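(* Let $f\in L^2(\Gamma)$, with $\int_\Gamma f\,ds=0$ if $c=0$. Let $u\in V$ and $u_h\in V^h$ be the solutions of $$a(u,v)=b(f,v)\quad\forall v\in V,\qquad a(u_h,v_h)=b(f,v_h)\quad\forall v_h\in V^h .$$ Then, with $M_h:=\sqrt{C_{e,h}^2+\kappa_h^2}$, $$\|u-u_h\|_a\le M_h\|f\|_b,\qquad \|u-u_h\|_b\le M_h\|u-u_h\|_a\le M_h^2\|f\|_b .$$
   Context: $\Omega\subset\mathbb{R}^2$ is a bounded polygonal domain with boundary $\Gamma=\partial\Omega$ and outward unit normal $\mathbf{n}$; $c\ge 0$ is a constant. $\|\cdot\|_{L^2}$ is the norm of $L^2(\Omega)$ or $(L^2(\Omega))^2$. If $c>0$, $V:=H^1(\Omega)$; if $c=0$, $V:=\{v\in H^1(\Omega):\int_\Gamma v\,ds=0\}$. Set $$a(u,v)=\int_\Omega(\nabla u\cdot\nabla v+c\,uv)\,dx,\quad b(u,v)=\int_\Gamma uv\,ds,\quad \|u\|_a=\sqrt{a(u,u)},\quad \|u\|_b=\sqrt{b(u,u)},$$ where functions in $V$ are identified with their traces on $\Gamma$ inside $b$. $\mathcal{T}_h$ is a shape-regular conforming triangulation of $\Omega$ such that each triangle has at most one edge on $\Gamma$. $P_1(K)$ (resp. $P_1(e)$) denotes the polynomials of degree at most $1$ on a triangle $K$ (resp. an edge $e$). The finite element spaces are: - $V^h:=\{v_h\in V: v_h|_K\in P_1(K)\ \forall K\in\mathcal{T}_h\}$; - $X_\Gamma^h:=\{v\in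 L^2(\Gamma): v|_e\in P_1(e)$ for every edge $e$ of $\mathcal{T}_h$ on $\Gamma\}$, with the additional requirement $\int_\Gamma v\,ds=0$ if $c=0$; - the Raviart--Thomas space of order one, $W^h:=\{p_h\in H(\operatorname{div},\Omega): p_h|_K=(a_K,b_K)^T+c_K\,(x,y)^T,\ a_K,b_K,c_K\in P_1(K)\ \forall K\in\mathcal{T}_h\}$; - $W^h_{f_h}:=\{p_h\in W^h: p_h\cdot\mathbf{n}=f_h \text{ on }\Gamma\}$ for $f_h\in X_\Gamma^h$. Here $H(\operatorname{div},\Omega)=\{q\in(L^2(\Omega))^2:\operatorname{div} q\in L^2(\Omega)\}$. The quantity $\kappa_h$ is $$\kappa_h:=\max_{f_h\in X_\Gamma^h\setminus\{0\}}\ \min_{\substack{v_h\in V^h,\ p_h\in W^h_{f_h}\\ \operatorname{div}p_h=c\,v_h}}\ \frac{\|\nabla v_h-p_h\|_{L^2}}{\|f_h\|_b}.$$ Let $\mathcal{T}_h^b$ be the set of triangles of $\mathcal{T}_h$ having an edge on $\Gamma$. For $K\in\mathcal{T}_h^b$ with boundary edge $e$, let $h_K$ be the longest edge length of $K$, $|e|$ the length of $e$, $|K|$ the area of $K$, and $$C_e(K):=0.574\sqrt{\frac{|e|}{|K|}}\,h_K,\qquad C_{e,h}:=\max_{K\in\mathcal{T}_h^b}C_e(K).$$ A known trace inequality that may be used: for every $v\in H^1(K)$ with $\int_e v\,ds=0$, $\|v\|_{L^2(e)}\le C_e(K)\,|v|_{H^1(K)}$, where $|v|_{H^1(K)}=\|\nabla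 v\|_{L^2(K)}$. *)

theory Defs
  imports "HOL-Analysis.Analysis"
begin

type_synonym plane = "real \<times> real"

section \<open>Square-integrable functions\<close>

text \<open>Elements of an \<open>L\<^sup>2\<close> space are represented by functions; every notion below depends only on
  their class modulo equality almost everywhere.\<close>

definition L2 :: "'a measure \<Rightarrow> ('a \<Rightarrow> 'b::euclidean_space) set" where
  "L2 M = {f \<in> borel_measurable M. integrable M (\<lambda>x. (norm (f x))\<^sup>2)}"

definition L2_norm :: "'a measure \<Rightarrow> ('a \<Rightarrow> 'b::euclidean_space) \<Rightarrow> real" where
  "L2_norm M f = sqrt (LINT x|M. (norm (f x))\<^sup>2)"

section \<open>Sobolev spaces\<close>

primrec C_k :: "nat \<Rightarrow> (plane \<Rightarrow> real) \<Rightarrow> bool" where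
  "C_k 0 f \<longleftrightarrow> continuous_on UNIV f"
| "C_k (Suc k) f \<longleftrightarrow>
     (\<exists>f\<^sub>1 f\<^sub>2. (\<forall>x. GDERIV f x :> (f\<^sub>1 x, f\<^sub>2 x)) \<and> C_k k f\<^sub>1 \<and> C_k k f\<^sub>2)"

definition C_inf :: "(plane \<Rightarrow> real) set" where
  "C_inf = {f. \<forall>k. C_k k f}"

definition grad :: "(plane \<Rightarrow> real) \<Rightarrow> plane \<Rightarrow> plane" where
  "grad f x = (THE D. GDERIV f x :> D)"

definition test_functions :: "plane set \<Rightarrow> (plane \<Rightarrow> real) set" where
  "test_functions \<Omega> =
     {\<phi> \<in> C_inf. compact (closure {x. \<phi> x \<noteq> 0}) \<and> closure {x. \<phi> x \<noteq> 0} \<subseteq> \<Omega>}"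

definition has_weak_grad :: "plane set \<Rightarrow> (plane \<Rightarrow> real) \<Rightarrow> (plane \<Rightarrow> plane) \<Rightarrow> bool" where
  "has_weak_grad \<Omega> v G \<longleftrightarrow>
     (\<forall>\<phi>\<in>test_functions \<Omega>.
        (LINT x|lebesgue_on \<Omega>. v x *\<^sub>R grad \<phi> x) = - (LINT x|lebesgue_on \<Omega>. \<phi> x *\<^sub>R G x))"

definition has_weak_div :: "plane set \<Rightarrow> (plane \<Rightarrow> plane) \<Rightarrow> (plane \<Rightarrow> real) \<Rightarrow> bool" where
  "has_weak_div \<Omega> p d \<longleftrightarrow>
     (\<forall>\<phi>\<in>test_functions \<Omega>.
        (LINT x|lebesgue_on \<Omega>. p x \<bullet> grad \<phi> x) = - (LINT x|lebesgue_on \<Omega>. d x * \<phi> x))"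

definition H1 :: "plane set \<Rightarrow> (plane \<Rightarrow> real) set" where
  "H1 \<Omega> = {v \<in> L2 (lebesgue_on \<Omega>). \<exists>G\<in>L2 (lebesgue_on \<Omega>). has_weak_grad \<Omega> v G}"

definition wgrad :: "plane set \<Rightarrow> (plane \<Rightarrow> real) \<Rightarrow> plane \<Rightarrow> plane" where
  "wgrad \<Omega> v = (SOME G. G \<in> L2 (lebesgue_on \<Omega>) \<and> has_weak_grad \<Omega> v G)"

definition H_div :: "plane set \<Rightarrow> (plane \<Rightarrow> plane) set" where
  "H_div \<Omega> = {p \<in> L2 (lebesgue_on \<Omega>). \<exists>d\<in>L2 (lebesgue_on \<Omega>). has_weak_div \<Omega> p d}"

section \<open>Polygonal domains and their triangulations\<close>

text \<open>The condition \<open>interior (closure \<Omega>) = \<Omega>\<close> says that \<open>\<Omega>\<close> lies on one side of its boundary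
  (no slits or punctures).\<close>

definition polygonal_domain :: "plane set \<Rightarrow> bool" where
  "polygonal_domain \<Omega> \<longleftrightarrow>
     open \<Omega> \<and> connected \<Omega> \<and> bounded \<Omega> \<and> \<Omega> \<noteq> {} \<and> interior (closure \<Omega>) = \<Omega> \<and>
     (\<exists>S. finite S \<and> frontier \<Omega> = (\<Union>(a, b)\<in>S. closed_segment a b))"

text \<open>\<^const>\<open>triangulation\<close> already contains conformity: two members meet in a common face.\<close>

definition triangulation_of :: "plane set \<Rightarrow> plane set set \<Rightarrow> bool" where
  "triangulation_of \<Omega> T \<longleftrightarrow> triangulation T \<and> (\<forall>K\<in>T. 2 simplex K) \<and> \<Union>T = closure \<Omega>"

definition longest_edge :: "plane set \<Rightarrow> real" where
  "longest_edge K = Max (diameter ` {e. e edge_of K})"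

definition area :: "plane set \<Rightarrow> real" where
  "area K = measure lebesgue K"

definition shape_regular :: "real \<Rightarrow> plane set set \<Rightarrow> bool" where
  "shape_regular \<sigma> T \<longleftrightarrow>
     (\<forall>K\<in>T. longest_edge K \<le> \<sigma> * Sup {2 * r | r x. 0 \<le> r \<and> cball x r \<subseteq> K})"

definition boundary_edges :: "plane set \<Rightarrow> plane set set \<Rightarrow> plane set set" where
  "boundary_edges \<Omega> T = {e. e \<subseteq> frontier \<Omega> \<and> (\<exists>K\<in>T. e edge_of K)}"

definition at_most_one_boundary_edge :: "plane set \<Rightarrow> plane set set \<Rightarrow> bool" where
  "at_most_one_boundary_edge \<Omega> T \<longleftrightarrow>
     (\<forall>K\<in>T. \<forall>e\<in>boundary_edges \<Omega> T. \<forall>e'\<in>boundary_edges \<Omega> T.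
        e edge_of K \<and> e' edge_of K \<longrightarrow> e = e')"

definition outward_normal :: "plane set \<Rightarrow> plane set \<Rightarrow> plane" where
  "outward_normal K e = (THE n. norm n = 1 \<and> (\<forall>x\<in>e. \<forall>y\<in>K. n \<bullet> (y - x) \<le> 0))"

section \<open>Arc length on the boundary\<close>

text \<open>Arc length on a segment, as the image of Lebesgue measure under a parametrization; it does not
  depend on the order of the end points.\<close>

definition segment_measure :: "plane set \<Rightarrow> plane measure" where
  "segment_measure e =
     (let (a, b) = (SOME (a, b). e = closed_segment a b) in
      scale_measure (ennreal (dist a b))
        (distr (restrict_space lborel {0..1}) borel (linepath a b)))"

text \<open>\<open>\<Gamma> = frontier \<Omega>\<close> is the union of the boundary edges, which overlap in end points only, so the
  following is the arc length measure \<open>ds\<close> on \<open>\<Gamma>\<close>.\<close>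

definition boundary_measure :: "plane set \<Rightarrow> plane set set \<Rightarrow> plane measure" where
  "boundary_measure \<Omega> T =
     measure_of (frontier \<Omega>) (sets (restrict_space borel (frontier \<Omega>)))
       (\<lambda>A. \<Sum>e\<in>boundary_edges \<Omega> T. emeasure (segment_measure e) A)"

section \<open>Traces and the variational spaces\<close>

text \<open>The trace operator is the continuous extension to \<open>H\<^sup>1(\<Omega>)\<close> of the restriction to \<open>\<Gamma>\<close> of smooth
  functions, which are dense in \<open>H\<^sup>1(\<Omega>)\<close>.\<close>

definition has_trace ::
  "plane set \<Rightarrow> plane set set \<Rightarrow> (plane \<Rightarrow> real) \<Rightarrow> (plane \<Rightarrow> real) \<Rightarrow> bool" where
  "has_trace \<Omega> T v g \<longleftrightarrow>
     g \<in> L2 (boundary_measure \<Omega> T) \<and>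
     (\<exists>\<phi>. (\<forall>n::nat. \<phi> n \<in> C_inf) \<and>
        (\<lambda>n. L2_norm (lebesgue_on \<Omega>) (\<lambda>x. \<phi> n x - v x)) \<longlonglongrightarrow> 0 \<and>
        (\<lambda>n. L2_norm (lebesgue_on \<Omega>) (\<lambda>x. grad (\<phi> n) x - wgrad \<Omega> v x)) \<longlonglongrightarrow> 0 \<and>
        (\<lambda>n. L2_norm (boundary_measure \<Omega> T) (\<lambda>x. \<phi> n x - g x)) \<longlonglongrightarrow> 0)"

definition bdry_trace :: "plane set \<Rightarrow> plane set set \<Rightarrow> (plane \<Rightarrow> real) \<Rightarrow> plane \<Rightarrow> real" where
  "bdry_trace \<Omega> T v = (SOME g. has_trace \<Omega> T v g)"

definition a_form ::
  "plane set \<Rightarrow> real \<Rightarrow> (plane \<Rightarrow> real) \<Rightarrow> (plane \<Rightarrow> real) \<Rightarrow> real" where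
  "a_form \<Omega> c u v = (LINT x|lebesgue_on \<Omega>. wgrad \<Omega> u x \<bullet> wgrad \<Omega> v x + c * u x * v x)"

definition a_norm :: "plane set \<Rightarrow> real \<Rightarrow> (plane \<Rightarrow> real) \<Rightarrow> real" where
  "a_norm \<Omega> c u = sqrt (a_form \<Omega> c u u)"

text \<open>\<open>b_form\<close> and \<open>b_norm\<close> act on functions on \<open>\<Gamma>\<close>; elements of \<open>V\<close> enter through their traces.\<close>

definition b_form ::
  "plane set \<Rightarrow> plane set set \<Rightarrow> (plane \<Rightarrow> real) \<Rightarrow> (plane \<Rightarrow> real) \<Rightarrow> real" where
  "b_form \<Omega> T f g = (LINT x|boundary_measure \<Omega> T. f x * g x)"

definition b_norm :: "plane set \<Rightarrow> plane set set \<Rightarrow> (plane \<Rightarrow> real) \<Rightarrow> real" where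
  "b_norm \<Omega> T f = sqrt (b_form \<Omega> T f f)"

definition L2_\<Gamma> :: "plane set \<Rightarrow> plane set set \<Rightarrow> real \<Rightarrow> (plane \<Rightarrow> real) set" where
  "L2_\<Gamma> \<Omega> T c =
     {f \<in> L2 (boundary_measure \<Omega> T). c = 0 \<longrightarrow> (LINT x|boundary_measure \<Omega> T. f x) = 0}"

text \<open>By the trace theorem every \<open>v \<in> H1 \<Omega>\<close> has a trace, so that requiring one excludes nothing.\<close>

definition V :: "plane set \<Rightarrow> plane set set \<Rightarrow> real \<Rightarrow> (plane \<Rightarrow> real) set" where
  "V \<Omega> T c =
     {v \<in> H1 \<Omega>. (\<exists>g. has_trace \<Omega> T v g) \<and>
        (c = 0 \<longrightarrow> (LINT x|boundary_measure \<Omega> T. bdry_trace \<Omega> T v x) = 0)}"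

section \<open>Finite element spaces\<close>

definition P1 :: "(plane \<Rightarrow> real) set" where
  "P1 = {\<lambda>(x, y). \<alpha> + \<beta> * x + \<gamma> * y | \<alpha> \<beta> \<gamma>. True}"

definition RT1 :: "(plane \<Rightarrow> plane) set" where
  "RT1 = {\<lambda>x. (a x, b x) + d x *\<^sub>R x | a b d. a \<in> P1 \<and> b \<in> P1 \<and> d \<in> P1}"

definition V_h :: "plane set \<Rightarrow> plane set set \<Rightarrow> real \<Rightarrow> (plane \<Rightarrow> real) set" where
  "V_h \<Omega> T c = {v \<in> V \<Omega> T c. \<forall>K\<in>T. \<exists>q\<in>P1. AE x in lebesgue_on K. v x = q x}"

text \<open>The polynomials of degree at most one on an edge are the restrictions of those on the plane.\<close>

definition X_h :: "plane set \<Rightarrow> plane set set \<Rightarrow> real \<Rightarrow> (plane \<Rightarrow> real) set" where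
  "X_h \<Omega> T c =
     {f \<in> L2_\<Gamma> \<Omega> T c.
        \<forall>e\<in>boundary_edges \<Omega> T. \<exists>q\<in>P1. AE x in segment_measure e. f x = q x}"

definition W_h :: "plane set \<Rightarrow> plane set set \<Rightarrow> (plane \<Rightarrow> plane) set" where
  "W_h \<Omega> T = {p \<in> H_div \<Omega>. \<forall>K\<in>T. \<exists>q\<in>RT1. AE x in lebesgue_on K. p x = q x}"

text \<open>The boundary values of \<open>p\<close> on an edge of \<open>K\<close> are those of the polynomial \<open>q\<close> which represents
  \<open>p\<close> on \<open>K\<close>; \<open>q\<close> is unique, since \<open>K\<close> has interior points.\<close>

definition W_h_f ::
  "plane set \<Rightarrow> plane set set \<Rightarrow> (plane \<Rightarrow> real) \<Rightarrow> (plane \<Rightarrow> plane) set" where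
  "W_h_f \<Omega> T f =
     {p \<in> W_h \<Omega> T. \<forall>K\<in>T. \<forall>e\<in>boundary_edges \<Omega> T. e edge_of K \<longrightarrow>
        (\<exists>q\<in>RT1. (AE x in lebesgue_on K. p x = q x) \<and>
           (AE x in segment_measure e. q x \<bullet> outward_normal K e = f x))}"

section \<open>The constants of the error estimate\<close>

text \<open>Maximum and minimum are rendered as supremum and infimum in \<open>[0, \<infinity>]\<close>, which agree with them
  when they are attained.\<close>

definition kappa_h :: "plane set \<Rightarrow> plane set set \<Rightarrow> real \<Rightarrow> ennreal" where
  "kappa_h \<Omega> T c =
     (SUP f\<in>{f \<in> X_h \<Omega> T c. b_norm \<Omega> T f \<noteq> 0}.
        INF (v, p)\<in>{(v, p). v \<in> V_h \<Omega> T c \<and> p \<in> W_h_f \<Omega> T f \<and>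
                            has_weak_div \<Omega> p (\<lambda>x. c * v x)}.
          ennreal (L2_norm (lebesgue_on \<Omega>) (\<lambda>x. wgrad \<Omega> v x - p x) / b_norm \<Omega> T f))"

definition C_e :: "plane set \<Rightarrow> plane set \<Rightarrow> real" where
  "C_e K e = 0.574 * sqrt (diameter e / area K) * longest_edge K"

definition C_eh :: "plane set \<Rightarrow> plane set set \<Rightarrow> real" where
  "C_eh \<Omega> T = Max {C_e K e | K e. K \<in> T \<and> e \<in> boundary_edges \<Omega> T \<and> e edge_of K}"

definition M_h :: "plane set \<Rightarrow> plane set set \<Rightarrow> real \<Rightarrow> ennreal" where
  "M_h \<Omega> T c =
     (if kappa_h \<Omega> T c = \<infinity> then \<infinity>
      else ennreal (sqrt ((C_eh \<Omega> T)\<^sup>2 + (enn2real (kappa_h \<Omega> T c))\<^sup>2)))"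

end

theory Submission
  imports Defs "HOL-Computational_Algebra.Polynomial"
begin

text \<open>Let \<open>w \<in> V\<close> be \<open>a\<close>-orthogonal to \<open>V\<^sup>h\<close>, let \<open>g \<in> L\<^sup>2(\<Gamma>)\<close>, and let \<open>g\<^sub>h\<close> be the mean value of \<open>g\<close> on each
  boundary edge. On the one hand \<open>b(g - g\<^sub>h, w) \<le> C \<parallel>g - g\<^sub>h\<parallel> \<parallel>\<nabla>w\<parallel>\<close> by the trace inequality on the boundary
  triangles. On the other hand Green's formula gives \<open>b(g\<^sub>h, w) = (p\<^sub>h, \<nabla>w) + (div p\<^sub>h, w) =
  (p\<^sub>h - \<nabla>v\<^sub>h, \<nabla>w) + a(v\<^sub>h, w)\<close> for all admissible \<open>v\<^sub>h, p\<^sub>h\<close>, and the last term vanishes, so that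
  \<open>b(g\<^sub>h, w) \<le> \<kappa>\<^sub>h \<parallel>g\<^sub>h\<parallel> \<parallel>\<nabla>w\<parallel>\<close>. Together, \<open>b(g, w) \<le> M\<^sub>h \<parallel>g\<parallel> \<parallel>\<nabla>w\<parallel>\<close>. Both estimates are instances with
  \<open>w = u - u\<^sub>h\<close>: take \<open>g = f\<close>, for which \<open>b(f, w) = a(w, w)\<close>, and \<open>g = w\<close>. No auxiliary boundary value
  problem has to be solved. If \<open>\<kappa>\<^sub>h = \<infinity>\<close>, only the degenerate products \<open>\<infinity> * 0\<close> carry information; they
  require that a function in \<open>V\<close> of vanishing \<open>a\<close>-norm has vanishing trace, which rests on the
  connectedness of \<open>\<Omega>\<close>.\<close>

section \<open>Integration over a triangle in polar coordinates\<close>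

text \<open>Edgewise means lie in \<open>X_h\<close>, so \<open>kappa_h\<close> applies to them, and
  they are orthogonal to \<open>g - edgewise_mean g\<close>; Pythagoras and Cauchy-Schwarz in the
  plane combine the two constants into \<open>sqrt (C\<^sup>2 + \<kappa>\<^sup>2)\<close>. That a
  triangle has at most one boundary edge enters twice: the gradient norms on the boundary triangles
  add up to no more than the norm on \<open>\<Omega>\<close>, and one polynomial per triangle
  represents both \<open>p\<close> and its boundary values. The main obstacle is Green's formula. A
  flux is only a piecewise polynomial function in \<open>H_div\<close>; nothing in its definition
  mentions normal components on inner edges. That their jumps vanish has to be extracted from the
  weak divergence with bump functions. Traces are limits of smooth functions, so Green's formula and
  the trace inequality are proved for smooth functions by explicit integration over triangles and
  carried over by limits in \<open>L2\<close>. A function of vanishing gradient is likewise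
  accessible through its smooth approximations, and is shown to be constant by comparing its
  integrals over boxes.\<close>

lemma fst_snd_borel_measurable [measurable]:
  "(fst :: plane \<Rightarrow> real) \<in> borel_measurable borel" "(snd :: plane \<Rightarrow> real) \<in> borel_measurable borel"
  by (intro borel_measurable_continuous_onI continuous_intros)+

lemma nn_integral_lborel_plane:
  fixes f :: "plane \<Rightarrow> ennreal"
  assumes "f \<in> borel_measurable borel"
  shows "(\<integral>\<^sup>+z. f z \<partial>lborel) = (\<integral>\<^sup>+x. \<integral>\<^sup>+y. f (x, y) \<partial>lborel \<partial>lborel)"
proof -
  have "f \<in> borel_measurable (lborel \<Otimes>\<^sub>M lborel)"
    using assms by (simp add: lborel_prod)
  from lborel.nn_integral_fst[OF this] show ?thesis
    by (simp add: lborel_prod)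
qed

text \<open>Two one-dimensional affine substitutions joined by Tonelli. The first coordinate is used
  to eliminate \<open>v\<close>, hence \<open>b1 \<noteq> 0\<close>.\<close>

lemma nn_integral_plane_affine1:
  fixes f :: "plane \<Rightarrow> ennreal" and p1 p2 a1 a2 b1 b2 :: real
  assumes [measurable]: "f \<in> borel_measurable borel" and b1: "b1 \<noteq> 0" and det: "a1 * b2 - a2 * b1 \<noteq> 0"
  shows "(\<integral>\<^sup>+z. f z \<partial>lborel) = ennreal \<bar>a1 * b2 - a2 * b1\<bar> *
     (\<integral>\<^sup>+u. \<integral>\<^sup>+v. f (p1 + u * a1 + v * b1, p2 + u * a2 + v * b2) \<partial>lborel \<partial>lborel)"
proof -
  \<comment> \<open>Solving \<open>x = p1 + u * a1 + v * b1\<close> for \<open>v\<close> makes the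
    second coordinate affine in \<open>u\<close> with slope \<open>c\<close>; up to sign,
    \<open>b1 * c\<close> is the determinant.\<close>
  define c where "c = a2 - a1 * b2 / b1"
  have c: "c \<noteq> 0" "\<bar>a1 * b2 - a2 * b1\<bar> = \<bar>b1\<bar> * \<bar>c\<bar>"
    using b1 det by (auto simp: c_def field_simps abs_mult[symmetric])
  have meas: "(\<lambda>(u,v). f (p1 + u * a1 + v * b1, p2 + u * a2 + v * b2)) \<in> borel_measurable (lborel \<Otimes>\<^sub>M lborel)"
    by measurable
  have A: "(\<integral>\<^sup>+x. f (x, p2 + u * a2 + (x - p1 - u * a1) * b2 / b1) \<partial>lborel) =
      ennreal \<bar>b1\<bar> * (\<integral>\<^sup>+v. f (p1 + u * a1 + v * b1, p2 + u * a2 + v * b2) \<partial>lborel)" for u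
    by (subst nn_integral_real_affine[where c = b1 and t = "p1 + u * a1"])
       (use b1 in \<open>auto simp: algebra_simps\<close>)
  have B: "(\<integral>\<^sup>+y. f (x, y) \<partial>lborel) =
      ennreal \<bar>c\<bar> * (\<integral>\<^sup>+u. f (x, p2 + u * a2 + (x - p1 - u * a1) * b2 / b1) \<partial>lborel)" for x
    by (subst nn_integral_real_affine[where c = c and t = "p2 + (x - p1) * b2 / b1"])
       (use b1 c in \<open>auto simp: algebra_simps c_def diff_divide_distrib add_divide_distrib\<close>)
  have "(\<integral>\<^sup>+z. f z \<partial>lborel) = (\<integral>\<^sup>+x. \<integral>\<^sup>+y. f (x, y) \<partial>lborel \<partial>lborel)"
    by (rule nn_integral_lborel_plane) measurable
  also have "\<dots> = ennreal \<bar>c\<bar> * (\<integral>\<^sup>+x. \<integral>\<^sup>+u. f (x, p2 + u * a2 + (x - p1 - u * a1) * b2 / b1) \<partial>lborel \<partial>lborel)"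
    unfolding B by (rule nn_integral_cmult) measurable
  also have "(\<integral>\<^sup>+x. \<integral>\<^sup>+u. f (x, p2 + u * a2 + (x - p1 - u * a1) * b2 / b1) \<partial>lborel \<partial>lborel) =
     (\<integral>\<^sup>+u. \<integral>\<^sup>+x. f (x, p2 + u * a2 + (x - p1 - u * a1) * b2 / b1) \<partial>lborel \<partial>lborel)"
    by (rule lborel_pair.Fubini'[symmetric]) measurable
  also have "\<dots> = ennreal \<bar>b1\<bar> * (\<integral>\<^sup>+u. \<integral>\<^sup>+v. f (p1 + u * a1 + v * b1, p2 + u * a2 + v * b2) \<partial>lborel \<partial>lborel)"
    unfolding A by (rule nn_integral_cmult) measurable
  finally show ?thesis
    unfolding c(2) by (simp add: ennreal_mult mult_ac)
qed

lemma nn_integral_plane_affine: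
  fixes f :: "plane \<Rightarrow> ennreal" and p1 p2 a1 a2 b1 b2 :: real
  assumes [measurable]: "f \<in> borel_measurable borel" and det: "a1 * b2 - a2 * b1 \<noteq> 0"
  shows "(\<integral>\<^sup>+z. f z \<partial>lborel) = ennreal \<bar>a1 * b2 - a2 * b1\<bar> *
     (\<integral>\<^sup>+u. \<integral>\<^sup>+v. f (p1 + u * a1 + v * b1, p2 + u * a2 + v * b2) \<partial>lborel \<partial>lborel)"
proof (cases "b1 = 0")
  case False
  then show ?thesis using nn_integral_plane_affine1[OF assms(1) False det] by simp
next
  case True
  \<comment> \<open>Exchanging the two parameters makes \<open>a1\<close> the pivot. This reverses
    the sign of the determinant, which the absolute value hides.\<close>
  then have a1: "a1 \<noteq> 0" using det by auto
  have "(\<integral>\<^sup>+u. \<integral>\<^sup>+v. f (p1 + u * a1 + v * b1, p2 + u * a2 + v * b2) \<partial>lborel \<partial>lborel) =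
     (\<integral>\<^sup>+v. \<integral>\<^sup>+u. f (p1 + v * b1 + u * a1, p2 + v * b2 + u * a2) \<partial>lborel \<partial>lborel)"
    by (subst lborel_pair.Fubini') (auto simp: algebra_simps)
  moreover have "\<bar>a1 * b2 - a2 * b1\<bar> = \<bar>b1 * a2 - b2 * a1\<bar>"
    by (simp add: abs_minus_commute algebra_simps)
  ultimately show ?thesis
    using nn_integral_plane_affine1[OF assms(1) a1, of b1 a2 b2 p1 p2] det
    by (simp add: algebra_simps)
qed

text \<open>The determinant of two plane vectors: twice the signed area of the triangle they span,
  the sign giving the orientation. It is also the inner product of \<open>v\<close> with
  \<open>w\<close> turned clockwise by a right angle, which is how it comes to describe
  fluxes.\<close>

definition cross :: "plane \<Rightarrow> plane \<Rightarrow> real" where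
  "cross v w = fst v * snd w - snd v * fst w"

text \<open>Relative to \<open>P\<close> the point has coefficients \<open>u - v\<close> and
  \<open>v\<close> with respect to \<open>a - P\<close> and \<open>b - P\<close>. The nonzero
  determinant makes them unique, so membership in the hull can be read off from them.\<close>

lemma triangle_eq_polar:
  fixes P a b :: plane
  assumes D: "cross (a - P) (b - P) \<noteq> 0"
  shows "P + u *\<^sub>R (a - P) + v *\<^sub>R (b - a) \<in> convex hull {P, a, b} \<longleftrightarrow> 0 \<le> v \<and> v \<le> u \<and> u \<le> 1"
proof
  assume "P + u *\<^sub>R (a - P) + v *\<^sub>R (b - a) \<in> convex hull {P, a, b}"
  then obtain s t where st: "0 \<le> s" "0 \<le> t" "s + t \<le> 1"
     and eq: "P + u *\<^sub>R (a - P) + v *\<^sub>R (b - a) = P + s *\<^sub>R (a - P) + t *\<^sub>R (b - P)"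
    unfolding convex_hull_3_alt by auto
  have e: "(u - v - s) *\<^sub>R (a - P) + (v - t) *\<^sub>R (b - P) = 0"
    using eq by (simp add: algebra_simps)
  have e1: "(u - v - s) * fst (a - P) + (v - t) * fst (b - P) = 0"
    using arg_cong[OF e, of fst] by simp
  have e2: "(u - v - s) * snd (a - P) + (v - t) * snd (b - P) = 0"
    using arg_cong[OF e, of snd] by simp
  have "(u - v - s) * cross (a - P) (b - P) = 0"
    using e1 e2 unfolding cross_def by algebra
  moreover have "(v - t) * cross (a - P) (b - P) = 0"
    using e1 e2 unfolding cross_def by algebra
  ultimately have "u - v = s" "v = t" using D by auto
  then show "0 \<le> v \<and> v \<le> u \<and> u \<le> 1" using st by auto
next
  assume "0 \<le> v \<and> v \<le> u \<and> u \<le> 1"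
  then show "P + u *\<^sub>R (a - P) + v *\<^sub>R (b - a) \<in> convex hull {P, a, b}"
    unfolding convex_hull_3_alt
    by (intro CollectI exI[of _ "u - v"] exI[of _ v]) (simp add: algebra_simps)
qed

text \<open>Polar coordinates of a triangle centred at the vertex \<open>P\<close>: \<open>r\<close> runs from \<open>P\<close> to the opposite edge,
  along which \<open>s\<close> runs from \<open>a\<close> to \<open>b\<close>.\<close>

definition polar_map :: "plane \<Rightarrow> plane \<Rightarrow> plane \<Rightarrow> real \<times> real \<Rightarrow> plane" where
  "polar_map P a b = (\<lambda>z. P + fst z *\<^sub>R (linepath a b (snd z) - P))"

lemma continuous_polar_map [continuous_intros]:
  "continuous_on S g \<Longrightarrow> continuous_on S (\<lambda>x. polar_map P a b (g x))"
  unfolding polar_map_def linepath_def by (intro continuous_intros)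

lemma polar_map_measurable [measurable]: "polar_map P a b \<in> borel_measurable borel"
  by (intro borel_measurable_continuous_onI continuous_intros)

lemma cross_triangle: "cross (a - P) (b - a) = cross (a - P) (b - P)"
  by (simp add: cross_def algebra_simps)

text \<open>Affine coordinates \<open>u\<close>, \<open>v\<close> followed by the substitution
  \<open>v = u * s\<close>, which contributes the factor \<open>fst z\<close>. It degenerates only
  at \<open>u = 0\<close>, a null set.\<close>

lemma nn_integral_triangle_polar:
  fixes P a b :: plane and f :: "plane \<Rightarrow> ennreal"
  assumes D: "cross (a - P) (b - P) \<noteq> 0" and [measurable]: "f \<in> borel_measurable borel"
  shows "(\<integral>\<^sup>+z. f z * indicator (convex hull {P, a, b}) z \<partial>lborel) =
    (\<integral>\<^sup>+z. ennreal (\<bar>cross (a - P) (b - P)\<bar> * fst z) * f (polar_map P a b z) * indicator (cbox (0,0) (1,1)) z \<partial>lborel)"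
proof -
  let ?K = "convex hull {P, a, b}" and ?D = "cross (a - P) (b - P)"
  have [measurable]: "?K \<in> sets borel"
    by (intro borel_closed compact_imp_closed finite_imp_compact_convex_hull) auto
  have det: "fst (a - P) * snd (b - a) - snd (a - P) * fst (b - a) = ?D"
    by (simp add: cross_def algebra_simps)
  have inner: "(\<integral>\<^sup>+v. f (P + u *\<^sub>R (a - P) + v *\<^sub>R (b - a)) * indicator ?K (P + u *\<^sub>R (a - P) + v *\<^sub>R (b - a)) \<partial>lborel) =
    (\<integral>\<^sup>+s. ennreal u * f (polar_map P a b (u, s)) * indicator (cbox (0,0) (1,1)) (u, s) \<partial>lborel)"
    if "u \<noteq> 0" for u
  proof -
    have "(\<integral>\<^sup>+v. f (P + u *\<^sub>R (a - P) + v *\<^sub>R (b - a)) * indicator ?K (P + u *\<^sub>R (a - P) + v *\<^sub>R (b - a)) \<partial>lborel) =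
       ennreal \<bar>u\<bar> * (\<integral>\<^sup>+s. f (P + u *\<^sub>R (a - P) + (u * s) *\<^sub>R (b - a)) * indicator ?K (P + u *\<^sub>R (a - P) + (u * s) *\<^sub>R (b - a)) \<partial>lborel)"
      by (subst nn_integral_real_affine[where c = u and t = 0]) (use that in auto)
    also have "\<dots> = (\<integral>\<^sup>+s. ennreal \<bar>u\<bar> * (f (P + u *\<^sub>R (a - P) + (u * s) *\<^sub>R (b - a)) * indicator ?K (P + u *\<^sub>R (a - P) + (u * s) *\<^sub>R (b - a))) \<partial>lborel)"
      by (rule nn_integral_cmult[symmetric]) measurable
    also have "\<dots> = (\<integral>\<^sup>+s. ennreal u * f (polar_map P a b (u, s)) * indicator (cbox (0,0) (1,1)) (u, s) \<partial>lborel)"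
    proof (rule nn_integral_cong)
      fix s
      have 1: "P + u *\<^sub>R (a - P) + (u * s) *\<^sub>R (b - a) = polar_map P a b (u, s)"
        unfolding polar_map_def linepath_def by (simp add: algebra_simps)
      \<comment> \<open>For \<open>u < 0\<close> both sides are false: \<open>0 \<le> u * s\<close>
        and \<open>u * s \<le> u\<close> cannot hold together.\<close>
      have 2: "polar_map P a b (u, s) \<in> ?K \<longleftrightarrow> (u, s) \<in> cbox (0,0) (1,1)"
        unfolding 1[symmetric] triangle_eq_polar[OF D] using that
        by (cases "u > 0") (auto simp: zero_le_mult_iff mult_le_cancel_left1)
      show "ennreal \<bar>u\<bar> * (f (P + u *\<^sub>R (a - P) + (u * s) *\<^sub>R (b - a)) * indicator ?K (P + u *\<^sub>R (a - P) + (u * s) *\<^sub>R (b - a))) =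
        ennreal u * f (polar_map P a b (u, s)) * indicator (cbox (0,0) (1,1)) (u, s)"
        unfolding 1 using 2 by (auto simp: indicator_def mult_ac)
    qed
    finally show ?thesis .
  qed
  have "(\<integral>\<^sup>+z. f z * indicator ?K z \<partial>lborel) = ennreal \<bar>?D\<bar> *
     (\<integral>\<^sup>+u. \<integral>\<^sup>+v. f (P + u *\<^sub>R (a - P) + v *\<^sub>R (b - a)) * indicator ?K (P + u *\<^sub>R (a - P) + v *\<^sub>R (b - a)) \<partial>lborel \<partial>lborel)"
  proof -
    have e: "(fst P + u * fst (a - P) + v * fst (b - a), snd P + u * snd (a - P) + v * snd (b - a)) =
      P + u *\<^sub>R (a - P) + v *\<^sub>R (b - a)" for u v
      by (simp add: prod_eq_iff)
    show ?thesis
      using nn_integral_plane_affine[of "\<lambda>z. f z * indicator ?K z", OF _ D[folded det], of "fst P" "snd P"]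
      unfolding e det by simp
  qed
  also have "(\<integral>\<^sup>+u. \<integral>\<^sup>+v. f (P + u *\<^sub>R (a - P) + v *\<^sub>R (b - a)) * indicator ?K (P + u *\<^sub>R (a - P) + v *\<^sub>R (b - a)) \<partial>lborel \<partial>lborel) =
     (\<integral>\<^sup>+u. \<integral>\<^sup>+s. ennreal u * f (polar_map P a b (u, s)) * indicator (cbox (0,0) (1,1)) (u, s) \<partial>lborel \<partial>lborel)"
    by (rule nn_integral_cong_AE) (use inner AE_lborel_singleton[of 0] in auto)
  also have "\<dots> = (\<integral>\<^sup>+z. ennreal (fst z) * f (polar_map P a b z) * indicator (cbox (0,0) (1,1)) z \<partial>lborel)"
    by (subst nn_integral_lborel_plane) auto
  also have "ennreal \<bar>?D\<bar> * \<dots> = (\<integral>\<^sup>+z. ennreal \<bar>?D\<bar> * (ennreal (fst z) * f (polar_map P a b z) * indicator (cbox (0,0) (1,1)) z) \<partial>lborel)"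
    by (rule nn_integral_cmult[symmetric]) measurable
  also have "\<dots> = (\<integral>\<^sup>+z. ennreal (\<bar>?D\<bar> * fst z) * f (polar_map P a b z) * indicator (cbox (0,0) (1,1)) z \<partial>lborel)"
    by (rule nn_integral_cong) (auto simp: indicator_def ennreal_mult' mult_ac)
  finally show ?thesis .
qed

text \<open>The nonnegative case, applied to indicators, identifies Lebesgue measure on the triangle
  as the image of a weighted measure on the unit square, so integrals of signed functions transfer
  as well. Continuity of \<open>f\<close> then permits an iterated integral.\<close>

lemma lebesgue_on_triangle_polar:
  fixes P a b :: plane and f :: "plane \<Rightarrow> real"
  assumes D: "cross (a - P) (b - P) \<noteq> 0" and f: "continuous_on UNIV f"
  shows "(LINT x|lebesgue_on (convex hull {P, a, b}). f x) =
    \<bar>cross (a - P) (b - P)\<bar> * integral {0..1} (\<lambda>r. r * integral {0..1} (\<lambda>s. f (polar_map P a b (r, s))))"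
proof -
  let ?K = "convex hull {P, a, b}" and ?D = "cross (a - P) (b - P)"
  have K [measurable]: "?K \<in> sets borel"
    by (intro borel_closed compact_imp_closed finite_imp_compact_convex_hull) auto
  have f' [measurable]: "f \<in> borel_measurable borel" by (rule borel_measurable_continuous_onI[OF f])
  let ?w = "\<lambda>z. \<bar>?D\<bar> * fst z * indicator (cbox (0,0) (1,1)) z :: real"
  have [measurable]: "?w \<in> borel_measurable borel"
    by (intro borel_measurable_times borel_measurable_indicator borel_measurable_continuous_onI continuous_intros) auto
  have wnn: "0 \<le> ?w z" for z by (auto simp: indicator_def cbox_Pair_eq)
  have eq: "density lborel (indicator ?K) = distr (density lborel (\<lambda>z. ennreal (?w z))) borel (polar_map P a b)"
  proof (rule measure_eqI)
    fix A assume "A \<in> sets (density lborel (indicator ?K))"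
    then have A [measurable]: "A \<in> sets borel" by simp
    have "emeasure (density lborel (indicator ?K)) A = (\<integral>\<^sup>+z. indicator A z * indicator ?K z \<partial>lborel)"
      by (subst emeasure_density) (auto simp: mult.commute)
    also have "\<dots> = (\<integral>\<^sup>+z. ennreal (\<bar>?D\<bar> * fst z) * indicator A (polar_map P a b z) * indicator (cbox (0,0) (1,1)) z \<partial>lborel)"
      by (rule nn_integral_triangle_polar[OF D]) measurable
    also have "\<dots> = (\<integral>\<^sup>+z. ennreal (?w z) * indicator (polar_map P a b -` A) z \<partial>lborel)"
      by (rule nn_integral_cong) (auto simp: indicator_def)
    also have "\<dots> = emeasure (density lborel (\<lambda>z. ennreal (?w z))) (polar_map P a b -` A)"
      by (subst emeasure_density) (auto simp: in_borel_measurable_borel[THEN iffD1, OF polar_map_measurable, rule_format, simplified])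
    also have "\<dots> = emeasure (distr (density lborel (\<lambda>z. ennreal (?w z))) borel (polar_map P a b)) A"
      by (subst emeasure_distr) auto
    finally show "emeasure (density lborel (indicator ?K)) A = emeasure (distr (density lborel (\<lambda>z. ennreal (?w z))) borel (polar_map P a b)) A" .
  qed simp
  have "(LINT x|lebesgue_on ?K. f x) = (LINT x|lborel. indicator ?K x *\<^sub>R f x)"
    by (subst integral_restrict_space) (auto intro!: integral_completion simp del: real_scaleR_def)
  also have "\<dots> = (LINT x|density lborel (indicator ?K). f x)"
    by (subst integral_density[symmetric, where g = "indicator ?K"]) (auto simp: ennreal_indicator)
  also have "\<dots> = (LINT z|density lborel (\<lambda>z. ennreal (?w z)). f (polar_map P a b z))"
    unfolding eq by (rule integral_distr) auto
  also have "\<dots> = (LINT z|lborel. ?w z *\<^sub>R f (polar_map P a b z))"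
    by (rule integral_density) (auto simp: wnn)
  also have "\<dots> = (LINT z:cbox (0,0) (1,1)|lborel. \<bar>?D\<bar> * (fst z * f (polar_map P a b z)))"
    unfolding set_lebesgue_integral_def by (rule Bochner_Integration.integral_cong) (auto simp: algebra_simps)
  also have "\<dots> = integral (cbox (0,0) (1,1)) (\<lambda>z. \<bar>?D\<bar> * (fst z * f (polar_map P a b z)))"
    by (rule set_borel_integral_eq_integral, unfold set_integrable_def, rule borel_integrable_compact)
       (auto intro!: continuous_intros continuous_on_compose2[OF f])
  also have "\<dots> = \<bar>?D\<bar> * integral (cbox (0,0) (1,1)) (\<lambda>z. fst z * f (polar_map P a b z))"
    by simp
  also have "integral (cbox (0,0) (1,1)) (\<lambda>z. fst z * f (polar_map P a b z)) =
      integral (cbox 0 1) (\<lambda>r. integral (cbox 0 1) (\<lambda>s. fst (r, s) * f (polar_map P a b (r, s))))"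
    by (rule integral_prod_continuous) (auto intro!: continuous_intros continuous_on_compose2[OF f])
  finally show ?thesis by simp
qed

section \<open>Green's formula and the trace inequality on a triangle\<close>

definition C1_with_grad :: "(plane \<Rightarrow> real) \<Rightarrow> (plane \<Rightarrow> plane) \<Rightarrow> bool" where
  "C1_with_grad \<phi> g \<longleftrightarrow> (\<forall>x. GDERIV \<phi> x :> g x) \<and> continuous_on UNIV g"

lemma C1_continuous_grad: "C1_with_grad \<phi> g \<Longrightarrow> continuous_on UNIV g"
  by (simp add: C1_with_grad_def)

lemma C1_continuous: "C1_with_grad \<phi> g \<Longrightarrow> continuous_on UNIV \<phi>"
  unfolding C1_with_grad_def gderiv_def
  by (meson continuous_at_imp_continuous_on has_derivative_continuous)

lemma C1_along_curve:
  assumes "C1_with_grad \<phi> g" "(\<gamma> has_vector_derivative \<gamma>') (at t within S)"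
  shows "((\<lambda>t. \<phi> (\<gamma> t)) has_real_derivative (g (\<gamma> t) \<bullet> \<gamma>')) (at t within S)"
proof -
  have "(\<phi> has_derivative (\<lambda>h. h \<bullet> g (\<gamma> t))) (at (\<gamma> t))"
    using assms(1) unfolding C1_with_grad_def gderiv_def by blast
  from vector_derivative_diff_chain_within[OF assms(2) has_derivative_at_withinI[OF this]]
  show ?thesis
    by (simp add: has_real_derivative_iff_has_vector_derivative o_def inner_commute)
qed

lemma polar_map_deriv_angle:
  "((\<lambda>s. polar_map P a b (r, s)) has_vector_derivative r *\<^sub>R (b - a)) (at s within S)"
  unfolding polar_map_def linepath_def
  by (auto intro!: derivative_eq_intros simp: algebra_simps)

lemma polar_map_deriv_radius:
  "((\<lambda>r. polar_map P a b (r, s)) has_vector_derivative (linepath a b s - P)) (at r within S)"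
  unfolding polar_map_def
  by (auto intro!: derivative_eq_intros)

lemma polar_map_edges [simp]:
  "polar_map P a b (r, 0) = linepath P a r" "polar_map P a b (r, 1) = linepath P b r"
  "polar_map P a b (1, s) = linepath a b s" "polar_map P a b (0, s) = P"
  by (auto simp: polar_map_def linepath_def algebra_simps)

text \<open>Normalised to a parameter interval of length one: in the flux terms below, the edge
  length is carried by the vector \<open>b - a\<close>.\<close>

definition edge_mean :: "(plane \<Rightarrow> real) \<Rightarrow> plane \<Rightarrow> plane \<Rightarrow> real" where
  "edge_mean f a b = integral {0..1} (\<lambda>t. f (linepath a b t))"

lemma edge_mean_commute: "edge_mean f a b = edge_mean f b a"
proof -
  have "integral {0..1::real} (\<lambda>t. f (linepath a b t)) = integral {-1..-0} (\<lambda>t. f (linepath a b (-t)))"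
    using Henstock_Kurzweil_Integration.integral_reflect_real[of 1 0 "\<lambda>t. f (linepath a b t)"] by simp
  also have "\<dots> = integral {0..1} (\<lambda>t. f (linepath a b (-(t - 1))))"
    using integral_shift_real_ivl[of "-1" "-1" "0" "\<lambda>t. f (linepath a b (-t))"] by simp
  also have "\<dots> = integral {0..1} (\<lambda>t. f (linepath b a t))"
    by (simp add: linepath_def algebra_simps)
  finally show ?thesis by (simp add: edge_mean_def)
qed

lemma continuous_imp_integrable_compact:
  fixes f :: "plane \<Rightarrow> real"
  assumes f: "continuous_on UNIV f" and K: "compact K"
  shows "integrable (lebesgue_on K) f"
proof -
  have "integrable lborel (\<lambda>x. indicator K x *\<^sub>R f x)"
    by (rule borel_integrable_compact[OF K continuous_on_subset[OF f]]) simp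
  then have "integrable lebesgue (\<lambda>x. indicator K x *\<^sub>R f x)"
    by (rule integrable_completion[THEN iffD2, rotated])
       (use borel_measurable_continuous_onI[OF f] K in \<open>auto simp: compact_imp_closed\<close>)
  then show ?thesis
    by (subst integrable_restrict_space) (use K in \<open>auto simp: compact_imp_closed\<close>)
qed

text \<open>In polar coordinates the derivative in direction \<open>b - a\<close>, multiplied by the
  Jacobian factor \<open>r\<close>, is exactly the \<open>s\<close>-derivative of
  \<open>\<phi>\<close>. The fundamental theorem in \<open>s\<close> leaves the values on the two
  sides through \<open>P\<close>.\<close>

lemma triangle_deriv_edge:
  assumes D: "cross (a - P) (b - P) \<noteq> 0" and \<phi>: "C1_with_grad \<phi> g"
  shows "(LINT x|lebesgue_on (convex hull {P, a, b}). g x \<bullet> (b - a)) =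
    \<bar>cross (a - P) (b - P)\<bar> * (edge_mean \<phi> P b - edge_mean \<phi> P a)"
proof -
  have g: "continuous_on UNIV g" "continuous_on UNIV \<phi>" using C1_continuous_grad[OF \<phi>] C1_continuous[OF \<phi>] .
  have "r * integral {0..1} (\<lambda>s. g (polar_map P a b (r, s)) \<bullet> (b - a)) = \<phi> (linepath P b r) - \<phi> (linepath P a r)" for r
  proof -
    have "((\<lambda>s. g (polar_map P a b (r, s)) \<bullet> (r *\<^sub>R (b - a))) has_integral
       (\<phi> (polar_map P a b (r, 1)) - \<phi> (polar_map P a b (r, 0)))) {0..1}"
      by (rule fundamental_theorem_of_calculus)
         (simp_all only: has_real_derivative_iff_has_vector_derivative[symmetric] C1_along_curve[OF \<phi> polar_map_deriv_angle] zero_le_one)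
    from integral_unique[OF this] show ?thesis by simp
  qed
  then have "integral {0..1} (\<lambda>r. r * integral {0..1} (\<lambda>s. g (polar_map P a b (r, s)) \<bullet> (b - a))) =
      integral {0..1} (\<lambda>r. \<phi> (linepath P b r) - \<phi> (linepath P a r))"
    by simp
  also have "\<dots> = edge_mean \<phi> P b - edge_mean \<phi> P a"
    unfolding edge_mean_def
    by (rule Henstock_Kurzweil_Integration.integral_diff)
       (auto intro!: integrable_continuous_interval continuous_on_compose2[OF g(2)] continuous_intros)
  finally show ?thesis
    by (subst lebesgue_on_triangle_polar[OF D]) (auto intro!: continuous_intros g)
qed

text \<open>Cramer's rule, kept free of division.\<close>

lemma cross_decompose: "cross A B *\<^sub>R w = cross w B *\<^sub>R A + cross A w *\<^sub>R (B::plane)"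
  by (simp add: cross_def prod_eq_iff algebra_simps)

text \<open>Cramer's rule expands \<open>w\<close> in the edge vectors \<open>a - P\<close> and
  \<open>b - a\<close>; the derivative along each of them is integrated in polar coordinates centred
  at the opposite vertex. The factor \<open>sgn\<close> is what remains of
  \<open>\<bar>D\<bar> / D\<close>.\<close>

lemma Green_triangle_const:
  assumes D: "cross (a - P) (b - P) \<noteq> 0" and \<phi>: "C1_with_grad \<phi> g"
  shows "(LINT x|lebesgue_on (convex hull {P, a, b}). g x \<bullet> w) =
    sgn (cross (a - P) (b - P)) *
     (cross w (b - a) * edge_mean \<phi> a b + cross w (P - b) * edge_mean \<phi> b P + cross w (a - P) * edge_mean \<phi> P a)"
proof -
  let ?K = "convex hull {P, a, b}" and ?D = "cross (a - P) (b - P)"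
  have K: "compact ?K" by (intro finite_imp_compact_convex_hull) auto
  have g: "continuous_on UNIV g" using C1_continuous_grad[OF \<phi>] .
  have int: "integrable (lebesgue_on ?K) (\<lambda>x. g x \<bullet> v)" for v
    by (intro continuous_imp_integrable_compact K continuous_intros g)
  have D': "cross (P - b) (a - b) = ?D" "\<bar>cross (P - b) (a - b)\<bar> = \<bar>?D\<bar>"
    by (auto simp: cross_def algebra_simps)
  have K': "convex hull {b, P, a} = ?K" by (simp add: insert_commute)
  have e1: "(LINT x|lebesgue_on ?K. g x \<bullet> (b - a)) = \<bar>?D\<bar> * (edge_mean \<phi> b P - edge_mean \<phi> P a)"
    using triangle_deriv_edge[OF D \<phi>] by (simp add: edge_mean_commute)
  have e2: "(LINT x|lebesgue_on ?K. g x \<bullet> (a - P)) = \<bar>?D\<bar> * (edge_mean \<phi> a b - edge_mean \<phi> b P)"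
    using triangle_deriv_edge[of P b a, OF _ \<phi>] D unfolding K' D' by (simp add: edge_mean_commute)
  have "g x \<bullet> (?D *\<^sub>R w) = cross w (b - a) * (g x \<bullet> (a - P)) + cross (a - P) w * (g x \<bullet> (b - a))" for x
    using arg_cong[OF cross_decompose[of "a - P" "b - a" w], of "\<lambda>v. g x \<bullet> v"]
    by (simp only: inner_add_right inner_scaleR_right cross_triangle)
  then have "(LINT x|lebesgue_on ?K. ?D * (g x \<bullet> w)) = (LINT x|lebesgue_on ?K. cross w (b - a) * (g x \<bullet> (a - P)) + cross (a - P) w * (g x \<bullet> (b - a)))"
    by simp
  also have "\<dots> = cross w (b - a) * (LINT x|lebesgue_on ?K. g x \<bullet> (a - P)) + cross (a - P) w * (LINT x|lebesgue_on ?K. g x \<bullet> (b - a))"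
    by (subst Bochner_Integration.integral_add) (auto intro!: integrable_mult_right int)
  also have "\<dots> = \<bar>?D\<bar> * (cross w (b - a) * (edge_mean \<phi> a b - edge_mean \<phi> b P) + cross (a - P) w * (edge_mean \<phi> b P - edge_mean \<phi> P a))"
    unfolding e1 e2 by (simp add: algebra_simps)
  also have "cross w (b - a) * (edge_mean \<phi> a b - edge_mean \<phi> b P) + cross (a - P) w * (edge_mean \<phi> b P - edge_mean \<phi> P a) =
    (cross w (b - a) * edge_mean \<phi> a b + cross w (P - b) * edge_mean \<phi> b P + cross w (a - P) * edge_mean \<phi> P a)"
    by (simp add: cross_def algebra_simps)
  finally have "?D * (LINT x|lebesgue_on ?K. g x \<bullet> w) = \<bar>?D\<bar> *
     (cross w (b - a) * edge_mean \<phi> a b + cross w (P - b) * edge_mean \<phi> b P + cross w (a - P) * edge_mean \<phi> P a)"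
    by simp
  then have "?D * (LINT x|lebesgue_on ?K. g x \<bullet> w) = ?D * (sgn ?D *
     (cross w (b - a) * edge_mean \<phi> a b + cross w (P - b) * edge_mean \<phi> b P + cross w (a - P) * edge_mean \<phi> P a))"
    by (simp only: abs_sgn mult.assoc)
  then show ?thesis using mult_left_cancel[OF D] by blast
qed

text \<open>The divergence theorem before normals are introduced: \<open>cross F (b - a)\<close> is
  edge length times the normal component of \<open>F\<close>, with the normal to the right of the
  direction from \<open>a\<close> to \<open>b\<close>; \<open>sgn\<close> corrects for the
  orientation of \<open>P\<close>, \<open>a\<close>, \<open>b\<close>.\<close>

lemma Green_triangle:
  assumes D: "cross (a - P) (b - P) \<noteq> 0" and 1: "C1_with_grad F1 G1" and 2: "C1_with_grad F2 G2"
  shows "(LINT x|lebesgue_on (convex hull {P, a, b}). fst (G1 x) + snd (G2 x)) =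
    sgn (cross (a - P) (b - P)) *
     (edge_mean (\<lambda>x. cross (F1 x, F2 x) (b - a)) a b + edge_mean (\<lambda>x. cross (F1 x, F2 x) (P - b)) b P
      + edge_mean (\<lambda>x. cross (F1 x, F2 x) (a - P)) P a)"
proof -
  let ?K = "convex hull {P, a, b}"
  have K: "compact ?K" by (intro finite_imp_compact_convex_hull) auto
  have c: "continuous_on UNIV G1" "continuous_on UNIV G2" "continuous_on UNIV F1" "continuous_on UNIV F2"
    using C1_continuous_grad[OF 1] C1_continuous_grad[OF 2] C1_continuous[OF 1] C1_continuous[OF 2] by auto
  have m: "edge_mean (\<lambda>x. cross (F1 x, F2 x) v) x y = cross (1,0) v * edge_mean F1 x y + cross (0,1) v * edge_mean F2 x y" for v x y
  proof -
    have "integral {0..1} (\<lambda>t. F1 (linepath x y t) * snd v + F2 (linepath x y t) * (- fst v)) =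
       integral {0..1} (\<lambda>t. F1 (linepath x y t) * snd v) + integral {0..1} (\<lambda>t. F2 (linepath x y t) * (- fst v))"
      by (rule Henstock_Kurzweil_Integration.integral_add)
         (auto intro!: integrable_continuous_interval continuous_on_compose2[OF c(3)] continuous_on_compose2[OF c(4)] continuous_intros)
    then show ?thesis
      by (simp add: edge_mean_def cross_def)
  qed
  have "(LINT x|lebesgue_on ?K. fst (G1 x) + snd (G2 x)) = (LINT x|lebesgue_on ?K. G1 x \<bullet> (1,0) + G2 x \<bullet> (0,1))"
    by (simp add: inner_prod_def)
  also have "\<dots> = (LINT x|lebesgue_on ?K. G1 x \<bullet> (1,0)) + (LINT x|lebesgue_on ?K. G2 x \<bullet> (0,1))"
    by (rule Bochner_Integration.integral_add)
       (intro continuous_imp_integrable_compact K continuous_intros c)+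
  also have "\<dots> = sgn (cross (a - P) (b - P)) *
     (edge_mean (\<lambda>x. cross (F1 x, F2 x) (b - a)) a b + edge_mean (\<lambda>x. cross (F1 x, F2 x) (P - b)) b P
      + edge_mean (\<lambda>x. cross (F1 x, F2 x) (a - P)) P a)"
    unfolding Green_triangle_const[OF D 1] Green_triangle_const[OF D 2] m
    by (simp add: algebra_simps)
  finally show ?thesis .
qed

section \<open>One-dimensional inequalities and the trace inequality\<close>

lemma integral_square_primitive_le:
  fixes k :: "real \<Rightarrow> real"
  assumes k: "continuous_on {x..y} k" and xy: "x \<le> y"
  shows "(integral {x..y} k)\<^sup>2 \<le> (y - x) * integral {x..y} (\<lambda>s. (k s)\<^sup>2)"
proof (cases "x = y")
  case True then show ?thesis by simp
next
  case False
  define G where "G = integral {x..y} k"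
  \<comment> \<open>With \<open>m\<close> the mean of \<open>k\<close>, nonnegativity of the
    integral of \<open>(k - m)\<^sup>2\<close> is the Cauchy-Schwarz inequality against the constant
    1.\<close>
  define m where "m = G / (y - x)"
  have int: "k integrable_on {x..y}" "(\<lambda>s. (k s)\<^sup>2) integrable_on {x..y}"
    by (intro integrable_continuous_interval continuous_intros k)+
  have "0 \<le> integral {x..y} (\<lambda>s. (k s - m)\<^sup>2)"
    by (rule integral_nonneg) (auto intro!: integrable_continuous_interval continuous_intros k)
  also have "\<dots> = integral {x..y} (\<lambda>s. ((k s)\<^sup>2 - 2 * m * k s) + m\<^sup>2)"
    by (simp add: power2_diff algebra_simps)
  also have "\<dots> = integral {x..y} (\<lambda>s. (k s)\<^sup>2 - 2 * m * k s) + m\<^sup>2 * (y - x)"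
    using xy by (subst Henstock_Kurzweil_Integration.integral_add) (auto intro!: integrable_continuous_interval continuous_intros k)
  also have "integral {x..y} (\<lambda>s. (k s)\<^sup>2 - 2 * m * k s) = integral {x..y} (\<lambda>s. (k s)\<^sup>2) - 2 * m * G"
    unfolding G_def by (subst Henstock_Kurzweil_Integration.integral_diff) (auto intro!: integrable_continuous_interval continuous_intros k)
  also have "integral {x..y} (\<lambda>s. (k s)\<^sup>2) - 2 * m * G + m\<^sup>2 * (y - x) = integral {x..y} (\<lambda>s. (k s)\<^sup>2) - G\<^sup>2 / (y - x)"
  proof -
    have "m\<^sup>2 * (y - x) = m * G" "m * G = G\<^sup>2 / (y - x)"
      using False by (simp_all add: m_def power2_eq_square)
    then show ?thesis by simp
  qed
  finally show ?thesis
    using False xy by (simp add: G_def field_simps)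
qed

text \<open>As the total integral vanishes, the primitive can be estimated from either end.
  Weighting the two estimates by \<open>1 - s\<close> and \<open>s\<close> gives the factor
  \<open>s * (1 - s)\<close>, whose integral is \<open>1 / 6\<close>.\<close>

lemma integral_primitive_square_le:
  fixes k :: "real \<Rightarrow> real"
  assumes k: "continuous_on {0..1} k" and z: "integral {0..1} k = 0"
  shows "integral {0..1} (\<lambda>s. (integral {0..s} k)\<^sup>2) \<le> integral {0..1} (\<lambda>s. (k s)\<^sup>2) / 6"
proof -
  define N where "N = integral {0..1} (\<lambda>s. (k s)\<^sup>2)"
  have i1: "k integrable_on {0..1}" by (intro integrable_continuous_interval k)
  have i2: "(\<lambda>s. (k s)\<^sup>2) integrable_on {0..1}" by (intro integrable_continuous_interval continuous_intros k)
  have le: "(integral {0..s} k)\<^sup>2 \<le> N * (s - s\<^sup>2)" if s: "s \<in> {0..1}" for s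
  proof -
    define A B where "A = integral {0..s} (\<lambda>s. (k s)\<^sup>2)" and "B = integral {s..1} (\<lambda>s. (k s)\<^sup>2)"
    have AB: "A + B = N" unfolding A_def B_def N_def
      by (rule Henstock_Kurzweil_Integration.integral_combine) (use s i2 in auto)
    have "integral {0..s} k + integral {s..1} k = integral {0..1} k"
      by (rule Henstock_Kurzweil_Integration.integral_combine) (use s i1 in auto)
    then have G2: "(integral {0..s} k)\<^sup>2 = (integral {s..1} k)\<^sup>2"
      using z by (metis add_eq_0_iff power2_minus)
    have 1: "(integral {0..s} k)\<^sup>2 \<le> s * A"
      using integral_square_primitive_le[OF continuous_on_subset[OF k], of 0 s] s unfolding A_def by simp
    have 2: "(integral {0..s} k)\<^sup>2 \<le> (1 - s) * B"
      using integral_square_primitive_le[OF continuous_on_subset[OF k], of s 1] s unfolding B_def G2 by simp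
    have "(integral {0..s} k)\<^sup>2 = (1 - s) * (integral {0..s} k)\<^sup>2 + s * (integral {0..s} k)\<^sup>2"
      by (simp add: algebra_simps)
    also have "\<dots> \<le> (1 - s) * (s * A) + s * ((1 - s) * B)"
      using s 1 2 by (intro add_mono mult_left_mono) auto
    also have "\<dots> = N * (s - s\<^sup>2)" unfolding AB[symmetric] by (simp add: algebra_simps power2_eq_square)
    finally show ?thesis .
  qed
  have "integral {0..1} (\<lambda>s. (integral {0..s} k)\<^sup>2) \<le> integral {0..1} (\<lambda>s. N * (s - s\<^sup>2))"
    by (rule integral_le[OF _ _ le])
       (intro integrable_continuous_interval continuous_intros indefinite_integral_continuous_1 i1)+
  also have "integral {0..1} (\<lambda>s. N * (s - s\<^sup>2)) = N / 6"
  proof -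
    have "((\<lambda>s. N * (s - s\<^sup>2)) has_integral (N * (1\<^sup>2 / 2 - 1 ^ 3 / 3) - N * (0\<^sup>2 / 2 - 0 ^ 3 / 3))) {0..1::real}"
      by (rule fundamental_theorem_of_calculus)
         (auto intro!: derivative_eq_intros simp: has_real_derivative_iff_has_vector_derivative[symmetric])
    from integral_unique[OF this] show ?thesis by simp
  qed
  finally show ?thesis by (simp add: N_def)
qed

lemma unit_square_iterated_integral:
  fixes f :: "real \<Rightarrow> real \<Rightarrow> real"
  assumes "continuous_on UNIV (\<lambda>z. f (fst z) (snd z))"
  shows "continuous_on S (\<lambda>r. integral {0..1} (f r))" "continuous_on S (f r)" "continuous_on S (\<lambda>r. f r s)"
    and "integral {0..1} (\<lambda>s. integral {0..1} (\<lambda>r. f r s)) = integral {0..1} (\<lambda>r. integral {0..1} (f r))"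
proof -
  have c: "continuous_on X (\<lambda>z. f (fst z) (snd z))" for X
    by (rule continuous_on_subset[OF assms]) simp
  have c': "continuous_on X (\<lambda>(r, s). f r s)" for X
    using c[of X] by (simp add: case_prod_unfold)
  show "continuous_on S (\<lambda>r. integral {0..1} (f r))"
    using integral_continuous_on_param[of S 0 "1::real" f] c' by simp
  show "continuous_on S (f r)"
    using continuous_on_compose2[OF assms, of S "\<lambda>s. (r, s)"] by (simp add: continuous_intros)
  show "continuous_on S (\<lambda>r. f r s)"
    using continuous_on_compose2[OF assms, of S "\<lambda>r. (r, s)"] by (simp add: continuous_intros)
  show "integral {0..1} (\<lambda>s. integral {0..1} (\<lambda>r. f r s)) = integral {0..1} (\<lambda>r. integral {0..1} (f r))"
    using integral_swap_continuous[of 0 0 1 1 f] c' by simp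
qed

text \<open>Let \<open>k = \<phi> - mean\<close> on the edge and \<open>G\<close> its primitive, which vanishes at both ends. Differentiating
  \<open>r\<^sup>2 \<phi>(r, s)\<close> in \<open>r\<close> and integrating by parts in \<open>s\<close> turns \<open>\<integral> k\<^sup>2\<close> into the integral of
  \<open>r\<^sup>2 \<nabla>\<phi> \<bullet> Z(s)\<close> with \<open>Z = k (y - P) - 2 G (b - a)\<close>. The exponent \<open>2\<close> makes the resulting
  constant \<open>1/2\<close>, below the known \<open>0.574\<close>; with the exponent \<open>1\<close> it would exceed it.\<close>

lemma trace_inequality_mean_zero:
  assumes D: "cross (a - P) (b - P) \<noteq> 0" and \<phi>: "C1_with_grad \<phi> g"
    and h: "norm (a - P) \<le> h" "norm (b - P) \<le> h" "norm (b - a) \<le> h"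
  shows "integral {0..1} (\<lambda>s. (\<phi> (linepath a b s) - edge_mean \<phi> a b)\<^sup>2) \<le>
     h\<^sup>2 / (2 * \<bar>cross (a - P) (b - P)\<bar>) * (LINT x|lebesgue_on (convex hull {P, a, b}). (norm (g x))\<^sup>2)"
proof -
  let ?D = "\<bar>cross (a - P) (b - P)\<bar>" and ?K = "convex hull {P, a, b}"
  define y where "y = linepath a b"
  define k where "k s = \<phi> (y s) - edge_mean \<phi> a b" for s
  define G where "G s = integral {0..s} k" for s
  define N where "N = integral {0..1} (\<lambda>s. (k s)\<^sup>2)"
  define X where "X = (LINT x|lebesgue_on ?K. (norm (g x))\<^sup>2)"
  define p where "p r s = polar_map P a b (r, s)" for r s
  define Z where "Z s = k s *\<^sub>R (y s - P) - (2 * G s) *\<^sub>R (b - a)" for s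
  have "a \<noteq> P" using D by (auto simp: cross_def)
  then have hp: "h > 0" using h(1) by (smt (verit) zero_less_norm_iff right_minus_eq)
  have y: "y s - P = (1 - s) *\<^sub>R (a - P) + s *\<^sub>R (b - P)" for s
    by (simp add: y_def linepath_def algebra_simps)
  have ny: "norm (y s - P) \<le> h" if "s \<in> {0..1}" for s
  proof -
    have "norm (y s - P) \<le> (1 - s) * norm (a - P) + s * norm (b - P)"
      unfolding y using that by (intro norm_triangle_le) auto
    also have "\<dots> \<le> (1 - s) * h + s * h"
      using that h by (intro add_mono mult_left_mono) auto
    finally show ?thesis by (simp add: algebra_simps)
  qed
  note c\<phi> = C1_continuous[OF \<phi>] and cg = C1_continuous_grad[OF \<phi>]
  have cy: "continuous_on S y" for S unfolding y_def linepath_def by (intro continuous_intros)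
  have ck: "continuous_on S k" for S
    unfolding k_def by (intro continuous_intros continuous_on_compose2[OF c\<phi> cy]) auto
  have ki: "k integrable_on {0..1}" by (intro integrable_continuous_interval ck)
  have cp: "continuous_on S f \<Longrightarrow> continuous_on S f' \<Longrightarrow> continuous_on S (\<lambda>x. p (f x) (f' x))" for S and f f' :: "'q::topological_space \<Rightarrow> real"
    unfolding p_def by (intro continuous_intros)
  have cgp: "continuous_on S f \<Longrightarrow> continuous_on S f' \<Longrightarrow> continuous_on S (\<lambda>x. g (p (f x) (f' x)))" for S and f f' :: "'q::topological_space \<Rightarrow> real"
    by (rule continuous_on_compose2[OF cg cp]) auto
  have c\<phi>p: "continuous_on S f \<Longrightarrow> continuous_on S f' \<Longrightarrow> continuous_on S (\<lambda>x. \<phi> (p (f x) (f' x)))" for S and f f' :: "'q::topological_space \<Rightarrow> real"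
    by (rule continuous_on_compose2[OF c\<phi> cp]) auto
  have ck': "continuous_on S f \<Longrightarrow> continuous_on S (\<lambda>x. k (f x))" for S and f :: "'q::topological_space \<Rightarrow> real"
    by (rule continuous_on_compose2[OF ck]) auto
  have cy': "continuous_on S f \<Longrightarrow> continuous_on S (\<lambda>x. y (f x))" for S and f :: "'q::topological_space \<Rightarrow> real"
    by (rule continuous_on_compose2[OF cy]) auto
  have G': "(G has_real_derivative k s) (at s within {0..1})" if "s \<in> {0..1}" for s
    unfolding G_def by (rule integral_has_real_derivative[OF ck]) (use that in auto)
  have cG: "continuous_on {0..1} G"
    unfolding G_def by (rule indefinite_integral_continuous_1[OF ki])
  have k0: "integral {0..1} k = 0"
    unfolding k_def edge_mean_def y_def
    by (subst Henstock_Kurzweil_Integration.integral_diff)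
       (auto intro!: integrable_continuous_interval continuous_intros continuous_on_compose2[OF c\<phi>])
  have G01: "G 0 = 0" "G 1 = 0" by (auto simp: G_def k0)
  have y': "(y has_vector_derivative (b - a)) (at s within S)" for s S
    unfolding y_def linepath_def by (auto intro!: derivative_eq_intros simp: algebra_simps)

  \<comment> \<open>Integration by parts in \<open>s\<close>: the boundary terms vanish because
    \<open>G\<close> is zero at both ends.\<close>
  have parts: "integral {0..1} (\<lambda>s. \<phi> (p r s) * k s) = - (r * integral {0..1} (\<lambda>s. (g (p r s) \<bullet> (b - a)) * G s))" for r
  proof -
    have "((\<lambda>s. \<phi> (p r s) * k s + (g (p r s) \<bullet> (r *\<^sub>R (b - a))) * G s) has_integral (\<phi> (p r 1) * G 1 - \<phi> (p r 0) * G 0)) {0..1}"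
    proof (rule fundamental_theorem_of_calculus)
      fix s :: real assume s: "s \<in> {0..1}"
      have "((\<lambda>s. \<phi> (p r s)) has_real_derivative g (p r s) \<bullet> (r *\<^sub>R (b - a))) (at s within {0..1})"
        unfolding p_def by (rule C1_along_curve[OF \<phi> polar_map_deriv_angle])
      from DERIV_mult'[OF this G'[OF s]]
      show "((\<lambda>s. \<phi> (p r s) * G s) has_vector_derivative \<phi> (p r s) * k s + g (p r s) \<bullet> (r *\<^sub>R (b - a)) * G s) (at s within {0..1})"
        by (simp add: has_real_derivative_iff_has_vector_derivative)
    qed simp
    from integral_unique[OF this]
    have "integral {0..1} (\<lambda>s. \<phi> (p r s) * k s + r * ((g (p r s) \<bullet> (b - a)) * G s)) = 0"
      by (simp add: G01 mult.assoc)
    then show ?thesis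
      by (subst (asm) Henstock_Kurzweil_Integration.integral_add)
         (auto intro!: integrable_continuous_interval continuous_intros ck cG cgp c\<phi>p)
  qed

  \<comment> \<open>The \<open>r\<close>-derivative of \<open>r\<^sup>2 * (\<phi> * k)\<close>. The
    factor \<open>r\<^sup>2\<close> removes the contribution of the vertex, so that integrating
    \<open>j\<close> over \<open>r\<close> leaves the value on the edge.\<close>
  define j where "j r s = 2 * r * (\<phi> (p r s) * k s) + r\<^sup>2 * ((g (p r s) \<bullet> (y s - P)) * k s)" for r s
  have cj: "continuous_on UNIV (\<lambda>z. j (fst z) (snd z))"
    unfolding j_def by (intro continuous_intros cgp c\<phi>p ck' cy')
  note j = unit_square_iterated_integral[OF cj]
  have "integral {0..1} (\<lambda>r. j r s) = \<phi> (y s) * k s" for s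
  proof -
    have "((\<lambda>r. j r s) has_integral (1\<^sup>2 * (\<phi> (p 1 s) * k s) - 0\<^sup>2 * (\<phi> (p 0 s) * k s))) {0..1}"
    proof (rule fundamental_theorem_of_calculus)
      fix r :: real
      have "((\<lambda>r. \<phi> (p r s)) has_real_derivative g (p r s) \<bullet> (y s - P)) (at r within {0..1})"
        unfolding p_def y_def by (rule C1_along_curve[OF \<phi> polar_map_deriv_radius])
      from DERIV_mult'[OF DERIV_power[OF DERIV_ident, of 2] DERIV_cmult_right[OF this, of "k s"]]
      have "((\<lambda>r. r\<^sup>2 * (\<phi> (p r s) * k s)) has_real_derivative j r s) (at r within {0..1})"
        by (simp add: j_def algebra_simps)
      then show "((\<lambda>r. r\<^sup>2 * (\<phi> (p r s) * k s)) has_vector_derivative j r s) (at r within {0..1})"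
        by (simp add: has_real_derivative_iff_has_vector_derivative)
    qed simp
    from integral_unique[OF this] show ?thesis by (simp add: p_def y_def)
  qed
  then have "integral {0..1} (\<lambda>r. integral {0..1} (j r)) = integral {0..1} (\<lambda>s. \<phi> (y s) * k s)"
    using j(4) by simp
  \<comment> \<open>Integrated against \<open>k\<close>, which has mean zero, \<open>\<phi>\<close>
    may be replaced by \<open>\<phi> - edge_mean \<phi> a b\<close>, that is, by
    \<open>k\<close>.\<close>
  also have "\<dots> = integral {0..1} (\<lambda>s. (k s)\<^sup>2 + edge_mean \<phi> a b * k s)"
    by (simp add: k_def power2_eq_square algebra_simps)
  also have "\<dots> = N"
    unfolding N_def
    by (subst Henstock_Kurzweil_Integration.integral_add)
       (auto intro!: integrable_continuous_interval continuous_intros ck simp: k0)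
  finally have N: "N = integral {0..1} (\<lambda>r. integral {0..1} (j r))" by simp

  have jZ: "integral {0..1} (j r) = integral {0..1} (\<lambda>s. r\<^sup>2 * (g (p r s) \<bullet> Z s))" for r
  proof -
    have "integral {0..1} (j r) = 2 * r * integral {0..1} (\<lambda>s. \<phi> (p r s) * k s) + r\<^sup>2 * integral {0..1} (\<lambda>s. (g (p r s) \<bullet> (y s - P)) * k s)"
      unfolding j_def
      by (subst Henstock_Kurzweil_Integration.integral_add)
         (auto intro!: integrable_continuous_interval continuous_intros ck cgp c\<phi>p cy)
    also have "\<dots> = r\<^sup>2 * (integral {0..1} (\<lambda>s. (g (p r s) \<bullet> (y s - P)) * k s) - 2 * integral {0..1} (\<lambda>s. (g (p r s) \<bullet> (b - a)) * G s))"
      unfolding parts by (simp add: power2_eq_square algebra_simps)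
    also have "integral {0..1} (\<lambda>s. (g (p r s) \<bullet> (y s - P)) * k s) - 2 * integral {0..1} (\<lambda>s. (g (p r s) \<bullet> (b - a)) * G s) =
       integral {0..1} (\<lambda>s. (g (p r s) \<bullet> (y s - P)) * k s - 2 * ((g (p r s) \<bullet> (b - a)) * G s))"
      by (subst Henstock_Kurzweil_Integration.integral_diff)
         (auto intro!: integrable_continuous_interval continuous_intros ck cG cgp cy)
    also have "\<dots> = integral {0..1} (\<lambda>s. g (p r s) \<bullet> Z s)"
      by (simp add: Z_def inner_diff_right inner_right_distrib mult_ac)
    finally show ?thesis by simp
  qed

  have cZ: "continuous_on {0..1} Z"
    unfolding Z_def by (intro continuous_intros ck cy cG)
  define Q where "Q = integral {0..1} (\<lambda>s. (norm (Z s))\<^sup>2)"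
  have Xeq: "X = ?D * integral {0..1} (\<lambda>r. r * integral {0..1} (\<lambda>s. (norm (g (p r s)))\<^sup>2))"
    unfolding X_def p_def
    by (rule lebesgue_on_triangle_polar[OF D]) (intro continuous_intros cg)
  have cg2: "continuous_on UNIV (\<lambda>z. (norm (g (p (fst z) (snd z))))\<^sup>2)"
    by (intro continuous_intros cgp)
  note g2 = unit_square_iterated_integral[OF cg2[unfolded case_prod_unfold]]
  \<comment> \<open>Young's inequality with weights serving two ends. The term with
    \<open>r * (norm v)\<^sup>2\<close> carries the polar Jacobian and integrates to the gradient
    norm on the triangle; the term with \<open>r ^ 3\<close> contributes at most
    \<open>Q / (4 * h\<^sup>2)\<close>, which after \<open>Q \<le> 2 * h\<^sup>2 * N\<close> is
    exactly the half of \<open>N\<close> that can be absorbed.\<close>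
  have amgm: "r\<^sup>2 * (v \<bullet> w) \<le> h\<^sup>2 / 4 * (r * (norm v)\<^sup>2) + r ^ 3 * ((norm w)\<^sup>2 / h\<^sup>2)" if "0 \<le> r" for r and v w :: plane
  proof -
    have "0 \<le> r * (h / 2 * norm v - r * (norm w / h))\<^sup>2" using that by simp
    also have "\<dots> = h\<^sup>2 / 4 * (r * (norm v)\<^sup>2) + r ^ 3 * ((norm w)\<^sup>2 / h\<^sup>2) - r\<^sup>2 * (norm v * norm w)"
      using hp by (simp add: power2_eq_square power3_eq_cube field_simps)
    finally have "r\<^sup>2 * (norm v * norm w) \<le> h\<^sup>2 / 4 * (r * (norm v)\<^sup>2) + r ^ 3 * ((norm w)\<^sup>2 / h\<^sup>2)" by simp
    moreover have "r\<^sup>2 * (v \<bullet> w) \<le> r\<^sup>2 * (norm v * norm w)"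
      by (intro mult_left_mono norm_cauchy_schwarz) auto
    ultimately show ?thesis by linarith
  qed
  have "integral {0..1} (j r) \<le> h\<^sup>2 / 4 * (r * integral {0..1} (\<lambda>s. (norm (g (p r s)))\<^sup>2)) + r ^ 3 * (Q / h\<^sup>2)" if r: "r \<in> {0..1}" for r
  proof -
    have "integral {0..1} (j r) \<le> integral {0..1} (\<lambda>s. h\<^sup>2 / 4 * (r * (norm (g (p r s)))\<^sup>2) + r ^ 3 * ((norm (Z s))\<^sup>2 / h\<^sup>2))"
      unfolding jZ
      by (rule integral_le[OF _ _ amgm])
         (use r hp in \<open>auto intro!: integrable_continuous_interval continuous_intros cZ cgp\<close>)
    also have "\<dots> = h\<^sup>2 / 4 * (r * integral {0..1} (\<lambda>s. (norm (g (p r s)))\<^sup>2)) + r ^ 3 * (Q / h\<^sup>2)"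
      unfolding Q_def using hp
      by (subst Henstock_Kurzweil_Integration.integral_add)
         (auto intro!: integrable_continuous_interval continuous_intros cZ cgp)
    finally show ?thesis .
  qed
  then have "N \<le> integral {0..1} (\<lambda>r. h\<^sup>2 / 4 * (r * integral {0..1} (\<lambda>s. (norm (g (p r s)))\<^sup>2)) + r ^ 3 * (Q / h\<^sup>2))"
    unfolding N
    by (intro integral_le integrable_continuous_interval j(1) continuous_intros g2(1)) (use hp in auto)
  also have "\<dots> = h\<^sup>2 / 4 * integral {0..1} (\<lambda>r. (r * integral {0..1} (\<lambda>s. (norm (g (p r s)))\<^sup>2))) + integral {0..1} (\<lambda>r. r ^ 3) * (Q / h\<^sup>2)"
    by (subst Henstock_Kurzweil_Integration.integral_add)
       (use hp in \<open>auto intro!: integrable_continuous_interval continuous_intros g2(1)\<close>)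
  also have "integral {0..1} (\<lambda>r::real. r ^ 3) = 1 / 4"
  proof -
    have "((\<lambda>r::real. r ^ 3) has_integral (1 ^ 4 / 4 - 0 ^ 4 / 4)) {0..1}"
      by (rule fundamental_theorem_of_calculus)
         (auto intro!: derivative_eq_intros simp: has_real_derivative_iff_has_vector_derivative[symmetric])
    from integral_unique[OF this] show ?thesis by simp
  qed
  also have "integral {0..1} (\<lambda>r. (r * integral {0..1} (\<lambda>s. (norm (g (p r s)))\<^sup>2))) = X / ?D"
    using D by (simp add: Xeq)
  finally have N1: "N \<le> h\<^sup>2 / 4 * (X / ?D) + 1 / 4 * (Q / h\<^sup>2)" .

  \<comment> \<open>The mixed terms of \<open>(norm (Z s))\<^sup>2\<close> are completed to the
    derivative of \<open>G\<^sup>2 * ((y - P) \<bullet> (b - a))\<close>, which integrates to zero.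
    There remain \<open>k\<^sup>2\<close> and \<open>6 * G\<^sup>2\<close>, each times at most
    \<open>h\<^sup>2\<close>; the constant \<open>1 / 6\<close> for primitives bounds the second
    contribution by \<open>h\<^sup>2 * N\<close> as well.\<close>
  have Q: "Q \<le> 2 * h\<^sup>2 * N"
  proof -
    let ?B = "b - a"
    have "((\<lambda>s. 2 * (k s * G s * ((y s - P) \<bullet> ?B)) + (G s)\<^sup>2 * (norm ?B)\<^sup>2) has_integral
        ((G 1)\<^sup>2 * ((y 1 - P) \<bullet> ?B) - (G 0)\<^sup>2 * ((y 0 - P) \<bullet> ?B))) {0..1}"
    proof (rule fundamental_theorem_of_calculus)
      fix s :: real assume s: "s \<in> {0..1}"
      have yy: "((\<lambda>s. (y s - P) \<bullet> ?B) has_real_derivative (norm ?B)\<^sup>2) (at s within {0..1})"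
      proof -
        have "((\<lambda>s. y s - P) has_vector_derivative ?B) (at s within {0..1})"
          using has_vector_derivative_diff[OF y' has_vector_derivative_const] by simp
        from bounded_linear.has_vector_derivative[OF bounded_linear_inner_left this]
        show ?thesis
          by (simp add: has_real_derivative_iff_has_vector_derivative power2_norm_eq_inner)
      qed
      from DERIV_mult'[OF DERIV_power[OF G'[OF s], of 2] yy]
      show "((\<lambda>s. (G s)\<^sup>2 * ((y s - P) \<bullet> ?B)) has_vector_derivative
         2 * (k s * G s * ((y s - P) \<bullet> ?B)) + (G s)\<^sup>2 * (norm ?B)\<^sup>2) (at s within {0..1})"
        by (simp add: has_real_derivative_iff_has_vector_derivative algebra_simps)
    qed simp
    from integral_unique[OF this]
    have I: "integral {0..1} (\<lambda>s. 2 * (k s * G s * ((y s - P) \<bullet> ?B)) + (G s)\<^sup>2 * (norm ?B)\<^sup>2) = 0"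
      by (simp add: G01)
    have Zs: "(norm (Z s))\<^sup>2 = ((k s)\<^sup>2 * (norm (y s - P))\<^sup>2 + 6 * (norm ?B)\<^sup>2 * (G s)\<^sup>2)
        - 2 * (2 * (k s * G s * ((y s - P) \<bullet> ?B)) + (G s)\<^sup>2 * (norm ?B)\<^sup>2)" for s
    proof -
      have "(norm (c *\<^sub>R v - (2 * d) *\<^sub>R w))\<^sup>2 = c\<^sup>2 * (norm v)\<^sup>2 - 4 * (c * d * (v \<bullet> w)) + 4 * (d\<^sup>2 * (norm w)\<^sup>2)"
        for c d and v w :: plane
        unfolding power2_norm_eq_inner
        by (simp add: inner_diff_left inner_diff_right inner_commute[of w v] power2_eq_square algebra_simps)
      then show ?thesis unfolding Z_def by simp
    qed
    have "Q = integral {0..1} (\<lambda>s. (k s)\<^sup>2 * (norm (y s - P))\<^sup>2 + 6 * (norm ?B)\<^sup>2 * (G s)\<^sup>2)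
       - integral {0..1} (\<lambda>s. 2 * (2 * (k s * G s * ((y s - P) \<bullet> ?B)) + (G s)\<^sup>2 * (norm ?B)\<^sup>2))"
      unfolding Q_def Zs
      by (rule Henstock_Kurzweil_Integration.integral_diff)
         (intro integrable_continuous_interval continuous_intros ck cG cy)+
    also have "\<dots> = integral {0..1} (\<lambda>s. (k s)\<^sup>2 * (norm (y s - P))\<^sup>2 + 6 * (norm ?B)\<^sup>2 * (G s)\<^sup>2)"
      using I by (simp only: integral_mult_right)
    also have "\<dots> \<le> integral {0..1} (\<lambda>s. (k s)\<^sup>2 * h\<^sup>2 + 6 * h\<^sup>2 * (G s)\<^sup>2)"
    proof (rule integral_le)
      fix s :: real assume s: "s \<in> {0..1}"
      have "(norm (y s - P))\<^sup>2 \<le> h\<^sup>2" "(norm ?B)\<^sup>2 \<le> h\<^sup>2"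
        using ny[OF s] h(3) by (auto intro!: power_mono)
      then show "(k s)\<^sup>2 * (norm (y s - P))\<^sup>2 + 6 * (norm ?B)\<^sup>2 * (G s)\<^sup>2 \<le> (k s)\<^sup>2 * h\<^sup>2 + 6 * h\<^sup>2 * (G s)\<^sup>2"
        by (intro add_mono mult_left_mono mult_right_mono) auto
    qed (intro integrable_continuous_interval continuous_intros ck cG cy)+
    also have "\<dots> = N * h\<^sup>2 + 6 * h\<^sup>2 * integral {0..1} (\<lambda>s. (G s)\<^sup>2)"
      unfolding N_def
      by (subst Henstock_Kurzweil_Integration.integral_add)
         (auto intro!: integrable_continuous_interval continuous_intros ck cG)
    also have "\<dots> \<le> N * h\<^sup>2 + 6 * h\<^sup>2 * (N / 6)"
      using integral_primitive_square_le[OF ck k0] unfolding G_def N_def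
      by (intro add_left_mono mult_left_mono) auto
    finally show ?thesis by (simp add: mult_ac)
  qed
  have "Q / h\<^sup>2 \<le> 2 * N" using Q hp by (simp add: divide_le_eq mult_ac)
  then have "N \<le> h\<^sup>2 / 2 * (X / ?D)" using N1 by linarith
  then show ?thesis by (simp add: N_def k_def y_def X_def)
qed

text \<open>Integrates the derivative of \<open>r\<^sup>2 * \<phi>\<^sup>2\<close> along the rays
  from \<open>P\<close>, without subtracting a mean. The constants are crude; the purpose is
  continuity of the trace in the norm of \<open>H1\<close>.\<close>

lemma trace_inequality_full:
  assumes D: "cross (a - P) (b - P) \<noteq> 0" and \<phi>: "C1_with_grad \<phi> g"
    and h: "norm (a - P) \<le> h" "norm (b - P) \<le> h"
  shows "\<bar>cross (a - P) (b - P)\<bar> * integral {0..1} (\<lambda>s. (\<phi> (linepath a b s))\<^sup>2) \<le>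
     (LINT x|lebesgue_on (convex hull {P, a, b}). 3 * (\<phi> x)\<^sup>2 + h\<^sup>2 * (norm (g x))\<^sup>2)"
proof -
  let ?D = "\<bar>cross (a - P) (b - P)\<bar>" and ?K = "convex hull {P, a, b}"
  define y where "y = linepath a b"
  define p where "p r s = polar_map P a b (r, s)" for r s
  have y: "y s - P = (1 - s) *\<^sub>R (a - P) + s *\<^sub>R (b - P)" for s
    by (simp add: y_def linepath_def algebra_simps)
  have ny: "norm (y s - P) \<le> h" if "s \<in> {0..1}" for s
  proof -
    have "norm (y s - P) \<le> (1 - s) * norm (a - P) + s * norm (b - P)"
      unfolding y using that by (intro norm_triangle_le) auto
    also have "\<dots> \<le> (1 - s) * h + s * h"
      using that h by (intro add_mono mult_left_mono) auto
    finally show ?thesis by (simp add: algebra_simps)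
  qed
  note c\<phi> = C1_continuous[OF \<phi>] and cg = C1_continuous_grad[OF \<phi>]
  have cy': "continuous_on S f \<Longrightarrow> continuous_on S (\<lambda>x. y (f x))" for S and f :: "'q::topological_space \<Rightarrow> real"
    unfolding y_def linepath_def by (intro continuous_intros)
  have cp: "continuous_on S f \<Longrightarrow> continuous_on S f' \<Longrightarrow> continuous_on S (\<lambda>x. p (f x) (f' x))" for S and f f' :: "'q::topological_space \<Rightarrow> real"
    unfolding p_def by (intro continuous_intros)
  have cgp: "continuous_on S f \<Longrightarrow> continuous_on S f' \<Longrightarrow> continuous_on S (\<lambda>x. g (p (f x) (f' x)))" for S and f f' :: "'q::topological_space \<Rightarrow> real"
    by (rule continuous_on_compose2[OF cg cp]) auto
  have c\<phi>p: "continuous_on S f \<Longrightarrow> continuous_on S f' \<Longrightarrow> continuous_on S (\<lambda>x. \<phi> (p (f x) (f' x)))" for S and f f' :: "'q::topological_space \<Rightarrow> real"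
    by (rule continuous_on_compose2[OF c\<phi> cp]) auto
  define j where "j r s = 2 * r * (\<phi> (p r s))\<^sup>2 + r\<^sup>2 * (2 * \<phi> (p r s) * (g (p r s) \<bullet> (y s - P)))" for r s
  define l where "l r s = r * (3 * (\<phi> (p r s))\<^sup>2 + h\<^sup>2 * (norm (g (p r s)))\<^sup>2)" for r s
  have cj: "continuous_on UNIV (\<lambda>z. j (fst z) (snd z))"
    unfolding j_def by (intro continuous_intros cgp c\<phi>p cy')
  have cl: "continuous_on UNIV (\<lambda>z. l (fst z) (snd z))"
    unfolding l_def by (intro continuous_intros cgp c\<phi>p cy')
  note j = unit_square_iterated_integral[OF cj] and l = unit_square_iterated_integral[OF cl]
  have "integral {0..1} (\<lambda>r. j r s) = (\<phi> (y s))\<^sup>2" for s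
  proof -
    have "((\<lambda>r. j r s) has_integral (1\<^sup>2 * (\<phi> (p 1 s))\<^sup>2 - 0\<^sup>2 * (\<phi> (p 0 s))\<^sup>2)) {0..1}"
    proof (rule fundamental_theorem_of_calculus)
      fix r :: real
      have "((\<lambda>r. \<phi> (p r s)) has_real_derivative g (p r s) \<bullet> (y s - P)) (at r within {0..1})"
        unfolding p_def y_def by (rule C1_along_curve[OF \<phi> polar_map_deriv_radius])
      from DERIV_mult'[OF DERIV_power[OF DERIV_ident, of 2] DERIV_power[OF this, of 2]]
      have "((\<lambda>r. r\<^sup>2 * (\<phi> (p r s))\<^sup>2) has_real_derivative j r s) (at r within {0..1})"
        by (simp add: j_def algebra_simps)
      then show "((\<lambda>r. r\<^sup>2 * (\<phi> (p r s))\<^sup>2) has_vector_derivative j r s) (at r within {0..1})"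
        by (simp add: has_real_derivative_iff_has_vector_derivative)
    qed simp
    from integral_unique[OF this] show ?thesis by (simp add: p_def y_def)
  qed
  then have "integral {0..1} (\<lambda>s. (\<phi> (y s))\<^sup>2) = integral {0..1} (\<lambda>r. integral {0..1} (j r))"
    using j(4) by simp
  also have "\<dots> \<le> integral {0..1} (\<lambda>r. integral {0..1} (l r))"
  proof (intro integral_le integrable_continuous_interval j l)
    fix r s :: real assume r: "r \<in> {0..1}" and s: "s \<in> {0..1}"
    define A B where "A = \<phi> (p r s)" and "B = g (p r s) \<bullet> (y s - P)"
    have "\<bar>B\<bar> \<le> norm (g (p r s)) * norm (y s - P)" unfolding B_def by (rule Cauchy_Schwarz_ineq2)
    also have "\<dots> \<le> norm (g (p r s)) * h" using ny[OF s] by (intro mult_left_mono) auto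
    finally have "B\<^sup>2 \<le> (norm (g (p r s)) * h)\<^sup>2" by (rule abs_le_square_iff[THEN iffD1, OF order_trans]) auto
    then have B: "B\<^sup>2 \<le> h\<^sup>2 * (norm (g (p r s)))\<^sup>2" by (simp add: power_mult_distrib mult.commute)
    \<comment> \<open>After \<open>r\<^sup>2 \<le> r\<close> the weight is the polar Jacobian;
      \<open>A\<^sup>2\<close> from here and \<open>2 * r * A\<^sup>2\<close> from the first term of
      \<open>j\<close> account for the constant 3.\<close>
    have AB: "2 * A * B \<le> A\<^sup>2 + B\<^sup>2" using sum_squares_bound[of A B] by simp
    have "r\<^sup>2 * (2 * A * B) \<le> r\<^sup>2 * (A\<^sup>2 + B\<^sup>2)" using AB by (intro mult_left_mono) auto
    also have "\<dots> \<le> r * (A\<^sup>2 + B\<^sup>2)"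
      using r by (intro mult_right_mono) (auto simp: power2_eq_square mult_left_le)
    also have "\<dots> \<le> r * (A\<^sup>2 + h\<^sup>2 * (norm (g (p r s)))\<^sup>2)" using B r by (intro mult_left_mono) auto
    finally show "j r s \<le> l r s" unfolding j_def l_def A_def[symmetric] B_def[symmetric]
      by (simp add: algebra_simps)
  qed
  also have "\<dots> = integral {0..1} (\<lambda>r. r * integral {0..1} (\<lambda>s. 3 * (\<phi> (p r s))\<^sup>2 + h\<^sup>2 * (norm (g (p r s)))\<^sup>2))"
    unfolding l_def by simp
  finally have "?D * integral {0..1} (\<lambda>s. (\<phi> (y s))\<^sup>2) \<le> ?D * \<dots>"
    by (rule mult_left_mono) simp
  also have "\<dots> = (LINT x|lebesgue_on ?K. 3 * (\<phi> x)\<^sup>2 + h\<^sup>2 * (norm (g x))\<^sup>2)"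
    unfolding p_def by (rule lebesgue_on_triangle_polar[OF D, symmetric]) (intro continuous_intros cg c\<phi>)
  finally show ?thesis by (simp add: y_def)
qed

section \<open>Bump functions and the fundamental lemma of the calculus of variations\<close>

lemma GDERIV_unique: "GDERIV f x :> D \<Longrightarrow> GDERIV f x :> D' \<Longrightarrow> D = D'"
proof -
  assume "GDERIV f x :> D" "GDERIV f x :> D'"
  then have "(\<lambda>h. h \<bullet> D) = (\<lambda>h. h \<bullet> D')"
    unfolding gderiv_def by (rule has_derivative_unique)
  then have "\<forall>h. h \<bullet> D = h \<bullet> D'" by meson
  then show "D = D'" by (simp only: vector_eq_ldot)
qed

lemma grad_eq: "GDERIV f x :> D \<Longrightarrow> grad f x = D"
  unfolding grad_def by (rule the_equality) (auto intro: GDERIV_unique)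

lemma C_k_continuous: "C_k k f \<Longrightarrow> continuous_on UNIV f"
proof (cases k)
  case (Suc k')
  assume "C_k k f"
  then have "\<forall>x. \<exists>D. GDERIV f x :> D" unfolding Suc C_k.simps by blast
  then show ?thesis
    unfolding gderiv_def by (meson continuous_at_imp_continuous_on has_derivative_continuous)
qed simp

lemma C_k_Suc_imp: "C_k (Suc k) f \<Longrightarrow> C_k k f"
proof (induction k arbitrary: f)
  case 0
  from C_k_continuous[OF 0] show ?case by simp
next
  case (Suc k)
  then obtain f1 f2 where "\<forall>x. GDERIV f x :> (f1 x, f2 x)" "C_k (Suc k) f1" "C_k (Suc k) f2"
    by (auto simp only: C_k.simps(2)[of "Suc k"])
  with Suc.IH show ?case unfolding C_k.simps(2) by blast
qed

lemma C_k_SucI: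
  "(\<And>x. GDERIV f x :> (f1 x, f2 x)) \<Longrightarrow> C_k k f1 \<Longrightarrow> C_k k f2 \<Longrightarrow> C_k (Suc k) f"
  unfolding C_k.simps(2) by blast

lemma C_k_const: "C_k k (\<lambda>x. c)"
proof (induction k arbitrary: c)
  case (Suc k)
  have "GDERIV (\<lambda>x. c) x :> (0, 0)" for x :: plane
    using GDERIV_const[of c x] unfolding zero_prod_def .
  then show ?case by (rule C_k_SucI) (rule Suc)+
qed simp

lemma C_k_add: "C_k k f \<Longrightarrow> C_k k g \<Longrightarrow> C_k k (\<lambda>x. f x + g x)"
proof (induction k arbitrary: f g)
  case (Suc k)
  obtain f1 f2 where f: "\<And>x. GDERIV f x :> (f1 x, f2 x)" "C_k k f1" "C_k k f2"
    using Suc.prems(1) by auto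
  obtain g1 g2 where g: "\<And>x. GDERIV g x :> (g1 x, g2 x)" "C_k k g1" "C_k k g2"
    using Suc.prems(2) by auto
  have "\<And>x. GDERIV (\<lambda>x. f x + g x) x :> (f1 x + g1 x, f2 x + g2 x)"
    using GDERIV_add[OF f(1) g(1)] by simp
  moreover have "C_k k (\<lambda>x. f1 x + g1 x)" "C_k k (\<lambda>x. f2 x + g2 x)"
    using Suc.IH f g by auto
  ultimately show ?case by (rule C_k_SucI)
qed (auto intro: continuous_intros)

lemma C_k_mult: "C_k k f \<Longrightarrow> C_k k g \<Longrightarrow> C_k k (\<lambda>x. f x * g x)"
proof (induction k arbitrary: f g)
  case (Suc k)
  obtain f1 f2 where f: "\<And>x. GDERIV f x :> (f1 x, f2 x)" "C_k k f1" "C_k k f2"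
    using Suc.prems(1) by auto
  obtain g1 g2 where g: "\<And>x. GDERIV g x :> (g1 x, g2 x)" "C_k k g1" "C_k k g2"
    using Suc.prems(2) by auto
  note fg = C_k_Suc_imp[OF Suc.prems(1)] C_k_Suc_imp[OF Suc.prems(2)]
  have "\<And>x. GDERIV (\<lambda>x. f x * g x) x :> (f x * g1 x + g x * f1 x, f x * g2 x + g x * f2 x)"
    using GDERIV_mult[OF f(1) g(1)] by simp
  moreover have "C_k k (\<lambda>x. f x * g1 x + g x * f1 x)" "C_k k (\<lambda>x. f x * g2 x + g x * f2 x)"
    using Suc.IH f g fg by (auto intro!: C_k_add)
  ultimately show ?case by (rule C_k_SucI)
qed (auto intro: continuous_intros)

lemma C_k_fst: "C_k k (\<lambda>x. fst x)" and C_k_snd: "C_k k (\<lambda>x. snd x)"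
proof -
  have 1: "GDERIV (\<lambda>x. fst x) x :> (1, 0)" for x :: plane
    unfolding gderiv_def inner_prod_def by (auto intro!: derivative_eq_intros)
  have 2: "GDERIV (\<lambda>x. snd x) x :> (0, 1)" for x :: plane
    unfolding gderiv_def inner_prod_def by (auto intro!: derivative_eq_intros)
  show "C_k k (\<lambda>x. fst x)"
    by (cases k) (auto intro!: continuous_intros C_k_SucI[OF 1] C_k_const simp del: C_k.simps(2))
  show "C_k k (\<lambda>x. snd x)"
    by (cases k) (auto intro!: continuous_intros C_k_SucI[OF 2] C_k_const simp del: C_k.simps(2))
qed

lemma C_inf_I: "(\<And>k. C_k k f) \<Longrightarrow> f \<in> C_inf" by (simp add: C_inf_def)
lemma C_inf_D: "f \<in> C_inf \<Longrightarrow> C_k k f" by (simp add: C_inf_def)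

lemma C_inf_const: "(\<lambda>x. c) \<in> C_inf"
  and C_inf_add: "f \<in> C_inf \<Longrightarrow> g \<in> C_inf \<Longrightarrow> (\<lambda>x. f x + g x) \<in> C_inf"
  and C_inf_mult: "f \<in> C_inf \<Longrightarrow> g \<in> C_inf \<Longrightarrow> (\<lambda>x. f x * g x) \<in> C_inf"
  and C_inf_fst: "(\<lambda>x. fst x) \<in> C_inf" and C_inf_snd: "(\<lambda>x. snd x) \<in> C_inf"
  by (auto intro!: C_inf_I C_k_const C_k_add C_k_mult C_k_fst C_k_snd dest: C_inf_D)

lemma C_inf_diff:
  assumes "f \<in> C_inf" "g \<in> C_inf" shows "(\<lambda>x. f x - g x) \<in> C_inf"
  using C_inf_add[OF assms(1) C_inf_mult[OF C_inf_const[of "-1"] assms(2)]] by simp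

lemma C_inf_C1:
  assumes "f \<in> C_inf" shows "C1_with_grad f (grad f)"
proof -
  obtain f1 f2 where f: "\<And>x. GDERIV f x :> (f1 x, f2 x)" "C_k 0 f1" "C_k 0 f2"
    using C_inf_D[OF assms, of "Suc 0"] unfolding C_k.simps(2) by blast
  have "grad f = (\<lambda>x. (f1 x, f2 x))" using grad_eq[OF f(1)] by auto
  then show ?thesis using f by (auto simp: C1_with_grad_def intro!: continuous_intros)
qed

lemma C1_grad_unique: "C1_with_grad f g \<Longrightarrow> grad f = g"
  by (auto simp: C1_with_grad_def fun_eq_iff intro!: grad_eq)

text \<open>The functions \<open>p(1/t) exp(-1/t)\<close> with a polynomial \<open>p\<close>, extended by \<open>0\<close> to \<open>t \<le> 0\<close>, are
  closed under differentiation, hence smooth.\<close>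

definition flat :: "real poly \<Rightarrow> real \<Rightarrow> real" where
  "flat p t = (if t > 0 then poly p (1 / t) * exp (- (1 / t)) else 0)"

text \<open>Generalised over the power \<open>k\<close>, because the step for \<open>pCons\<close>
  moves a factor \<open>x\<close> from the polynomial into the power.\<close>

lemma tendsto_power_poly_exp: "((\<lambda>x::real. x ^ k * poly p x / exp x) \<longlongrightarrow> 0) at_top"
proof (induction p arbitrary: k)
  case (pCons a p)
  have "((\<lambda>x::real. a * (x ^ k / exp x) + x ^ Suc k * poly p x / exp x) \<longlongrightarrow> a * 0 + 0) at_top"
    by (intro tendsto_intros tendsto_power_div_exp_0 pCons.IH)
  then show ?case by (simp add: field_simps)
qed simp

text \<open>For positive \<open>t\<close> this is the chain rule: differentiating
  \<open>1 / t\<close> yields the factor \<open>monom 1 2\<close>, and \<open>p - pderiv p\<close>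
  collects the derivatives of the exponential and of the polynomial. At 0 the exponential beats
  every power of \<open>1 / t\<close>.\<close>

lemma flat_deriv: "(flat p has_real_derivative flat (monom 1 2 * (p - pderiv p)) t) (at t)"
proof -
  consider "t > 0" | "t < 0" | "t = 0" by linarith
  then show ?thesis
  proof cases
    case 1
    have "((\<lambda>t. poly p (1 / t) * exp (- (1 / t))) has_real_derivative flat (monom 1 2 * (p - pderiv p)) t) (at t)"
      using 1 by (auto intro!: derivative_eq_intros DERIV_chain2[OF poly_DERIV]
          simp: flat_def poly_monom power2_eq_square field_simps)
    moreover have "eventually (\<lambda>s. flat p s = poly p (1 / s) * exp (- (1 / s))) (nhds t)"
      using eventually_nhds_in_open[of "{0<..}" t] 1 by (auto simp: flat_def elim!: eventually_mono)
    ultimately show ?thesis by (subst DERIV_cong_ev[OF refl _ refl]) auto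
  next
    case 2
    have "eventually (\<lambda>s. flat p s = 0) (nhds t)"
      using eventually_nhds_in_open[of "{..<0}" t] 2 by (auto simp: flat_def elim!: eventually_mono)
    then show ?thesis using 2 by (subst DERIV_cong_ev[OF refl _ refl]) (auto simp: flat_def)
  next
    case 3
    have "((\<lambda>h. h * poly p h / exp h) \<longlongrightarrow> 0) at_top"
      using tendsto_power_poly_exp[of 1 p] by simp
    then have "((\<lambda>h. (1/h) * poly p (1/h) / exp (1/h)) \<longlongrightarrow> 0) (at_right 0)"
      by (rule filterlim_compose) (auto simp: filterlim_inverse_at_top_right divide_inverse)
    then have r: "((\<lambda>h. flat p h / h) \<longlongrightarrow> 0) (at_right 0)"
      by (rule Lim_transform_eventually)
         (auto simp: eventually_at_right[of 0 1] flat_def exp_minus field_simps intro!: exI[of _ 1])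
    have l: "((\<lambda>h. flat p h / h) \<longlongrightarrow> 0) (at_left 0)"
      by (rule tendsto_eventually) (auto simp: eventually_at_left[of "-1" 0] flat_def intro!: exI[of _ "-1"])
    have "((\<lambda>h. flat p h / h) \<longlongrightarrow> 0) (at 0)"
      using l r by (simp add: filterlim_split_at)
    then show ?thesis using 3 by (simp add: DERIV_def flat_def[of _ 0])
  qed
qed

lemma C_k_flat:
  assumes "\<psi> \<in> C_inf" shows "C_k k (\<lambda>x. flat p (\<psi> x))"
proof (induction k arbitrary: p)
  case 0
  have "continuous_on UNIV (flat p)"
    by (meson flat_deriv DERIV_continuous continuous_at_imp_continuous_on)
  then show ?case
    using continuous_on_compose2[OF _ C_k_continuous[OF C_inf_D[OF assms]]] by auto
next
  case (Suc k)
  obtain f1 f2 where f: "\<And>x. GDERIV \<psi> x :> (f1 x, f2 x)" "C_k k f1" "C_k k f2"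
    using C_inf_D[OF assms, of "Suc k"] unfolding C_k.simps(2) by blast
  let ?q = "monom 1 2 * (p - pderiv p)"
  have "\<And>x. GDERIV (\<lambda>x. flat p (\<psi> x)) x :> (flat ?q (\<psi> x) * f1 x, flat ?q (\<psi> x) * f2 x)"
    using GDERIV_DERIV_compose[OF f(1) flat_deriv[of p]] by simp
  moreover have "C_k k (\<lambda>x. flat ?q (\<psi> x) * f1 x)" "C_k k (\<lambda>x. flat ?q (\<psi> x) * f2 x)"
    by (intro C_k_mult Suc.IH f)+
  ultimately show ?case by (rule C_k_SucI)
qed

section \<open>Bump functions of boxes\<close>

lemma mem_box_plane:
  "x \<in> box a b \<longleftrightarrow> fst a < fst x \<and> fst x < fst b \<and> snd a < snd x \<and> snd x < snd (b::plane)"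
  "x \<in> cbox a b \<longleftrightarrow> fst a \<le> fst x \<and> fst x \<le> fst b \<and> snd a \<le> snd x \<and> snd x \<le> snd (b::plane)"
  by (auto simp: box_def cbox_def Basis_prod_def inner_prod_def ball_Un)

text \<open>With \<open>n\<close> in place of \<open>Suc n\<close> the first bump would vanish
  identically; as \<open>n\<close> grows, the values tend to the indicator of the box. For corners
  in the wrong order two negative factors have a positive product, hence the hypothesis
  \<open>box a b \<noteq> {}\<close> of the lemmas below.\<close>

definition box_bump :: "plane \<Rightarrow> plane \<Rightarrow> nat \<Rightarrow> plane \<Rightarrow> real" where
  "box_bump a b n x =
     flat 1 (real (Suc n) * ((fst x - fst a) * (fst b - fst x))) *
     flat 1 (real (Suc n) * ((snd x - snd a) * (snd b - snd x)))"

lemma flat_1: "flat 1 t = (if t > 0 then exp (- (1 / t)) else 0)" "0 \<le> flat 1 t" "flat 1 t \<le> 1"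
  by (auto simp: flat_def)

lemma box_bump_outside: "box a b \<noteq> {} \<Longrightarrow> x \<notin> box a b \<Longrightarrow> box_bump a b n x = 0"
proof -
  have z: "flat 1 (real (Suc n) * ((t - p) * (q - t))) = 0" if "p < q" "\<not> (p < t \<and> t < q)" for p q t :: real
  proof -
    have "(t - p) * (q - t) \<le> 0" using that
      by (metis diff_gt_0_iff_gt diff_le_0_iff_le less_le_trans linorder_not_le mult_nonneg_nonpos mult_nonneg_nonpos2 order_less_imp_le diff_ge_0_iff_ge)
    then show ?thesis by (auto simp: flat_1 mult_le_0_iff zero_less_mult_iff not_less)
  qed
  assume "box a b \<noteq> {}" "x \<notin> box a b"
  then have "fst a < fst b" "snd a < snd b" "\<not> (fst a < fst x \<and> fst x < fst b) \<or> \<not> (snd a < snd x \<and> snd x < snd b)"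
    by (auto simp: mem_box_plane ex_in_conv[symmetric])
  then show ?thesis unfolding box_bump_def using z by auto
qed

lemma box_bump_inside: "x \<in> box a b \<Longrightarrow> box_bump a b n x > 0"
  by (auto simp: box_bump_def flat_1 mem_box_plane intro!: mult_pos_pos)

lemma box_bump_bounds: "0 \<le> box_bump a b n x" "box_bump a b n x \<le> 1"
  by (auto simp: box_bump_def flat_1(2,3) intro!: mult_le_one)

lemma box_bump_C_inf: "box_bump a b n \<in> C_inf"
proof -
  have "(\<lambda>x. real (Suc n) * ((fst x - fst a) * (fst b - fst x))) \<in> C_inf" "(\<lambda>x. real (Suc n) * ((snd x - snd a) * (snd b - snd x))) \<in> C_inf"
    by (intro C_inf_mult C_inf_diff C_inf_const C_inf_fst C_inf_snd)+
  then have "(\<lambda>x. flat 1 (real (Suc n) * ((fst x - fst a) * (fst b - fst x))) *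
     flat 1 (real (Suc n) * ((snd x - snd a) * (snd b - snd x)))) \<in> C_inf"
    using C_inf_mult[OF C_inf_I[OF C_k_flat] C_inf_I[OF C_k_flat]] by blast
  then show ?thesis unfolding box_bump_def[abs_def] .
qed

lemma box_bump_test:
  assumes "box a b \<noteq> {}" "cbox a b \<subseteq> U" shows "box_bump a b n \<in> test_functions U"
proof -
  have "closure {x. box_bump a b n x \<noteq> 0} \<subseteq> closure (box a b)"
    using box_bump_outside[OF assms(1)] by (intro closure_mono) auto
  also have "\<dots> = cbox a b" by (rule closure_box[OF assms(1)])
  finally have "closure {x. box_bump a b n x \<noteq> 0} \<subseteq> cbox a b" .
  then show ?thesis unfolding test_functions_def
    using box_bump_C_inf assms(2) bounded_subset[OF bounded_cbox order_trans[OF closure_subset]] by auto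
qed

lemma box_bump_limit:
  assumes "box a b \<noteq> {}" shows "(\<lambda>n. box_bump a b n x) \<longlonglongrightarrow> indicator (box a b) x"
proof (cases "x \<in> box a b")
  case False
  then show ?thesis using box_bump_outside[OF assms False] by simp
next
  case True
  have *: "(\<lambda>n. flat 1 (real (Suc n) * t)) \<longlonglongrightarrow> 1" if t: "t > 0" for t
  proof -
    have "(\<lambda>n. exp (- ((1 / t) * inverse (real (Suc n))))) \<longlonglongrightarrow> exp (- ((1 / t) * 0))"
      by (intro tendsto_intros LIMSEQ_inverse_real_of_nat)
    moreover have "flat 1 (real (Suc n) * t) = exp (- ((1 / t) * inverse (real (Suc n))))" for n
      using t by (simp add: flat_1 field_simps del: of_nat_Suc)
    ultimately show ?thesis by simp
  qed
  have "(\<lambda>n. box_bump a b n x) \<longlonglongrightarrow> 1 * 1"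
    unfolding box_bump_def by (intro tendsto_mult *) (use True in \<open>auto simp: mem_box_plane\<close>)
  then show ?thesis using True by simp
qed

lemma box_Int_plane:
  "\<exists>c d. box a b \<inter> box a' b' = box c (d::plane) \<and> (box c d \<noteq> {} \<longrightarrow> cbox c d \<subseteq> cbox a' b')"
proof (intro exI conjI impI)
  let ?c = "(max (fst a) (fst a'), max (snd a) (snd a'))" and ?d = "(min (fst b) (fst b'), min (snd b) (snd b'))"
  show "box a b \<inter> box a' b' = box ?c ?d" by (auto simp: mem_box_plane)
  show "cbox ?c ?d \<subseteq> cbox a' b'" by (auto simp: mem_box_plane)
qed

text \<open>The boxes form an intersection-stable generator, so the finite measures with densities
  \<open>w\<^sup>+\<close> and \<open>w\<^sup>-\<close> agree.\<close>

lemma AE_zero_of_box_integrals_plane: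
  fixes w :: "plane \<Rightarrow> real"
  assumes w: "integrable lborel w" and z: "\<And>a b. (LINT x|lborel. indicator (box a b) x * w x) = 0"
  shows "AE x in lborel. w x = 0"
proof -
  have [measurable]: "w \<in> borel_measurable borel" using w by auto
  let ?p = "\<lambda>x. ennreal (w x)" and ?m = "\<lambda>x. ennreal (- w x)"
  have fin: "(\<integral>\<^sup>+x. ?p x \<partial>lborel) \<noteq> \<infinity>" "(\<integral>\<^sup>+x. ?m x \<partial>lborel) \<noteq> \<infinity>"
    using w unfolding real_integrable_def by auto
  have eq: "density lborel ?p = density lborel ?m"
  proof (rule measure_eqI_generator_eq[where E = "range (\<lambda>(a,b). box a b)" and \<Omega> = UNIV and A = "\<lambda>n. box (-(real n *\<^sub>R (1,1))) (real n *\<^sub>R (1,1))"])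
    show "Int_stable (range (\<lambda>(a::plane,b). box a b))"
    proof (rule Int_stableI)
      fix X Y assume "X \<in> range (\<lambda>(a::plane,b). box a b)" "Y \<in> range (\<lambda>(a::plane,b). box a b)"
      then obtain a b a' b' where "X = box a b" "Y = box a' b'" by auto
      then obtain c d where "X \<inter> Y = (\<lambda>(a,b). box a b) (c, d)" using box_Int_plane[of a b a' b'] by auto
      then show "X \<inter> Y \<in> range (\<lambda>(a::plane,b). box a b)" by (metis rangeI)
    qed
    show "(\<Union>n. box (- (real n *\<^sub>R (1,1))) (real n *\<^sub>R (1::real,1::real))) = UNIV"
    proof -
      have "\<exists>n. x \<in> box (- (real n *\<^sub>R (1,1))) (real n *\<^sub>R (1,1))" for x :: plane
      proof -
        obtain n where "max \<bar>fst x\<bar> \<bar>snd x\<bar> < real n" using reals_Archimedean2 by blast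
        then show ?thesis by (intro exI[of _ n]) (auto simp: mem_box_plane)
      qed
      then show ?thesis by blast
    qed
    fix X assume "X \<in> range (\<lambda>(a::plane,b). box a b)"
    then obtain a b where X: "X = box a b" by auto
    have wX: "integrable lborel (\<lambda>x. indicator X x * w x)"
      using integrable_mult_indicator[OF _ w, of X] X by simp
    have "(\<integral>\<^sup>+x. ennreal (indicator X x * w x) \<partial>lborel) = (\<integral>\<^sup>+x. ennreal (- (indicator X x * w x)) \<partial>lborel)"
    proof -
      have f: "(\<integral>\<^sup>+x. ennreal (indicator X x * w x) \<partial>lborel) \<noteq> \<infinity>" "(\<integral>\<^sup>+x. ennreal (- (indicator X x * w x)) \<partial>lborel) \<noteq> \<infinity>"
        using wX unfolding real_integrable_def by auto
      have "enn2real (\<integral>\<^sup>+x. ennreal (indicator X x * w x) \<partial>lborel) = enn2real (\<integral>\<^sup>+x. ennreal (- (indicator X x * w x)) \<partial>lborel)"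
        using real_lebesgue_integral_def[OF wX] z[of a b] X by simp
      moreover have "ennreal (enn2real (\<integral>\<^sup>+x. ennreal (indicator X x * w x) \<partial>lborel)) = (\<integral>\<^sup>+x. ennreal (indicator X x * w x) \<partial>lborel)"
        "ennreal (enn2real (\<integral>\<^sup>+x. ennreal (- (indicator X x * w x)) \<partial>lborel)) = (\<integral>\<^sup>+x. ennreal (- (indicator X x * w x)) \<partial>lborel)"
        using f by (simp_all only: ennreal_enn2real_if infinity_ennreal_def if_False)
      ultimately show ?thesis by metis
    qed
    moreover have "(\<integral>\<^sup>+x. ennreal (indicator X x * w x) \<partial>lborel) = emeasure (density lborel ?p) X"
      unfolding X by (subst emeasure_density) (auto simp: indicator_def intro!: nn_integral_cong)
    moreover have "(\<integral>\<^sup>+x. ennreal (- (indicator X x * w x)) \<partial>lborel) = emeasure (density lborel ?m) X"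
      unfolding X by (subst emeasure_density) (auto simp: indicator_def intro!: nn_integral_cong)
    ultimately show "emeasure (density lborel ?p) X = emeasure (density lborel ?m) X" by simp
  next
    fix n
    have "emeasure (density lborel ?p) (box (- (real n *\<^sub>R (1,1))) (real n *\<^sub>R (1,1))) \<le> (\<integral>\<^sup>+x. ?p x \<partial>lborel)"
      by (subst emeasure_density) (auto simp: indicator_def intro!: nn_integral_mono)
    then show "emeasure (density lborel ?p) (box (- (real n *\<^sub>R (1,1))) (real n *\<^sub>R (1,1))) \<noteq> \<infinity>"
      using fin(1) by (metis infinity_ennreal_def top.extremum_unique)
  qed (auto simp: borel_eq_box)
  have "AE x in lborel. ?p x = ?m x"
    by (rule sigma_finite_measure.density_unique[OF sigma_finite_lborel]) (use eq in auto)
  \<comment> \<open>At least one of \<open>w x\<close> and \<open>- w x\<close> is sent to 0 by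
    \<open>ennreal\<close>, so equality forces \<open>w x = 0\<close>.\<close>
  then show ?thesis
  proof eventually_elim
    case (elim x)
    then show ?case
      by (cases "w x" "0::real" rule: linorder_cases) (auto simp: ennreal_neg ennreal_eq_0_iff)
  qed
qed


lemma integral_lebesgue_on_borel:
  fixes f :: "plane \<Rightarrow> 'b::{banach, second_countable_topology}"
  assumes "f \<in> borel_measurable borel" "S \<in> sets borel"
  shows "(LINT x|lebesgue_on S. f x) = (LINT x|lborel. indicator S x *\<^sub>R f x)"
  using assms by (subst integral_restrict_space) (auto intro!: integral_completion)

lemma AE_zero_of_box_integrals:
  fixes w :: "plane \<Rightarrow> real"
  assumes U: "open U" and w: "integrable (lebesgue_on U) w"
    and z: "\<And>a b. box a b \<noteq> {} \<Longrightarrow> cbox a b \<subseteq> U \<Longrightarrow> (LINT x|lebesgue_on U. indicator (box a b) x * w x) = 0"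
  shows "AE x in lebesgue_on U. w x = 0"
proof -
  have U': "U \<in> sets lebesgue" using U by auto
  have w': "integrable lebesgue (\<lambda>x. indicator U x * w x)"
    using w U' by (subst (asm) integrable_restrict_space) auto
  obtain w0 where w0: "w0 \<in> borel_measurable lborel" "AE x in lborel. indicator U x * w x = w0 x"
    using completion_ex_borel_measurable_real[of "\<lambda>x. indicator U x * w x" lborel] w' by auto
  have w0m [measurable]: "w0 \<in> borel_measurable borel" using w0(1) by simp
  have ae: "AE x in lebesgue. indicator U x * w x = w0 x" using AE_completion[OF w0(2)] .
  have "integrable lebesgue w0"
    using integrable_cong_AE_imp[OF w' _ ae] by (simp add: measurable_completion)
  then have i0: "integrable lborel w0" by (simp add: integrable_completion)
  have "negligible {x \<in> U. w0 x \<noteq> 0}"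
  proof (subst locally_negligible_alt, intro ballI)
    fix x assume "x \<in> {x \<in> U. w0 x \<noteq> 0}"
    then have "x \<in> U" by simp
    then obtain p q where pq: "x \<in> box p q" "cbox p q \<subseteq> U"
      using U open_contains_cbox[of U] by (metis)
    have wQ: "integrable lborel (\<lambda>x. indicator (box p q) x * w0 x)"
      using integrable_mult_indicator[OF _ i0, of "box p q"] by simp
    have "AE x in lborel. indicator (box p q) x * w0 x = 0"
    proof (rule AE_zero_of_box_integrals_plane[OF wQ])
      fix a b :: plane
      obtain c d where cd: "box a b \<inter> box p q = box c d" "box c d \<noteq> {} \<Longrightarrow> cbox c d \<subseteq> cbox p q"
        using box_Int_plane[of a b p q] by auto
      have i: "indicator (box a b) x * (indicator (box p q) x * w0 x) = indicator (box c d) x * w0 x" for x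
        unfolding cd(1)[symmetric] by (auto simp: indicator_def)
      show "(LINT x|lborel. indicator (box a b) x * (indicator (box p q) x * w0 x)) = 0"
      proof (cases "box c d = {}")
        case True then show ?thesis unfolding i by simp
      next
        case False
        have "(LINT x|lborel. indicator (box c d) x * w0 x) = (LINT x|lebesgue. indicator (box c d) x * w0 x)"
          by (rule integral_completion[symmetric]) measurable
        also have "\<dots> = (LINT x|lebesgue. indicator U x * (indicator (box c d) x * w x))"
        proof (rule integral_cong_AE)
          show "AE x in lebesgue. indicator (box c d) x * w0 x = indicator U x * (indicator (box c d) x * w x)"
            using ae by eventually_elim (auto simp: indicator_def)
          show "(\<lambda>x. indicator U x * (indicator (box c d) x * w x)) \<in> borel_measurable lebesgue"
            using borel_measurable_times[OF borel_measurable_indicator[of "box c d"] borel_measurable_integrable[OF w']]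
            by (simp add: mult_ac)
        qed (auto intro!: measurable_completion)
        also have "\<dots> = (LINT x|lebesgue_on U. indicator (box c d) x * w x)"
          using U' by (subst integral_restrict_space) auto
        also have "\<dots> = 0" using False cd(2) pq(2) by (intro z) auto
        finally show ?thesis unfolding i .
      qed
    qed
    then have "AE x in lebesgue. x \<in> box p q \<longrightarrow> w0 x = 0"
      by (intro AE_completion) (auto elim!: eventually_mono simp: indicator_def)
    then have "negligible {y. y \<in> box p q \<and> w0 y \<noteq> 0}"
      unfolding negligible_iff_null_sets by (subst AE_iff_null_sets) (auto elim!: eventually_mono)
    then have "negligible ({x \<in> U. w0 x \<noteq> 0} \<inter> box p q)"
      by (rule negligible_subset) auto
    then show "\<exists>W. openin (top_of_set {x \<in> U. w0 x \<noteq> 0}) W \<and> x \<in> W \<and> negligible W"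
      using pq(1) \<open>x \<in> {x \<in> U. w0 x \<noteq> 0}\<close> by (intro exI[of _ "{x \<in> U. w0 x \<noteq> 0} \<inter> box p q"]) auto
  qed
  then have "AE x in lebesgue. x \<in> U \<longrightarrow> w0 x = 0"
    unfolding negligible_iff_null_sets by (rule AE_I') auto
  then have "AE x in lebesgue. x \<in> U \<longrightarrow> w x = 0"
    using ae by eventually_elim auto
  then show ?thesis using U' by (subst AE_restrict_space_iff) auto
qed

text \<open>The bumps of a box lie between 0 and 1 and tend to its indicator, so dominated
  convergence with majorant \<open>\<bar>w\<bar>\<close> reduces the claim to integrals over
  boxes.\<close>

lemma fundamental_lemma_calculus_of_variations:
  fixes w :: "plane \<Rightarrow> real"
  assumes U: "open U" and w: "integrable (lebesgue_on U) w"
    and z: "\<And>\<phi>. \<phi> \<in> test_functions U \<Longrightarrow> (LINT x|lebesgue_on U. \<phi> x * w x) = 0"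
  shows "AE x in lebesgue_on U. w x = 0"
proof (rule AE_zero_of_box_integrals[OF U w])
  fix a b assume ab: "box a b \<noteq> {}" "cbox a b \<subseteq> U"
  have [measurable]: "w \<in> borel_measurable (lebesgue_on U)" using w by auto
  have m: "box_bump a b n \<in> borel_measurable (lebesgue_on U)" for n
    using borel_measurable_continuous_onI[OF C1_continuous[OF C_inf_C1[OF box_bump_C_inf]]]
    by (intro measurable_restrict_space1 measurable_completion) simp
  have "(\<lambda>n. LINT x|lebesgue_on U. box_bump a b n x * w x) \<longlonglongrightarrow> (LINT x|lebesgue_on U. indicator (box a b) x * w x)"
  proof (rule integral_dominated_convergence[where w = "\<lambda>x. \<bar>w x\<bar>"])
    show "(\<lambda>x. indicator (box a b) x * w x) \<in> borel_measurable (lebesgue_on U)"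
      by (intro borel_measurable_times measurable_restrict_space1[OF borel_measurable_indicator]) auto
    show "(\<lambda>x. box_bump a b n x * w x) \<in> borel_measurable (lebesgue_on U)" for n
      using m by measurable
    show "AE x in lebesgue_on U. (\<lambda>n. box_bump a b n x * w x) \<longlonglongrightarrow> indicator (box a b) x * w x"
      by (intro AE_I2 tendsto_mult_right box_bump_limit ab)
    show "AE x in lebesgue_on U. norm (box_bump a b n x * w x) \<le> \<bar>w x\<bar>" for n
      by (rule AE_I2) (simp add: abs_mult box_bump_bounds mult_left_le_one_le)
  qed (use w in auto)
  moreover have "(LINT x|lebesgue_on U. box_bump a b n x * w x) = 0" for n
    by (rule z[OF box_bump_test[OF ab]])
  ultimately show "(LINT x|lebesgue_on U. indicator (box a b) x * w x) = 0"
    by (simp add: LIMSEQ_const_iff)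
qed

section \<open>Edges of triangles and triangulations\<close>

text \<open>\<open>segment_measure\<close> picks end points by choice. A segment determines its end
  points up to order, so every choice has the same length; the density form gives access to the
  rules for integrals with respect to a density.\<close>

lemma segment_measure_cases:
  assumes "e = closed_segment a b"
  obtains p q where "{p, q} = {a, b}" "e = closed_segment p q"
    "segment_measure e = density (distr (restrict_space lborel {0..1}) borel (linepath p q)) (\<lambda>_. ennreal (dist a b))"
proof -
  define z where "z = (SOME (p, q). e = closed_segment p q)"
  have z: "e = closed_segment (fst z) (snd z)"
    using someI[of "\<lambda>(p, q). e = closed_segment p q" "(a, b)"] assms unfolding z_def by (auto simp: case_prod_unfold)
  have 1: "{fst z, snd z} = {a, b}" using z unfolding assms by auto
  then have d: "dist (fst z) (snd z) = dist a b" by (auto simp: doubleton_eq_iff dist_commute)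
  have "segment_measure e = scale_measure (ennreal (dist a b)) (distr (restrict_space lborel {0..1}) borel (linepath (fst z) (snd z)))"
    unfolding segment_measure_def z_def[symmetric] Let_def by (simp add: case_prod_unfold d)
  also have "\<dots> = density (distr (restrict_space lborel {0..1}) borel (linepath (fst z) (snd z))) (\<lambda>_. ennreal (dist a b))"
    by (rule measure_eqI) (auto simp: emeasure_density_const)
  finally show ?thesis using that 1 z by blast
qed

lemma linepath_measurable [measurable]: "linepath p q \<in> restrict_space lborel {0..1} \<rightarrow>\<^sub>M (borel :: plane measure)"
  by (intro measurable_restrict_space1) (auto simp: linepath_def)

lemma sets_segment_measure [simp, measurable_cong]: "sets (segment_measure e) = sets borel"
  and space_segment_measure [simp]: "space (segment_measure e) = UNIV"
  unfolding segment_measure_def by (auto simp: Let_def case_prod_unfold space_scale_measure)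

lemma segment_measure_integral:
  assumes f: "continuous_on UNIV f"
  shows "(LINT x|segment_measure (closed_segment a b). f x) = dist a b * edge_mean f a b"
    and "integrable (segment_measure (closed_segment a b)) f"
proof -
  obtain p q where pq: "{p, q} = {a, b}"
    "segment_measure (closed_segment a b) = density (distr (restrict_space lborel {0..1}) borel (linepath p q)) (\<lambda>_. ennreal (dist a b))"
    using segment_measure_cases[OF refl] by metis
  have [measurable]: "f \<in> borel_measurable borel" by (rule borel_measurable_continuous_onI[OF f])
  have c: "continuous_on S (\<lambda>t. f (linepath p q t))" for S
    by (rule continuous_on_compose2[OF f]) (auto simp: linepath_def intro!: continuous_intros)
  have i: "set_integrable lborel {0..1} (\<lambda>t. f (linepath p q t))"
    using borel_integrable_compact[OF _ c, of "{0..1}"] unfolding set_integrable_def by simp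
  have "(LINT x|segment_measure (closed_segment a b). f x) = (LINT x|distr (restrict_space lborel {0..1}) borel (linepath p q). dist a b *\<^sub>R f x)"
    unfolding pq(2) by (rule integral_density) auto
  also have "\<dots> = (LINT t|restrict_space lborel {0..1}. dist a b *\<^sub>R f (linepath p q t))"
    by (rule integral_distr) auto
  also have "\<dots> = dist a b * (LINT t|restrict_space lborel {0..1}. f (linepath p q t))"
    by simp
  also have "(LINT t|restrict_space lborel {0..1}. f (linepath p q t)) = (LINT t:{0..1}|lborel. f (linepath p q t))"
    unfolding set_lebesgue_integral_def by (subst integral_restrict_space) auto
  also have "\<dots> = edge_mean f p q"
    unfolding edge_mean_def by (rule set_borel_integral_eq_integral(2)[OF i])
  also have "\<dots> = edge_mean f a b" using pq(1) edge_mean_commute[of f a b] by (auto simp: doubleton_eq_iff)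
  finally show "(LINT x|segment_measure (closed_segment a b). f x) = dist a b * edge_mean f a b" .
  show "integrable (segment_measure (closed_segment a b)) f"
    unfolding pq(2) using i
    by (subst integrable_density) (auto simp: integrable_distr_eq integrable_restrict_space set_integrable_def)
qed

lemma emeasure_segment_measure_UNIV: "emeasure (segment_measure (closed_segment a b)) UNIV = dist a b"
proof -
  obtain p q where pq: "{p, q} = {a, b}"
    "segment_measure (closed_segment a b) = density (distr (restrict_space lborel {0..1}) borel (linepath p q)) (\<lambda>_. ennreal (dist a b))"
    using segment_measure_cases[OF refl] by metis
  show ?thesis
    unfolding pq(2) by (subst emeasure_density_const) (auto simp: emeasure_distr emeasure_restrict_space space_restrict_space)
qed

lemma AE_segment_measure_in: "AE x in segment_measure (closed_segment a b). x \<in> closed_segment a b"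
proof -
  obtain p q where pq: "closed_segment a b = closed_segment p q"
    "segment_measure (closed_segment a b) = density (distr (restrict_space lborel {0..1}) borel (linepath p q)) (\<lambda>_. ennreal (dist a b))"
    using segment_measure_cases[OF refl] by metis
  have "AE x in distr (restrict_space lborel {0..1}) borel (linepath p q). x \<in> closed_segment p q"
    by (subst AE_distr_iff) (auto simp: AE_restrict_space_iff linepath_in_path borel_closed)
  then show ?thesis unfolding pq(2) unfolding pq(1)
    by (subst AE_density) auto
qed

text \<open>Arc length has no atoms, since \<open>linepath\<close> is injective. This makes the
  common end points of edges negligible.\<close>

lemma AE_segment_measure_not_eq:
  assumes ne: "a \<noteq> b" shows "AE x in segment_measure (closed_segment a b). x \<noteq> y"
proof -
  obtain p q where pq: "{p, q} = {a, b}"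
    "segment_measure (closed_segment a b) = density (distr (restrict_space lborel {0..1}) borel (linepath p q)) (\<lambda>_. ennreal (dist a b))"
    using segment_measure_cases[OF refl] by metis
  have "p \<noteq> q" using pq(1) ne by (auto simp: doubleton_eq_iff)
  have inj: "s = t" if "linepath p q s = linepath p q t" for s t
  proof -
    have "(s - t) *\<^sub>R (q - p) = 0" using that by (simp add: linepath_def algebra_simps)
    then show ?thesis using \<open>p \<noteq> q\<close> by simp
  qed
  obtain t where t: "\<And>s. linepath p q s = y \<Longrightarrow> s = t" using inj by metis
  have "AE s in lborel. s \<in> {0..1} \<longrightarrow> linepath p q s \<noteq> y"
    using AE_lborel_singleton[of t] by eventually_elim (use t in auto)
  then have "AE x in distr (restrict_space lborel {0..1}) borel (linepath p q). x \<noteq> y"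
    by (subst AE_distr_iff) (auto simp: AE_restrict_space_iff)
  then show ?thesis unfolding pq(2)
    by (subst AE_density) auto
qed

section \<open>Triangles: edges, area, normals and the divergence theorem\<close>

lemma cross_zero_collinear:
  assumes "cross (a - P) (b - P) = 0" shows "collinear {P, a, b}"
proof -
  have "collinear {0, a - P, b - P}"
  proof (cases "a = P")
    case False
    let ?A = "a - P" and ?B = "b - P"
    have n: "(fst ?A)\<^sup>2 + (snd ?A)\<^sup>2 \<noteq> 0" using False by (auto simp: sum_power2_eq_zero_iff prod_eq_iff)
    \<comment> \<open>The coefficient is that of the orthogonal projection of \<open>?B\<close> onto
      \<open>?A\<close>; the vanishing determinant makes the projection equal to
      \<open>?B\<close>.\<close>
    have "?B = ((fst ?A * fst ?B + snd ?A * snd ?B) / ((fst ?A)\<^sup>2 + (snd ?A)\<^sup>2)) *\<^sub>R ?A"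
    proof (rule prod_eqI)
      have "fst ?B * ((fst ?A)\<^sup>2 + (snd ?A)\<^sup>2) = (fst ?A * fst ?B + snd ?A * snd ?B) * fst ?A"
        using assms unfolding cross_def by algebra
      then show "fst ?B = fst (((fst ?A * fst ?B + snd ?A * snd ?B) / ((fst ?A)\<^sup>2 + (snd ?A)\<^sup>2)) *\<^sub>R ?A)"
        using n by (simp only: fst_scaleR) (simp add: eq_divide_eq)
      have "snd ?B * ((fst ?A)\<^sup>2 + (snd ?A)\<^sup>2) = (fst ?A * fst ?B + snd ?A * snd ?B) * snd ?A"
        using assms unfolding cross_def by algebra
      then show "snd ?B = snd (((fst ?A * fst ?B + snd ?A * snd ?B) / ((fst ?A)\<^sup>2 + (snd ?A)\<^sup>2)) *\<^sub>R ?A)"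
        using n by (simp only: snd_scaleR) (simp add: eq_divide_eq)
    qed
    then show ?thesis unfolding collinear_lemma by blast
  qed (simp add: collinear_2)
  then show ?thesis
    using collinear_3[of a P b] by (simp add: insert_commute)
qed

text \<open>The vertex \<open>P\<close> is listed first because it is opposite to the edge \<open>ab\<close> under consideration.\<close>

definition is_triangle :: "plane set \<Rightarrow> plane \<Rightarrow> plane \<Rightarrow> plane \<Rightarrow> bool" where
  "is_triangle K P a b \<longleftrightarrow> K = convex hull {P, a, b} \<and> cross (a - P) (b - P) \<noteq> 0"

lemma is_triangle_rotate: "is_triangle K P a b \<Longrightarrow> is_triangle K a b P"
proof -
  have c: "cross (b - a) (P - a) = cross (a - P) (b - P)" by (simp add: cross_def algebra_simps)
  have s: "{a, b, P} = {P, a, b}" by auto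
  show "is_triangle K P a b \<Longrightarrow> is_triangle K a b P" unfolding is_triangle_def c s .
qed

lemma is_triangle_distinct:
  assumes "is_triangle K P a b" shows "a \<noteq> b" "a \<noteq> P" "b \<noteq> P"
  using assms by (auto simp: is_triangle_def cross_def)

text \<open>Faces of a simplex are the hulls of subsets of its vertices, and affine dimension one
  means two vertices. The distinctness clauses allow a sum over the edges to be split into three
  terms.\<close>

lemma is_triangle_edges:
  assumes "is_triangle K P a b"
  shows "{e. e edge_of K} = {closed_segment a b, closed_segment b P, closed_segment P a}"
    and "closed_segment a b \<noteq> closed_segment b P" "closed_segment b P \<noteq> closed_segment P a" "closed_segment a b \<noteq> closed_segment P a"
proof -
  note d = is_triangle_distinct[OF assms]
  show "closed_segment a b \<noteq> closed_segment b P" "closed_segment b P \<noteq> closed_segment P a" "closed_segment a b \<noteq> closed_segment P a"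
    using d by (auto simp: doubleton_eq_iff)
  have nd: "\<not> affine_dependent {P, a, b}"
  proof
    assume "affine_dependent {P, a, b}"
    then have "collinear {P, a, b}" using collinear_3_eq_affine_dependent by blast
    then have "collinear {a, P, b}" by (simp add: insert_commute)
    then have "collinear {0, a - P, b - P}" by (simp add: collinear_3)
    moreover have "cross A (c *\<^sub>R A) = 0" "cross 0 B = 0" "cross A 0 = 0" for A B c by (simp_all add: cross_def)
    ultimately have "cross (a - P) (b - P) = 0" unfolding collinear_lemma by metis
    then show False using assms by (simp add: is_triangle_def)
  qed
  have K: "K = convex hull {P, a, b}" using assms by (simp add: is_triangle_def)
  have dim: "aff_dim (convex hull c) = 1 \<longleftrightarrow> card c = 2" if "c \<subseteq> {P, a, b}" for c
    using aff_dim_affine_independent[OF affine_independent_subset[OF nd that]]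
    unfolding aff_dim_convex_hull by presburger
  have "e edge_of K \<longleftrightarrow> (\<exists>c\<subseteq>{P, a, b}. card c = 2 \<and> e = convex hull c)" for e
    unfolding edge_of_def K face_of_convex_hull_affine_independent[OF nd] using dim by metis
  also have "\<dots> e \<longleftrightarrow> e \<in> {closed_segment a b, closed_segment b P, closed_segment P a}" for e
  proof
    assume "\<exists>c\<subseteq>{P, a, b}. card c = 2 \<and> e = convex hull c"
    then obtain c x y where "c \<subseteq> {P, a, b}" "c = {x, y}" "x \<noteq> y" "e = convex hull c"
      unfolding card_2_iff by blast
    then show "e \<in> {closed_segment a b, closed_segment b P, closed_segment P a}"
      by (auto simp: segment_convex_hull insert_commute)
  next
    assume e: "e \<in> {closed_segment a b, closed_segment b P, closed_segment P a}"
    have *: "\<exists>c\<subseteq>{P, a, b}. card c = 2 \<and> closed_segment x y = convex hull c"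
      if "x \<in> {P, a, b}" "y \<in> {P, a, b}" "x \<noteq> y" for x y
      using that by (intro exI[of _ "{x, y}"]) (auto simp: segment_convex_hull)
    show "\<exists>c\<subseteq>{P, a, b}. card c = 2 \<and> e = convex hull c"
      using e *[of a b] *[of b P] *[of P a] d by (elim insertE emptyE) simp_all
  qed
  finally show "{e. e edge_of K} = {closed_segment a b, closed_segment b P, closed_segment P a}" by blast
qed

lemma simplex_is_triangle:
  assumes "2 simplex K" obtains P a b where "is_triangle K P a b"
proof -
  obtain C where C: "\<not> affine_dependent C" "int (card C) = 3" "K = convex hull C"
    using assms by (auto simp: simplex_def)
  then have "card C = 3" by simp
  then obtain P a b where abc: "C = {P, a, b}" "P \<noteq> a" "P \<noteq> b" "a \<noteq> b"
    by (auto simp: card_3_iff)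
  have "cross (a - P) (b - P) \<noteq> 0"
    using cross_zero_collinear C(1) abc collinear_3_eq_affine_dependent by metis
  then show ?thesis using that C(3) abc by (auto simp: is_triangle_def)
qed

lemma edge_is_triangle:
  assumes "2 simplex K" "e edge_of K"
  obtains P a b where "is_triangle K P a b" "e = closed_segment a b"
proof -
  obtain P a b where t: "is_triangle K P a b" using simplex_is_triangle[OF assms(1)] .
  then have "e = closed_segment a b \<or> e = closed_segment b P \<or> e = closed_segment P a"
    using is_triangle_edges(1)[OF t] assms(2) by blast
  then show ?thesis using that t is_triangle_rotate[OF t] is_triangle_rotate[OF is_triangle_rotate[OF t]] by blast
qed

lemma is_triangle_compact: "is_triangle K P a b \<Longrightarrow> compact K"
  unfolding is_triangle_def using finite_imp_compact_convex_hull[of "{P, a, b}"] by auto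

lemma is_triangle_area:
  assumes "is_triangle K P a b" shows "area K = \<bar>cross (a - P) (b - P)\<bar> / 2"
proof -
  have i: "integral {0..1} (\<lambda>r::real. r) = 1 / 2"
    using integral_unique[OF ident_has_integral[of 0 "1::real"]] by simp
  have K: "K \<in> sets lebesgue" using is_triangle_compact[OF assms] by (simp add: compact_imp_closed)
  have "(LINT x|lebesgue_on K. 1) = \<bar>cross (a - P) (b - P)\<bar> / 2"
    using lebesgue_on_triangle_polar[of a P b "\<lambda>_. 1"] assms i unfolding is_triangle_def by simp
  then show ?thesis using K by (simp add: area_def measure_restrict_space)
qed

lemma is_triangle_longest_edge:
  assumes "is_triangle K P a b"
  shows "norm (a - P) \<le> longest_edge K" "norm (b - P) \<le> longest_edge K" "norm (b - a) \<le> longest_edge K"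
proof -
  have D: "diameter (closed_segment x y) = dist x y" for x y :: plane
  proof (rule antisym)
    show "diameter (closed_segment x y) \<le> dist x y"
    proof (rule diameter_le)
      fix u v assume uv: "u \<in> closed_segment x y" "v \<in> closed_segment x y"
      show "norm (u - v) \<le> dist x y"
        using segment_furthest_le[OF uv(2), of u] segment_bound[OF uv(1)]
        by (auto simp: dist_norm norm_minus_commute)
    qed auto
    show "dist x y \<le> diameter (closed_segment x y)"
      by (rule diameter_bounded_bound) (auto simp: compact_imp_bounded)
  qed
  have "x \<in> diameter ` {e. e edge_of K} \<Longrightarrow> x \<le> longest_edge K" for x
    unfolding longest_edge_def is_triangle_edges(1)[OF assms] by (rule Max_ge) auto
  then show "norm (a - P) \<le> longest_edge K" "norm (b - P) \<le> longest_edge K" "norm (b - a) \<le> longest_edge K"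
    unfolding is_triangle_edges(1)[OF assms] by (auto simp: D dist_norm norm_minus_commute)
qed


lemma is_triangle_swap: "is_triangle K P a b \<Longrightarrow> is_triangle K P b a"
proof -
  have c: "cross (b - P) (a - P) = - cross (a - P) (b - P)" by (simp add: cross_def)
  have s: "{P, b, a} = {P, a, b}" by auto
  show "is_triangle K P a b \<Longrightarrow> is_triangle K P b a" unfolding is_triangle_def c s by simp
qed

text \<open>The defining inequality in both directions along the edge makes a candidate orthogonal
  to it, the unit norm leaves two vectors, and the vertex \<open>P\<close> selects the sign. The
  edge length stays on the left so that the right-hand side matches the flux terms of
  \<open>Green_triangle\<close>.\<close>

lemma outward_normal_triangle:
  assumes t: "is_triangle K P a b"
  shows "dist a b * (w \<bullet> outward_normal K (closed_segment a b)) = sgn (cross (a - P) (b - P)) * cross w (b - a)"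
proof -
  define E D where "E = b - a" and "D = cross (a - P) (b - P)"
  define n where "n = (sgn D / norm E) *\<^sub>R (snd E, - fst E)"
  have E: "E \<noteq> 0" and D: "D \<noteq> 0" and K: "K = convex hull {P, a, b}"
    using t is_triangle_distinct[OF t] by (auto simp: E_def D_def is_triangle_def)
  have nw: "w \<bullet> n = sgn D / norm E * cross w E" for w
    by (simp add: n_def inner_prod_def cross_def algebra_simps)
  have nE: "norm (snd E, - fst E) = norm E" by (simp add: norm_prod_def add.commute)
  have PE: "cross (P - a) E = - D" by (simp add: cross_def E_def D_def algebra_simps)
  have "outward_normal K (closed_segment a b) = n"
    unfolding outward_normal_def
  proof (rule the_equality, intro conjI ballI)
    show "norm n = 1" unfolding n_def norm_scaleR nE using E D by (simp add: abs_sgn_eq)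
    fix x y assume "x \<in> closed_segment a b" "y \<in> K"
    then obtain s \<alpha> \<beta> \<gamma> where x: "x = (1 - s) *\<^sub>R a + s *\<^sub>R b"
      and y: "y = \<alpha> *\<^sub>R P + \<beta> *\<^sub>R a + \<gamma> *\<^sub>R b" "0 \<le> \<alpha>" "\<alpha> + \<beta> + \<gamma> = 1"
      unfolding K convex_hull_3 by (auto simp: closed_segment_def)
    have b: "\<beta> = 1 - \<alpha> - \<gamma>" using y(3) by simp
    have "cross (y - x) E = \<alpha> * cross (P - a) E"
      unfolding x y(1) b cross_def E_def by (simp add: algebra_simps)
    then have "n \<bullet> (y - x) = - (\<alpha> * \<bar>D\<bar> / norm E)"
      unfolding inner_commute[of n] nw PE by (simp add: abs_sgn algebra_simps)
    then show "n \<bullet> (y - x) \<le> 0" using y(2) by simp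
  next
    fix n' assume n': "norm n' = 1 \<and> (\<forall>x\<in>closed_segment a b. \<forall>y\<in>K. n' \<bullet> (y - x) \<le> 0)"
    have mem: "a \<in> K" "b \<in> K" "P \<in> K" unfolding K by (auto intro: hull_inc)
    have "n' \<bullet> (b - a) \<le> 0" "n' \<bullet> (a - b) \<le> 0" "n' \<bullet> (P - a) \<le> 0"
      using n' mem by auto
    then have nE0: "n' \<bullet> E = 0" and le: "n' \<bullet> (P - a) \<le> 0"
      by (auto simp: E_def inner_diff_right)
    \<comment> \<open>The coefficient of \<open>n'\<close> with respect to the rotated edge vector;
      orthogonality to \<open>E\<close> makes \<open>n'\<close> a multiple of that vector.\<close>
    define lam where "lam = cross n' E / (norm E)\<^sup>2"
    have N2: "(norm E)\<^sup>2 = (fst E)\<^sup>2 + (snd E)\<^sup>2" by (simp add: norm_prod_def)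
    have N0: "(norm E)\<^sup>2 \<noteq> 0" using E by simp
    have "(norm E)\<^sup>2 *\<^sub>R n' = cross n' E *\<^sub>R (snd E, - fst E)"
    proof (rule prod_eqI)
      have z0: "fst n' * fst E + snd n' * snd E = 0" using nE0 by (simp add: inner_prod_def)
      show "fst ((norm E)\<^sup>2 *\<^sub>R n') = fst (cross n' E *\<^sub>R (snd E, - fst E))"
        unfolding N2 cross_def fst_scaleR real_scaleR_def fst_conv using z0 by algebra
      show "snd ((norm E)\<^sup>2 *\<^sub>R n') = snd (cross n' E *\<^sub>R (snd E, - fst E))"
        unfolding N2 cross_def snd_scaleR real_scaleR_def snd_conv using z0 by algebra
    qed
    then have n'l: "n' = lam *\<^sub>R (snd E, - fst E)"
      unfolding lam_def using N0
      by (metis (no_types, lifting) divide_inverse_commute real_vector.scale_scale real_vector.scale_one left_inverse)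
    have l1: "\<bar>lam\<bar> * norm E = 1" using n' unfolding n'l norm_scaleR nE by blast
    have "n' \<bullet> (P - a) = lam * cross (P - a) E"
      unfolding n'l by (simp add: inner_prod_def cross_def algebra_simps)
    then have "0 \<le> lam * D" using le PE by simp
    then have "lam = sgn D * \<bar>lam\<bar>" using D
      by (auto simp: sgn_if abs_if zero_le_mult_iff)
    also have "\<bar>lam\<bar> = 1 / norm E" using l1 E by (simp add: field_simps)
    finally show "n' = n" unfolding n'l n_def by simp
  qed
  then show ?thesis
    unfolding D_def[symmetric] E_def[symmetric] using E
    by (simp add: nw dist_norm norm_minus_commute[of a] E_def[symmetric])
qed

text \<open>Cyclic rotation of the vertices preserves the determinant, so the three edges carry the
  same sign, which the outward normals absorb. The result no longer refers to a labelling of the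
  vertices.\<close>

lemma Green_simplex:
  assumes K: "2 simplex K" and 1: "C1_with_grad F1 G1" and 2: "C1_with_grad F2 G2"
  shows "(LINT x|lebesgue_on K. fst (G1 x) + snd (G2 x)) =
     (\<Sum>e | e edge_of K. LINT x|segment_measure e. (F1 x, F2 x) \<bullet> outward_normal K e)"
proof -
  obtain P a b where t: "is_triangle K P a b" using simplex_is_triangle[OF K] .
  have D: "cross (a - P) (b - P) \<noteq> 0" and KK: "K = convex hull {P, a, b}"
    using t by (auto simp: is_triangle_def)
  note c = C1_continuous[OF 1] C1_continuous[OF 2]
  have *: "(LINT x|segment_measure (closed_segment a b). (F1 x, F2 x) \<bullet> outward_normal K (closed_segment a b))
     = sgn (cross (a - P) (b - P)) * edge_mean (\<lambda>x. cross (F1 x, F2 x) (b - a)) a b" if "is_triangle K P a b" for P a b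
  proof -
    have "(LINT x|segment_measure (closed_segment a b). (F1 x, F2 x) \<bullet> outward_normal K (closed_segment a b)) =
      dist a b * edge_mean (\<lambda>x. (F1 x, F2 x) \<bullet> outward_normal K (closed_segment a b)) a b"
      by (rule segment_measure_integral) (intro continuous_intros c)
    also have "\<dots> = edge_mean (\<lambda>x. dist a b * ((F1 x, F2 x) \<bullet> outward_normal K (closed_segment a b))) a b"
      by (simp add: edge_mean_def)
    finally show ?thesis unfolding outward_normal_triangle[OF that] by (simp add: edge_mean_def)
  qed
  have cyc: "cross (b - a) (P - a) = cross (a - P) (b - P)" "cross (P - b) (a - b) = cross (a - P) (b - P)"
    by (simp_all add: cross_def algebra_simps)
  note t2 = is_triangle_rotate[OF t] and t3 = is_triangle_rotate[OF is_triangle_rotate[OF t]]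
  show ?thesis
    unfolding is_triangle_edges(1)[OF t]
    using is_triangle_edges(2-4)[OF t] *[OF t] *[OF t2] *[OF t3] Green_triangle[OF D 1 2]
    unfolding cyc KK[symmetric] by (simp add: algebra_simps)
qed

section \<open>Incidence of triangles and edges in a triangulation\<close>

lemma triangulation_ofD:
  assumes "triangulation_of \<Omega> T"
  shows "finite T" "\<And>K. K \<in> T \<Longrightarrow> 2 simplex K" "\<Union>T = closure \<Omega>"
    "\<And>K K'. K \<in> T \<Longrightarrow> K' \<in> T \<Longrightarrow> (K \<inter> K') face_of K" "\<And>K K'. K \<in> T \<Longrightarrow> K' \<in> T \<Longrightarrow> (K \<inter> K') face_of K'"
proof -
  have "triangulation T" and rest: "\<forall>K\<in>T. 2 simplex K" "\<Union>T = closure \<Omega>"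
    using assms by (auto simp: triangulation_of_def)
  then show "finite T" "\<And>K K'. K \<in> T \<Longrightarrow> K' \<in> T \<Longrightarrow> (K \<inter> K') face_of K"
    by (auto simp: triangulation_def)
  then show "\<And>K K'. K \<in> T \<Longrightarrow> K' \<in> T \<Longrightarrow> (K \<inter> K') face_of K'"
    by (metis Int_commute)
qed (use assms in \<open>auto simp: triangulation_of_def\<close>)

lemma face_of_eqI:
  assumes "convex S" "F face_of S" "aff_dim S \<le> aff_dim F" shows "F = S"
  using face_of_aff_dim_lt[OF assms(1,2)] assms(3) by linarith

text \<open>A face of full dimension is the whole triangle, so containment would make the two
  triangles equal.\<close>

lemma triangulation_Int_neq:
  assumes T: "triangulation_of \<Omega> T" and K: "K \<in> T" "K' \<in> T" "K \<noteq> K'"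
  shows "K \<inter> K' \<noteq> K"
proof
  note s = triangulation_ofD[OF T]
  assume "K \<inter> K' = K"
  then have "K face_of K'" using s(5)[OF K(1,2)] by simp
  then have "K = K'"
    using s(2)[OF K(1)] s(2)[OF K(2)] by (intro face_of_eqI) (auto simp: aff_dim_simplex convex_simplex)
  with K show False by simp
qed

text \<open>The intersection is a proper face, hence misses the interior and lies in the frontier, a
  null set for a convex set.\<close>

lemma triangulation_negligible_Int:
  assumes T: "triangulation_of \<Omega> T" and K: "K \<in> T" "K' \<in> T" "K \<noteq> K'"
  shows "negligible (K \<inter> K')"
proof -
  note s = triangulation_ofD[OF T]
  have c: "convex K" "closed K" using s(2)[OF K(1)] by (auto simp: convex_simplex closed_simplex)
  have "(K \<inter> K') \<inter> interior K = {}"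
    by (rule face_of_disjoint_interior[OF s(4)[OF K(1,2)] triangulation_Int_neq[OF T K]])
  then have "K \<inter> K' \<subseteq> frontier K" using c by (auto simp: frontier_def)
  then show ?thesis using negligible_convex_frontier[OF c(1)] negligible_subset by blast
qed

text \<open>The intersection is a face of both edges. If it had dimension one it would equal both,
  so it is empty or a single point.\<close>

lemma triangulation_edges_Int:
  assumes T: "triangulation_of \<Omega> T" and K: "K \<in> T" "K' \<in> T" and e: "e edge_of K" "e' edge_of K'" "e \<noteq> e'"
  shows "\<exists>x. e \<inter> e' \<subseteq> {x}"
proof -
  note s = triangulation_ofD[OF T]
  have f: "(e \<inter> e') face_of e" "(e \<inter> e') face_of e'"
    using face_of_Int_subface[OF s(4)[OF K] s(5)[OF K], of e e'] e by (auto simp: edge_of_def)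
  have cv: "convex e" "convex e'" using e by (auto simp: edge_of_def face_of_imp_convex)
  have "aff_dim (e \<inter> e') < 1"
  proof (rule ccontr)
    assume "\<not> aff_dim (e \<inter> e') < 1"
    then have "e \<inter> e' = e" "e \<inter> e' = e'"
      using face_of_eqI[OF cv(1) f(1)] face_of_eqI[OF cv(2) f(2)] e by (auto simp: edge_of_def)
    with e(3) show False by simp
  qed
  then have "aff_dim (e \<inter> e') = -1 \<or> aff_dim (e \<inter> e') = 0"
    using aff_dim_geq[of "e \<inter> e'"] by linarith
  then show ?thesis
  proof
    assume "aff_dim (e \<inter> e') = -1"
    then have "e \<inter> e' = {}" by (simp only: aff_dim_empty)
    then show ?thesis by blast
  next
    assume "aff_dim (e \<inter> e') = 0"
    then show ?thesis unfolding aff_dim_eq_0 by blast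
  qed
qed

text \<open>\<open>l\<close> and \<open>k\<close> are the coordinates of
  \<open>z - midpoint a b\<close> with respect to the median from the midpoint to \<open>P\<close>
  and the edge vector. Near the midpoint the barycentric coordinates of \<open>a\<close> and
  \<open>b\<close> stay positive, and the sign condition controls the remaining one, that of
  \<open>P\<close>.\<close>

lemma triangle_near_midpoint:
  assumes t: "is_triangle K P a b"
  shows "\<exists>U. open U \<and> midpoint a b \<in> U \<and>
    (\<forall>z\<in>U. 0 \<le> cross (z - midpoint a b) (b - a) * cross (P - midpoint a b) (b - a) \<longrightarrow> z \<in> K)"
proof -
  define m where "m = midpoint a b"
  define d where "d = cross (P - m) (b - a)"
  have K: "K = convex hull {P, a, b}" using t by (simp add: is_triangle_def)
  have "d = - cross (a - P) (b - P)"
    by (simp add: d_def m_def midpoint_def cross_def field_simps)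
  then have d: "d \<noteq> 0" using t by (simp add: is_triangle_def)
  define l where "l z = cross (z - m) (b - a) / d" for z
  define k where "k z = cross (P - m) (z - m) / d" for z
  have zm: "z - m = l z *\<^sub>R (P - m) + k z *\<^sub>R (b - a)" for z
  proof -
    have "d *\<^sub>R (z - m) = d *\<^sub>R (l z *\<^sub>R (P - m) + k z *\<^sub>R (b - a))"
      using cross_decompose[of "P - m" "b - a" "z - m"] d unfolding d_def[symmetric]
      by (simp add: l_def k_def scaleR_right_distrib)
    then show ?thesis using d by (simp only: scaleR_cancel_left) auto
  qed
  \<comment> \<open>From \<open>\<bar>l z\<bar> < 1/2\<close> follows
    \<open>(1 - l z) / 2 > 1/4\<close>, which a \<open>k z\<close> of modulus below
    \<open>1/4\<close> cannot use up.\<close>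
  define U where "U = {z. \<bar>l z\<bar> < 1/2} \<inter> {z. \<bar>k z\<bar> < 1/4}"
  have "open U" unfolding U_def l_def k_def cross_def
    by (intro open_Int open_Collect_less continuous_intros) (use d in auto)
  moreover have "m \<in> U" by (simp add: U_def l_def k_def cross_def)
  moreover have "z \<in> K" if z: "z \<in> U" "0 \<le> cross (z - m) (b - a) * d" for z
  proof -
    have l0: "0 \<le> l z" using z(2) unfolding l_def by (simp add: zero_le_divide_iff zero_le_mult_iff)
    have "z = l z *\<^sub>R P + ((1 - l z) / 2 - k z) *\<^sub>R a + ((1 - l z) / 2 + k z) *\<^sub>R b"
    proof -
      have "z = m + l z *\<^sub>R (P - m) + k z *\<^sub>R (b - a)" using zm[of z] by (simp add: algebra_simps)
      moreover have "m = (1/2) *\<^sub>R a + (1/2) *\<^sub>R b" by (simp add: m_def midpoint_def scaleR_right_distrib)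
      ultimately show ?thesis by (auto simp: prod_eq_iff field_simps)
    qed
    moreover have "0 \<le> (1 - l z) / 2 - k z" "0 \<le> (1 - l z) / 2 + k z"
    proof -
      have "l z < 1/2" "k z < 1/4" "- (1/4) < k z" using z(1) unfolding U_def by (auto simp: abs_less_iff)
      then show "0 \<le> (1 - l z) / 2 - k z" "0 \<le> (1 - l z) / 2 + k z" by (simp_all add: field_simps)
    qed
    ultimately show ?thesis unfolding K convex_hull_3 using l0
      by (intro CollectI exI[of _ "l z"] exI[of _ "(1 - l z) / 2 - k z"] exI[of _ "(1 - l z) / 2 + k z"]) auto
  qed
  ultimately show ?thesis unfolding m_def d_def by blast
qed

text \<open>Two triangles on the same side of \<open>e\<close> would overlap; two triangles on opposite sides would make
  the midpoint of \<open>e\<close> an interior point of \<open>closure \<Omega>\<close>, hence a point of \<open>\<Omega>\<close>.\<close>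

lemma boundary_edge_unique_triangle:
  assumes dom: "polygonal_domain \<Omega>" and T: "triangulation_of \<Omega> T"
    and K: "K \<in> T" "K' \<in> T" and e: "e \<in> boundary_edges \<Omega> T" "e edge_of K" "e edge_of K'"
  shows "K = K'"
proof (rule ccontr)
  assume ne: "K \<noteq> K'"
  note s = triangulation_ofD[OF T]
  obtain P a b where t: "is_triangle K P a b" "e = closed_segment a b"
    using edge_is_triangle[OF s(2)[OF K(1)] e(2)] .
  obtain P' a' b' where t': "is_triangle K' P' a' b'" "e = closed_segment a' b'"
    using edge_is_triangle[OF s(2)[OF K(2)] e(3)] .
  have "{a', b'} = {a, b}" using t(2) t'(2) by auto
  then have t'': "is_triangle K' P' a b" using t'(1) is_triangle_swap[OF t'(1)] by (auto simp: doubleton_eq_iff)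
  define m where "m = midpoint a b"
  obtain U where U: "open U" "m \<in> U" "\<And>z. z \<in> U \<Longrightarrow> 0 \<le> cross (z - m) (b - a) * cross (P - m) (b - a) \<Longrightarrow> z \<in> K"
    using triangle_near_midpoint[OF t(1)] unfolding m_def by auto
  obtain U' where U': "open U'" "m \<in> U'" "\<And>z. z \<in> U' \<Longrightarrow> 0 \<le> cross (z - m) (b - a) * cross (P' - m) (b - a) \<Longrightarrow> z \<in> K'"
    using triangle_near_midpoint[OF t''] unfolding m_def by auto
  have dd: "cross (P - m) (b - a) \<noteq> 0"
  proof -
    have "cross (P - m) (b - a) = - cross (a - P) (b - P)"
      by (simp add: m_def midpoint_def cross_def field_simps)
    then show ?thesis using t(1) by (simp add: is_triangle_def)
  qed
  have V: "open (U \<inter> U')" "m \<in> U \<inter> U'" using U U' by auto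
  have me: "m \<in> e" unfolding t(2) m_def by (simp add: midpoint_in_closed_segment)
  show False
  proof (cases "0 \<le> cross (P - m) (b - a) * cross (P' - m) (b - a)")
    case False
    then have sgn: "cross (P - m) (b - a) * cross (P' - m) (b - a) < 0" by simp
    have "U \<inter> U' \<subseteq> K \<union> K'"
    proof
      fix z assume z: "z \<in> U \<inter> U'"
      have "0 \<le> cross (z - m) (b - a) * cross (P - m) (b - a) \<or> 0 \<le> cross (z - m) (b - a) * cross (P' - m) (b - a)"
        using sgn by (auto simp: zero_le_mult_iff mult_less_0_iff)
      then show "z \<in> K \<union> K'" using U(3) U'(3) z by blast
    qed
    also have "\<dots> \<subseteq> closure \<Omega>" using K s(3) by blast
    finally have "m \<in> interior (closure \<Omega>)" using V interior_maximal by blast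
    then have "m \<in> \<Omega>" using dom by (simp add: polygonal_domain_def)
    moreover have "m \<in> frontier \<Omega>" using e(1) me by (auto simp: boundary_edges_def)
    moreover have "open \<Omega>" using dom by (simp add: polygonal_domain_def)
    ultimately show False by (simp add: frontier_def interior_open)
  next
    case True
    \<comment> \<open>A point slightly off the midpoint towards \<open>P\<close> lies in both
      triangles but not on the line of \<open>e\<close>; yet the common face, having dimension less
      than two, is \<open>e\<close> itself.\<close>
    have "((\<lambda>t. m + t *\<^sub>R (P - m)) \<longlongrightarrow> m + 0 *\<^sub>R (P - m)) (at_right 0)"
      by (intro tendsto_intros)
    then have "eventually (\<lambda>t. m + t *\<^sub>R (P - m) \<in> U \<inter> U') (at_right 0)"
      using V by (intro topological_tendstoD) auto
    moreover have "eventually (\<lambda>t::real. 0 < t) (at_right 0)" by (rule eventually_at_right_less)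
    ultimately have "eventually (\<lambda>t. 0 < t \<and> m + t *\<^sub>R (P - m) \<in> U \<inter> U') (at_right 0)"
      by eventually_elim auto
    then obtain t0 where t0: "0 < t0" "m + t0 *\<^sub>R (P - m) \<in> U \<inter> U'"
      using eventually_happens'[of "at_right (0::real)"] by auto
    define z where "z = m + t0 *\<^sub>R (P - m)"
    have cz: "cross (z - m) (b - a) = t0 * cross (P - m) (b - a)"
      by (simp add: z_def cross_def algebra_simps)
    have "z \<in> K" using U(3)[of z] t0 unfolding cz z_def[symmetric] by (auto simp: mult.assoc)
    moreover have "z \<in> K'" using U'(3)[of z] t0 True unfolding cz z_def[symmetric] by (auto simp: mult.assoc)
    ultimately have zKK: "z \<in> K \<inter> K'" by simp
    have lt: "aff_dim (K \<inter> K') < 2"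
      using face_of_aff_dim_lt[OF _ s(4)[OF K] triangulation_Int_neq[OF T K ne]] s(2)[OF K(1)]
      by (simp add: aff_dim_simplex convex_simplex)
    have "e face_of (K \<inter> K')"
      using face_of_subset[of e K "K \<inter> K'"] e face_of_imp_subset unfolding edge_of_def by blast
    then have "e = K \<inter> K'"
      using lt e(2) s(4)[OF K] by (intro face_of_eqI) (auto simp: edge_of_def face_of_imp_convex)
    then have "z \<in> closed_segment a b" using zKK t(2) by simp
    then obtain u where "z = (1 - u) *\<^sub>R a + u *\<^sub>R b" by (auto simp: closed_segment_def)
    then have "z - m = (u - 1/2) *\<^sub>R (b - a)"
      by (simp add: m_def midpoint_def prod_eq_iff field_simps)
    then have "cross (z - m) (b - a) = 0"
      by (simp add: cross_def)
    then show False using cz dd t0 by simp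
  qed
qed

section \<open>Square-integrable functions\<close>

lemma L2_D:
  assumes "f \<in> L2 M" shows "f \<in> borel_measurable M" "integrable M (\<lambda>x. (norm (f x))\<^sup>2)"
  using assms by (auto simp: L2_def)

lemma L2_I: "f \<in> borel_measurable M \<Longrightarrow> integrable M (\<lambda>x. (norm (f x))\<^sup>2) \<Longrightarrow> f \<in> L2 M"
  by (simp add: L2_def)

lemma L2_norm_sq: "(L2_norm M f)\<^sup>2 = (LINT x|M. (norm (f x))\<^sup>2)"
  by (simp add: L2_norm_def)

lemma L2_norm_nonneg [simp]: "0 \<le> L2_norm M f"
  by (simp add: L2_norm_def)

lemma L2_inner_integrable:
  assumes f: "f \<in> L2 M" and g: "g \<in> L2 M"
  shows "integrable M (\<lambda>x. norm (f x) * norm (g x))" "integrable M (\<lambda>x. f x \<bullet> g x)"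
proof -
  note [measurable] = L2_D(1)[OF f] L2_D(1)[OF g]
  have i: "integrable M (\<lambda>x. (norm (f x))\<^sup>2 + (norm (g x))\<^sup>2)"
    by (intro Bochner_Integration.integrable_add L2_D f g)
  have b: "norm (f x) * norm (g x) \<le> (norm (f x))\<^sup>2 + (norm (g x))\<^sup>2" for x
  proof -
    have "0 \<le> norm (f x) * norm (g x)" by simp
    then show ?thesis using sum_squares_bound[of "norm (f x)" "norm (g x)"] by linarith
  qed
  show "integrable M (\<lambda>x. norm (f x) * norm (g x))"
    by (rule Bochner_Integration.integrable_bound[OF i]) (auto intro!: order_trans[OF b])
  show "integrable M (\<lambda>x. f x \<bullet> g x)"
    by (rule Bochner_Integration.integrable_bound[OF i])
       (auto intro!: order_trans[OF Cauchy_Schwarz_ineq2] order_trans[OF b])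
qed

lemma L2_zero_imp_AE:
  assumes f: "f \<in> L2 M" and z: "L2_norm M f = 0" shows "AE x in M. f x = 0"
proof -
  have "(LINT x|M. (norm (f x))\<^sup>2) = 0" using z L2_norm_sq[of M f] by simp
  then have "AE x in M. (norm (f x))\<^sup>2 = 0"
    using integral_nonneg_eq_0_iff_AE[OF L2_D(2)[OF f]] by simp
  then show ?thesis by simp
qed

text \<open>Young's inequality, weighted so that each term integrates to half the product of the
  norms. The weights divide by the norms, so vanishing norms are treated first.\<close>

lemma L2_Cauchy_Schwarz_norm:
  fixes f g :: "'a \<Rightarrow> 'b::euclidean_space"
  assumes f: "f \<in> L2 M" and g: "g \<in> L2 M"
  shows "(LINT x|M. norm (f x) * norm (g x)) \<le> L2_norm M f * L2_norm M g"
proof (cases "L2_norm M f = 0 \<or> L2_norm M g = 0")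
  case True
  then have "AE x in M. f x = 0 \<or> g x = 0"
    using L2_zero_imp_AE[OF f] L2_zero_imp_AE[OF g] by (auto elim: eventually_mono)
  then have "(LINT x|M. norm (f x) * norm (g x)) = 0"
    by (intro integral_eq_zero_AE) (auto elim: eventually_mono)
  then show ?thesis by simp
next
  case False
  define A B where "A = L2_norm M f" and "B = L2_norm M g"
  have AB: "A > 0" "B > 0" using False by (auto simp: A_def B_def less_le)
  have i: "integrable M (\<lambda>x. B / (2 * A) * (norm (f x))\<^sup>2)" "integrable M (\<lambda>x. A / (2 * B) * (norm (g x))\<^sup>2)"
    by (intro integrable_mult_right L2_D f g)+
  have "(LINT x|M. norm (f x) * norm (g x)) \<le> (LINT x|M. B / (2 * A) * (norm (f x))\<^sup>2 + A / (2 * B) * (norm (g x))\<^sup>2)"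
  proof (rule integral_mono[OF L2_inner_integrable(1)[OF f g] Bochner_Integration.integrable_add[OF i]])
    fix x
    have "0 \<le> (B * norm (f x) - A * norm (g x))\<^sup>2 / (2 * A * B)" using AB by simp
    also have "\<dots> = B / (2 * A) * (norm (f x))\<^sup>2 + A / (2 * B) * (norm (g x))\<^sup>2 - norm (f x) * norm (g x)"
      using AB by (simp add: power2_eq_square field_simps)
    finally show "norm (f x) * norm (g x) \<le> B / (2 * A) * (norm (f x))\<^sup>2 + A / (2 * B) * (norm (g x))\<^sup>2" by simp
  qed
  also have "\<dots> = B / (2 * A) * A\<^sup>2 + A / (2 * B) * B\<^sup>2"
    unfolding Bochner_Integration.integral_add[OF i] by (simp add: A_def B_def L2_norm_sq)
  also have "\<dots> = A * B" using AB by (simp add: power2_eq_square)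
  finally show ?thesis by (simp add: A_def B_def)
qed

lemma L2_Cauchy_Schwarz:
  assumes f: "f \<in> L2 M" and g: "g \<in> L2 M"
  shows "\<bar>LINT x|M. f x \<bullet> g x\<bar> \<le> L2_norm M f * L2_norm M g"
proof -
  have "\<bar>LINT x|M. f x \<bullet> g x\<bar> \<le> (LINT x|M. \<bar>f x \<bullet> g x\<bar>)"
    using integral_norm_bound[of M "\<lambda>x. f x \<bullet> g x"] by simp
  also have "\<dots> \<le> (LINT x|M. norm (f x) * norm (g x))"
    by (intro integral_mono L2_inner_integrable integrable_abs f g Cauchy_Schwarz_ineq2)
  finally show ?thesis using L2_Cauchy_Schwarz_norm[OF f g] by linarith
qed

lemma L2_scaleR: "f \<in> L2 M \<Longrightarrow> (\<lambda>x. c *\<^sub>R f x) \<in> L2 M"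
  by (auto simp: L2_def power_mult_distrib)

lemma L2_add:
  assumes f: "f \<in> L2 M" and g: "g \<in> L2 M" shows "(\<lambda>x. f x + g x) \<in> L2 M"
proof (rule L2_I)
  note [measurable] = L2_D(1)[OF f] L2_D(1)[OF g]
  show "(\<lambda>x. f x + g x) \<in> borel_measurable M" by measurable
  have "integrable M (\<lambda>x. (norm (f x))\<^sup>2 + 2 * (f x \<bullet> g x) + (norm (g x))\<^sup>2)"
    by (intro Bochner_Integration.integrable_add integrable_mult_right L2_D L2_inner_integrable f g)
  then show "integrable M (\<lambda>x. (norm (f x + g x))\<^sup>2)"
    by (simp add: power2_norm_eq_inner inner_add_left inner_add_right inner_commute algebra_simps)
qed

lemma L2_diff:
  assumes f: "f \<in> L2 M" and g: "g \<in> L2 M" shows "(\<lambda>x. f x - g x) \<in> L2 M"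
  using L2_add[OF f L2_scaleR[OF g, of "-1"]] by simp

lemma L2_norm_triangle:
  assumes f: "f \<in> L2 M" and g: "g \<in> L2 M"
  shows "L2_norm M (\<lambda>x. f x + g x) \<le> L2_norm M f + L2_norm M g"
proof (rule power2_le_imp_le)
  have "(L2_norm M (\<lambda>x. f x + g x))\<^sup>2 = (LINT x|M. (norm (f x))\<^sup>2 + 2 * (f x \<bullet> g x) + (norm (g x))\<^sup>2)"
    unfolding L2_norm_sq
    by (simp add: power2_norm_eq_inner inner_add_left inner_add_right inner_commute algebra_simps)
  also have "\<dots> = (L2_norm M f)\<^sup>2 + 2 * (LINT x|M. f x \<bullet> g x) + (L2_norm M g)\<^sup>2"
    unfolding L2_norm_sq
    by (subst Bochner_Integration.integral_add, intro Bochner_Integration.integrable_add integrable_mult_right L2_D L2_inner_integrable f g,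
        rule L2_D[OF g], subst Bochner_Integration.integral_add) (auto intro!: L2_D L2_inner_integrable f g)
  also have "\<dots> \<le> (L2_norm M f)\<^sup>2 + 2 * (L2_norm M f * L2_norm M g) + (L2_norm M g)\<^sup>2"
    using L2_Cauchy_Schwarz[OF f g] by simp
  finally show "(L2_norm M (\<lambda>x. f x + g x))\<^sup>2 \<le> (L2_norm M f + L2_norm M g)\<^sup>2"
    by (simp add: power2_sum)
qed simp

lemma L2_norm_uminus: "L2_norm M (\<lambda>x. f x - g x) = L2_norm M (\<lambda>x. g x - f x)"
  by (simp add: L2_norm_def norm_minus_commute)

lemma L2_norm_le_add:
  assumes f: "f \<in> L2 M" and g: "g \<in> L2 M"
  shows "L2_norm M f \<le> L2_norm M (\<lambda>x. f x - g x) + L2_norm M g"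
  using L2_norm_triangle[OF L2_diff[OF f g] g] by simp

lemma L2_norm_cong_AE:
  assumes "f \<in> borel_measurable M" "g \<in> borel_measurable M" "AE x in M. f x = g x"
  shows "L2_norm M f = L2_norm M g"
proof -
  have "(LINT x|M. (norm (f x))\<^sup>2) = (LINT x|M. (norm (g x))\<^sup>2)"
    by (rule integral_cong_AE) (use assms in \<open>auto elim: eventually_mono\<close>)
  then show ?thesis by (simp add: L2_norm_def)
qed

lemma tendsto_zero_squeeze:
  fixes a b :: "nat \<Rightarrow> real"
  assumes "\<And>n. 0 \<le> a n" "\<And>n. a n \<le> b n" "b \<longlonglongrightarrow> 0"
  shows "a \<longlonglongrightarrow> 0"
  by (rule tendsto_sandwich[OF _ _ tendsto_const assms(3)]) (use assms in auto)

text \<open>Membership in \<open>L2\<close> is recorded because the integral of a non-integrable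
  function is 0 by default, so that a small \<open>L2_norm\<close> alone says nothing.\<close>

definition L2_lim :: "'a measure \<Rightarrow> (nat \<Rightarrow> 'a \<Rightarrow> 'b::euclidean_space) \<Rightarrow> ('a \<Rightarrow> 'b) \<Rightarrow> bool" where
  "L2_lim M \<phi> v \<longleftrightarrow> (\<forall>n. \<phi> n \<in> L2 M) \<and> v \<in> L2 M \<and> (\<lambda>n. L2_norm M (\<lambda>x. \<phi> n x - v x)) \<longlonglongrightarrow> 0"

lemma L2_lim_diff:
  assumes 1: "L2_lim M \<phi> v" and 2: "L2_lim M \<psi> w"
  shows "L2_lim M (\<lambda>n x. \<phi> n x - \<psi> n x) (\<lambda>x. v x - w x)"
  unfolding L2_lim_def
proof (intro conjI allI)
  show "(\<lambda>x. \<phi> n x - \<psi> n x) \<in> L2 M" for n using 1 2 by (auto simp: L2_lim_def intro: L2_diff)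
  show "(\<lambda>x. v x - w x) \<in> L2 M" using 1 2 by (auto simp: L2_lim_def intro: L2_diff)
  have "L2_norm M (\<lambda>x. \<phi> n x - \<psi> n x - (v x - w x)) \<le> L2_norm M (\<lambda>x. \<phi> n x - v x) + L2_norm M (\<lambda>x. \<psi> n x - w x)" for n
  proof -
    have "L2_norm M (\<lambda>x. (\<phi> n x - v x) + (w x - \<psi> n x)) \<le> L2_norm M (\<lambda>x. \<phi> n x - v x) + L2_norm M (\<lambda>x. w x - \<psi> n x)"
      using 1 2 by (intro L2_norm_triangle L2_diff) (auto simp: L2_lim_def)
    then show ?thesis by (simp add: L2_norm_uminus[of M w] algebra_simps)
  qed
  moreover have "(\<lambda>n. L2_norm M (\<lambda>x. \<phi> n x - v x) + L2_norm M (\<lambda>x. \<psi> n x - w x)) \<longlonglongrightarrow> 0"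
    using 1 2 by (auto simp: L2_lim_def intro: tendsto_add_zero)
  ultimately show "(\<lambda>n. L2_norm M (\<lambda>x. \<phi> n x - \<psi> n x - (v x - w x))) \<longlonglongrightarrow> 0"
    by (intro tendsto_zero_squeeze[OF L2_norm_nonneg])
qed

lemma L2_lim_norm:
  assumes "L2_lim M \<phi> v" shows "(\<lambda>n. L2_norm M (\<phi> n)) \<longlonglongrightarrow> L2_norm M v"
proof -
  have l: "\<phi> n \<in> L2 M" "v \<in> L2 M" for n using assms by (auto simp: L2_lim_def)
  have "\<bar>L2_norm M (\<phi> n) - L2_norm M v\<bar> \<le> L2_norm M (\<lambda>x. \<phi> n x - v x)" for n
    using L2_norm_le_add[OF l(1)[of n] l(2)] L2_norm_le_add[OF l(2) l(1)[of n]]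
    by (simp add: L2_norm_uminus[of M v])
  then have "(\<lambda>n. \<bar>L2_norm M (\<phi> n) - L2_norm M v\<bar>) \<longlonglongrightarrow> 0"
    using assms unfolding L2_lim_def
    by (intro tendsto_zero_squeeze[OF abs_ge_zero, where b = "\<lambda>n. L2_norm M (\<lambda>x. \<phi> n x - v x)"]) auto
  then show ?thesis by (simp add: LIM_zero_iff tendsto_rabs_zero_iff)
qed

lemma L2_lim_inner:
  assumes "L2_lim M \<phi> v" "g \<in> L2 M"
  shows "(\<lambda>n. LINT x|M. \<phi> n x \<bullet> g x) \<longlonglongrightarrow> (LINT x|M. v x \<bullet> g x)"
proof -
  have l: "\<phi> n \<in> L2 M" "v \<in> L2 M" for n using assms by (auto simp: L2_lim_def)
  have "\<bar>(LINT x|M. \<phi> n x \<bullet> g x) - (LINT x|M. v x \<bullet> g x)\<bar> \<le> L2_norm M (\<lambda>x. \<phi> n x - v x) * L2_norm M g" for n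
    using L2_Cauchy_Schwarz[OF L2_diff[OF l(1)[of n] l(2)] assms(2)]
    by (simp add: inner_diff_left Bochner_Integration.integral_diff L2_inner_integrable l assms(2))
  moreover have "(\<lambda>n. L2_norm M (\<lambda>x. \<phi> n x - v x) * L2_norm M g) \<longlonglongrightarrow> 0"
    using assms(1) unfolding L2_lim_def by (auto intro: tendsto_mult_left_zero)
  ultimately have "(\<lambda>n. \<bar>(LINT x|M. \<phi> n x \<bullet> g x) - (LINT x|M. v x \<bullet> g x)\<bar>) \<longlonglongrightarrow> 0"
    by (intro tendsto_zero_squeeze[OF abs_ge_zero, where b = "\<lambda>n. L2_norm M (\<lambda>x. \<phi> n x - v x) * L2_norm M g"]) auto
  then show ?thesis by (simp add: LIM_zero_iff tendsto_rabs_zero_iff)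
qed

section \<open>The mesh and arc length on the boundary\<close>

locale polygonal_mesh =
  fixes \<Omega> :: "plane set" and T :: "plane set set"
  assumes dom: "polygonal_domain \<Omega>" and tri: "triangulation_of \<Omega> T"
    and one_edge: "at_most_one_boundary_edge \<Omega> T"
begin

lemmas tri_finite = triangulation_ofD(1)[OF tri]
  and tri_simplex = triangulation_ofD(2)[OF tri]
  and tri_Union = triangulation_ofD(3)[OF tri]

lemma open_\<Omega>: "open \<Omega>" and bounded_\<Omega>: "bounded \<Omega>" and connected_\<Omega>: "connected \<Omega>"
  using dom by (auto simp: polygonal_domain_def)

lemma \<Omega>_sets [measurable, simp]: "\<Omega> \<in> sets borel" "\<Omega> \<in> sets lebesgue"
  using open_\<Omega> by auto

lemma negligible_frontier: "negligible (frontier \<Omega>)"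
proof -
  obtain S where S: "finite S" "frontier \<Omega> = (\<Union>(a, b)\<in>S. closed_segment a b)"
    using dom by (auto simp: polygonal_domain_def)
  have "negligible (closed_segment a b)" for a b :: plane
  proof -
    have "interior (closed_segment a b) = {}" by (rule interior_closed_segment_ge2) simp
    then show ?thesis using negligible_convex_interior[of "closed_segment a b"] by simp
  qed
  then show ?thesis unfolding S(2) using S(1) by (intro negligible_Union) (auto simp: case_prod_unfold)
qed

lemma tri_compact: "K \<in> T \<Longrightarrow> compact K"
  using tri_simplex compact_simplex by blast

lemma tri_sets [measurable]: "K \<in> T \<Longrightarrow> K \<in> sets borel" and tri_sets_lebesgue: "K \<in> T \<Longrightarrow> K \<in> sets lebesgue"
  using compact_imp_closed[OF tri_compact] by auto

text \<open>Off \<open>N\<close>, the frontier together with all pairwise intersections, a point of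
  \<open>\<Omega>\<close> lies in exactly one triangle and any other point in none. Integrals over
  \<open>\<Omega>\<close> thereby split into integrals over triangles.\<close>

lemma AE_sum_indicator: "AE x in lebesgue. (\<Sum>K\<in>T. indicator K x) = (indicator \<Omega> x :: real)"
proof -
  define N where "N = frontier \<Omega> \<union> (\<Union>(K, K')\<in>{(K, K'). K \<in> T \<and> K' \<in> T \<and> K \<noteq> K'}. K \<inter> K')"
  have fin: "finite {(K, K'). K \<in> T \<and> K' \<in> T \<and> K \<noteq> K'}"
    by (rule finite_subset[of _ "T \<times> T"]) (auto simp: tri_finite)
  have "negligible (\<Union>(K, K')\<in>{(K, K'). K \<in> T \<and> K' \<in> T \<and> K \<noteq> K'}. K \<inter> K')"
    using fin triangulation_negligible_Int[OF tri] by (intro negligible_Union) auto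
  then have "negligible N" unfolding N_def using negligible_frontier by simp
  moreover have "(\<Sum>K\<in>T. indicator K x) = (indicator \<Omega> x :: real)" if x: "x \<notin> N" for x
  proof (cases "x \<in> \<Omega>")
    case True
    then have "x \<in> \<Union>T" unfolding tri_Union using closure_subset by blast
    then obtain K where K: "K \<in> T" "x \<in> K" by blast
    have "x \<notin> K'" if "K' \<in> T - {K}" for K'
      using x K that by (auto simp: N_def)
    then have "(\<Sum>K\<in>T - {K}. indicator K x) = (0 :: real)" by (intro sum.neutral) auto
    then show ?thesis using K True by (simp add: sum.remove[OF tri_finite K(1)])
  next
    case False
    have "x \<notin> K" if "K \<in> T" for K
    proof
      assume "x \<in> K"
      then have "x \<in> closure \<Omega>" using that tri_Union by blast
      then have "x \<in> frontier \<Omega>" using False open_\<Omega> by (simp add: frontier_def interior_open)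
      then show False using x by (simp add: N_def)
    qed
    then show ?thesis using False by (simp add: sum.neutral)
  qed
  ultimately show ?thesis
    unfolding negligible_iff_null_sets by (intro AE_I'[of N]) auto
qed

text \<open>Triangles are closed and may touch the frontier, so they lie in \<open>\<Omega>\<close>
  only up to the null set \<open>frontier \<Omega>\<close>.\<close>

lemma AE_tri_in_\<Omega>:
  assumes K: "K \<in> T" shows "AE x in lebesgue. x \<in> K \<longrightarrow> x \<in> \<Omega>"
proof -
  have "frontier \<Omega> \<in> null_sets lebesgue" using negligible_frontier by (simp add: negligible_iff_null_sets)
  moreover have "{x. \<not> (x \<in> K \<longrightarrow> x \<in> \<Omega>)} \<subseteq> frontier \<Omega>"
    using K tri_Union open_\<Omega> by (auto simp: frontier_def interior_open)
  ultimately show ?thesis by (intro AE_I') auto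
qed

lemma integrable_on_tri:
  fixes f :: "plane \<Rightarrow> real"
  assumes K: "K \<in> T" and f: "integrable (lebesgue_on \<Omega>) f"
  shows "integrable (lebesgue_on K) f"
    and "(LINT x|lebesgue_on K. f x) = (LINT x|lebesgue. indicator K x * (indicator \<Omega> x * f x))"
proof -
  have f': "integrable lebesgue (\<lambda>x. indicator \<Omega> x * f x)"
    using f by (simp add: integrable_restrict_space)
  have 1: "integrable lebesgue (\<lambda>x. indicator K x * (indicator \<Omega> x * f x))"
    using integrable_mult_indicator[OF tri_sets_lebesgue[OF K] f'] by simp
  have ae: "AE x in lebesgue. indicator K x * (indicator \<Omega> x * f x) = indicator K x * f x"
    using AE_tri_in_\<Omega>[OF K] by eventually_elim (auto simp: indicator_def)
  have m: "(\<lambda>x. indicator K x * f x) \<in> borel_measurable lebesgue"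
    by (rule borel_measurable_AE[OF _ ae]) (use 1 in auto)
  show "integrable (lebesgue_on K) f"
    using integrable_cong_AE_imp[OF 1 m] ae tri_sets_lebesgue[OF K]
    by (subst integrable_restrict_space) (auto elim: eventually_mono)
  have "(LINT x|lebesgue. indicator K x * (indicator \<Omega> x * f x)) = (LINT x|lebesgue. indicator K x * f x)"
    by (rule integral_cong_AE) (use 1 m ae in auto)
  then show "(LINT x|lebesgue_on K. f x) = (LINT x|lebesgue. indicator K x * (indicator \<Omega> x * f x))"
    using tri_sets_lebesgue[OF K] by (subst integral_restrict_space) auto
qed

lemma integral_\<Omega>_eq_sum:
  fixes f :: "plane \<Rightarrow> real"
  assumes f: "integrable (lebesgue_on \<Omega>) f"
  shows "(LINT x|lebesgue_on \<Omega>. f x) = (\<Sum>K\<in>T. LINT x|lebesgue_on K. f x)"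
proof -
  have f': "integrable lebesgue (\<lambda>x. indicator \<Omega> x * f x)"
    using f by (simp add: integrable_restrict_space)
  have i: "integrable lebesgue (\<lambda>x. indicator K x * (indicator \<Omega> x * f x))" if "K \<in> T" for K
    using integrable_mult_indicator[OF tri_sets_lebesgue[OF that] f'] by simp
  have "(LINT x|lebesgue_on \<Omega>. f x) = (LINT x|lebesgue. indicator \<Omega> x * f x)"
    by (subst integral_restrict_space) auto
  also have "\<dots> = (LINT x|lebesgue. (\<Sum>K\<in>T. indicator K x * (indicator \<Omega> x * f x)))"
  proof (rule integral_cong_AE)
    show "AE x in lebesgue. indicator \<Omega> x * f x = (\<Sum>K\<in>T. indicator K x * (indicator \<Omega> x * f x))"
      using AE_sum_indicator by eventually_elim (simp add: sum_distrib_right[symmetric] indicator_def)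
  qed (use f' i in \<open>auto intro!: borel_measurable_sum\<close>)
  also have "\<dots> = (\<Sum>K\<in>T. LINT x|lebesgue. indicator K x * (indicator \<Omega> x * f x))"
    by (rule Bochner_Integration.integral_sum[OF i])
  also have "\<dots> = (\<Sum>K\<in>T. LINT x|lebesgue_on K. f x)"
    using integrable_on_tri(2)[OF _ f] by simp
  finally show ?thesis .
qed

lemma L2_on_tri:
  fixes f :: "plane \<Rightarrow> 'b::euclidean_space"
  assumes K: "K \<in> T" and f: "f \<in> L2 (lebesgue_on \<Omega>)"
  shows "f \<in> L2 (lebesgue_on K)"
proof (rule L2_I)
  show "integrable (lebesgue_on K) (\<lambda>x. (norm (f x))\<^sup>2)"
    by (rule integrable_on_tri(1)[OF K L2_D(2)[OF f]])
  show "f \<in> borel_measurable (lebesgue_on K)"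
  proof -
    have "(\<lambda>x. indicator \<Omega> x *\<^sub>R f x) \<in> borel_measurable lebesgue"
      using L2_D(1)[OF f] by (subst (asm) borel_measurable_restrict_space_iff) auto
    then have 1: "(\<lambda>x. indicator K x *\<^sub>R (indicator \<Omega> x *\<^sub>R f x)) \<in> borel_measurable lebesgue"
      using tri_sets_lebesgue[OF K] by measurable
    have ae: "AE x in lebesgue. indicator K x *\<^sub>R (indicator \<Omega> x *\<^sub>R f x) = indicator K x *\<^sub>R f x"
      using AE_tri_in_\<Omega>[OF K] by eventually_elim (auto simp: indicator_def)
    have "(\<lambda>x. indicator K x *\<^sub>R f x) \<in> borel_measurable lebesgue"
      by (rule borel_measurable_AE[OF _ ae]) (use 1 in auto)
    then show ?thesis
      using tri_sets_lebesgue[OF K] by (subst borel_measurable_restrict_space_iff) auto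
  qed
qed

lemma L2_norm_\<Omega>_eq_sum:
  assumes "f \<in> L2 (lebesgue_on \<Omega>)"
  shows "(L2_norm (lebesgue_on \<Omega>) f)\<^sup>2 = (\<Sum>K\<in>T. (L2_norm (lebesgue_on K) f)\<^sup>2)"
  unfolding L2_norm_sq by (rule integral_\<Omega>_eq_sum[OF L2_D(2)[OF assms]])

section \<open>Arc length on the boundary as a sum over the boundary edges\<close>

abbreviation "BE \<equiv> boundary_edges \<Omega> T"
abbreviation "\<Gamma>M \<equiv> boundary_measure \<Omega> T"

definition all_edges :: "plane set set" where
  "all_edges = {e. \<exists>K\<in>T. e edge_of K}"

lemma finite_edges: "finite all_edges"
proof -
  have "finite {e. e edge_of K}" if "K \<in> T" for K
    using simplex_is_triangle[OF tri_simplex[OF that]] is_triangle_edges(1) by (metis finite.emptyI finite.insertI)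
  moreover have "all_edges = (\<Union>K\<in>T. {e. e edge_of K})" by (auto simp: all_edges_def)
  ultimately show ?thesis using tri_finite by simp
qed

lemma BE_subset: "BE \<subseteq> all_edges" by (auto simp: boundary_edges_def all_edges_def)

lemma finite_BE: "finite BE" using finite_subset[OF BE_subset finite_edges] .

lemma BE_triangle:
  assumes "e \<in> BE"
  obtains K P a b where "K \<in> T" "e edge_of K" "is_triangle K P a b" "e = closed_segment a b" "e \<subseteq> frontier \<Omega>"
proof -
  obtain K where K: "K \<in> T" "e edge_of K" "e \<subseteq> frontier \<Omega>" using assms by (auto simp: boundary_edges_def)
  show ?thesis by (rule edge_is_triangle[OF tri_simplex[OF K(1)] K(2)]) (rule that[OF K(1,2) _ _ K(3)])
qed

lemma frontier_borel [measurable, simp]: "frontier \<Omega> \<in> sets borel"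
  by (simp add: borel_closed)

text \<open>Restricted to \<open>frontier \<Omega>\<close> so that it has the space and the
  measurable sets of \<open>\<Gamma>M\<close>; measurability on an edge and on the whole boundary
  are then the same.\<close>

definition edge_measure :: "plane set \<Rightarrow> plane measure" where
  "edge_measure e = restrict_space (segment_measure e) (frontier \<Omega>)"

lemma space_\<Gamma>M [simp]: "space \<Gamma>M = frontier \<Omega>"
  and sets_\<Gamma>M: "sets \<Gamma>M = sets (restrict_space borel (frontier \<Omega>))"
proof -
  have "sigma_algebra (frontier \<Omega>) (sets (restrict_space borel (frontier \<Omega>)))"
    using sets.sigma_algebra_axioms[of "restrict_space borel (frontier \<Omega>)"] by (simp add: space_restrict_space)
  then show "space \<Gamma>M = frontier \<Omega>" "sets \<Gamma>M = sets (restrict_space borel (frontier \<Omega>))"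
    unfolding boundary_measure_def
    by (simp_all add: sigma_algebra.sets_measure_of_eq sigma_algebra.space_measure_of_eq)
qed

lemma space_edge_measure [simp]: "space (edge_measure e) = frontier \<Omega>"
  and sets_edge_measure [simp, measurable_cong]: "sets (edge_measure e) = sets \<Gamma>M"
  unfolding edge_measure_def sets_\<Gamma>M by (auto simp: space_restrict_space sets_restrict_space)

lemma emeasure_edge_measure: "A \<in> sets \<Gamma>M \<Longrightarrow> emeasure (edge_measure e) A = emeasure (segment_measure e) A"
  unfolding edge_measure_def sets_\<Gamma>M
  by (subst emeasure_restrict_space) (auto simp: sets_restrict_space)

text \<open>\<open>measure_of\<close> returns the given set function only if it is countably
  additive; here this follows by exchanging a series with the finite sum over the edges.\<close>

lemma emeasure_\<Gamma>M: 
  assumes "A \<in> sets \<Gamma>M" shows "emeasure \<Gamma>M A = (\<Sum>e\<in>BE. emeasure (edge_measure e) A)"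
proof -
  have "emeasure \<Gamma>M A = (\<Sum>e\<in>BE. emeasure (segment_measure e) A)"
    unfolding boundary_measure_def
  proof (rule emeasure_measure_of_sigma)
    show "sigma_algebra (frontier \<Omega>) (sets (restrict_space borel (frontier \<Omega>)))"
      using sets.sigma_algebra_axioms[of "restrict_space borel (frontier \<Omega>)"] by (simp add: space_restrict_space)
    show "positive (sets (restrict_space borel (frontier \<Omega>))) (\<lambda>A. \<Sum>e\<in>BE. emeasure (segment_measure e) A)"
      by (simp add: positive_def)
    show "countably_additive (sets (restrict_space borel (frontier \<Omega>))) (\<lambda>A. \<Sum>e\<in>BE. emeasure (segment_measure e) A)"
    proof (rule countably_additiveI)
      fix A :: "nat \<Rightarrow> plane set"
      assume A: "range A \<subseteq> sets (restrict_space borel (frontier \<Omega>))" "disjoint_family A"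
      then have A': "range A \<subseteq> sets (segment_measure e)" for e
        by (auto simp: sets_restrict_space)
      have "(\<Sum>i. \<Sum>e\<in>BE. emeasure (segment_measure e) (A i)) = (\<Sum>e\<in>BE. \<Sum>i. emeasure (segment_measure e) (A i))"
        by (rule suminf_sum) auto
      then show "(\<Sum>i. \<Sum>e\<in>BE. emeasure (segment_measure e) (A i)) = (\<Sum>e\<in>BE. emeasure (segment_measure e) (\<Union> (range A)))"
        using suminf_emeasure[OF A' A(2)] by simp
    qed
    show "A \<in> sets (restrict_space borel (frontier \<Omega>))" using assms by (simp add: sets_\<Gamma>M)
  qed
  then show ?thesis using emeasure_edge_measure[OF assms] by simp
qed

lemma measurable_edge_measure [simp]: "f \<in> borel_measurable (edge_measure e) \<longleftrightarrow> f \<in> borel_measurable \<Gamma>M"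
  by (rule arg_cong[where f = "\<lambda>X. f \<in> X"], rule measurable_cong_sets) auto

lemma nn_integral_\<Gamma>M:
  assumes "f \<in> borel_measurable \<Gamma>M"
  shows "(\<integral>\<^sup>+x. f x \<partial>\<Gamma>M) = (\<Sum>e\<in>BE. \<integral>\<^sup>+x. f x \<partial>edge_measure e)"
  using assms
proof (induction rule: borel_measurable_induct)
  case (cong f g)
  have "(\<integral>\<^sup>+x. f x \<partial>\<Gamma>M) = (\<integral>\<^sup>+x. g x \<partial>\<Gamma>M)" "(\<integral>\<^sup>+x. f x \<partial>edge_measure e) = (\<integral>\<^sup>+x. g x \<partial>edge_measure e)" for e
    by (rule nn_integral_cong; simp add: cong(3))+
  then show ?case using cong by simp
next
  case (set A)
  then show ?case by (simp add: emeasure_\<Gamma>M)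
next
  case (mult u c)
  then show ?case by (simp add: nn_integral_cmult sum_distrib_left)
next
  case (add u v)
  then show ?case by (simp add: nn_integral_add sum.distrib)
next
  case (seq U)
  have m: "U i \<in> borel_measurable \<Gamma>M" for i using seq by simp
  have "(\<integral>\<^sup>+x. (SUP i. U i x) \<partial>\<Gamma>M) = (SUP i. \<integral>\<^sup>+x. U i x \<partial>\<Gamma>M)"
    by (rule nn_integral_monotone_convergence_SUP[OF seq(3) m])
  also have "\<dots> = (SUP i. \<Sum>e\<in>BE. \<integral>\<^sup>+x. U i x \<partial>edge_measure e)" using seq by simp
  also have "\<dots> = (\<Sum>e\<in>BE. SUP i. \<integral>\<^sup>+x. U i x \<partial>edge_measure e)"
    by (rule ennreal_SUP_sum)
       (use seq(3) in \<open>auto simp: incseq_def le_fun_def intro!: nn_integral_mono\<close>)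
  also have "\<dots> = (\<Sum>e\<in>BE. \<integral>\<^sup>+x. (SUP i. U i x) \<partial>edge_measure e)"
    by (intro sum.cong refl nn_integral_monotone_convergence_SUP[symmetric] seq(3)) (use m in simp)
  finally show ?case by (simp add: image_image SUP_apply[abs_def])
qed

lemma integrable_\<Gamma>M_edge:
  fixes f :: "plane \<Rightarrow> real"
  assumes f: "integrable \<Gamma>M f" and e: "e \<in> BE" shows "integrable (edge_measure e) f"
proof -
  have m [measurable]: "f \<in> borel_measurable \<Gamma>M" using f by auto
  have "(\<integral>\<^sup>+x. ennreal (norm (f x)) \<partial>edge_measure e) \<le> (\<Sum>e\<in>BE. \<integral>\<^sup>+x. ennreal (norm (f x)) \<partial>edge_measure e)"
    by (rule member_le_sum[OF e]) (auto simp: finite_BE)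
  also have "\<dots> < \<infinity>" using f by (subst nn_integral_\<Gamma>M[symmetric]) (auto simp: integrable_iff_bounded)
  finally show ?thesis using m by (simp add: integrable_iff_bounded)
qed

lemma integrable_\<Gamma>M:
  fixes f :: "plane \<Rightarrow> real"
  assumes m: "f \<in> borel_measurable \<Gamma>M" and f: "\<And>e. e \<in> BE \<Longrightarrow> integrable (edge_measure e) f"
  shows "integrable \<Gamma>M f"
proof -
  note [measurable] = m
  have "(\<integral>\<^sup>+x. ennreal (norm (f x)) \<partial>\<Gamma>M) = (\<Sum>e\<in>BE. \<integral>\<^sup>+x. ennreal (norm (f x)) \<partial>edge_measure e)"
    by (rule nn_integral_\<Gamma>M) measurable
  also have "\<dots> < \<infinity>" using f by (simp add: integrable_iff_bounded finite_BE)
  finally show ?thesis using m by (simp add: integrable_iff_bounded)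
qed

lemma integral_\<Gamma>M:
  fixes f :: "plane \<Rightarrow> real"
  assumes f: "integrable \<Gamma>M f"
  shows "(LINT x|\<Gamma>M. f x) = (\<Sum>e\<in>BE. LINT x|edge_measure e. f x)"
proof -
  have m [measurable]: "f \<in> borel_measurable \<Gamma>M" using f by auto
  have fin: "(\<integral>\<^sup>+x. ennreal (f x) \<partial>edge_measure e) < \<infinity>" "(\<integral>\<^sup>+x. ennreal (- f x) \<partial>edge_measure e) < \<infinity>" if "e \<in> BE" for e
    using integrable_\<Gamma>M_edge[OF f that] unfolding real_integrable_def by (auto simp: less_top)
  have "(LINT x|\<Gamma>M. f x) = enn2real (\<Sum>e\<in>BE. \<integral>\<^sup>+x. ennreal (f x) \<partial>edge_measure e) - enn2real (\<Sum>e\<in>BE. \<integral>\<^sup>+x. ennreal (- f x) \<partial>edge_measure e)"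
    by (simp add: real_lebesgue_integral_def[OF f] nn_integral_\<Gamma>M)
  also have "\<dots> = (\<Sum>e\<in>BE. enn2real (\<integral>\<^sup>+x. ennreal (f x) \<partial>edge_measure e)) - (\<Sum>e\<in>BE. enn2real (\<integral>\<^sup>+x. ennreal (- f x) \<partial>edge_measure e))"
    using fin by (subst (1 2) enn2real_sum) auto
  also have "\<dots> = (\<Sum>e\<in>BE. LINT x|edge_measure e. f x)"
    unfolding sum_subtractf[symmetric]
    by (intro sum.cong refl real_lebesgue_integral_def[symmetric] integrable_\<Gamma>M_edge[OF f])
  finally show ?thesis .
qed

lemma AE_edge_measure:
  assumes "AE x in segment_measure e. P x" shows "AE x in edge_measure e. P x"
  unfolding edge_measure_def using assms by (subst AE_restrict_space_iff) auto

lemma edge_measure_integral: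
  assumes e: "e \<in> BE" "e = closed_segment a b" and f: "continuous_on UNIV f"
  shows "(LINT x|edge_measure e. f x) = dist a b * edge_mean f a b"
    and "integrable (edge_measure e) f"
proof -
  have sub: "closed_segment a b \<subseteq> frontier \<Omega>" using e by (auto simp: boundary_edges_def)
  have ae: "AE x in segment_measure (closed_segment a b). f x = indicator (frontier \<Omega>) x *\<^sub>R f x"
    using AE_segment_measure_in[of a b] by eventually_elim (use sub in \<open>auto simp: indicator_def\<close>)
  have m [measurable]: "f \<in> borel_measurable borel" by (rule borel_measurable_continuous_onI[OF f])
  have "(LINT x|edge_measure e. f x) = (LINT x|segment_measure e. indicator (frontier \<Omega>) x *\<^sub>R f x)"
    unfolding edge_measure_def by (rule integral_restrict_space) auto
  also have "\<dots> = (LINT x|segment_measure (closed_segment a b). f x)"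
    unfolding e(2) by (rule integral_cong_AE) (use ae in \<open>auto elim: eventually_mono\<close>)
  finally show "(LINT x|edge_measure e. f x) = dist a b * edge_mean f a b"
    using segment_measure_integral(1)[OF f] by simp
  show "integrable (edge_measure e) f"
    unfolding edge_measure_def e(2)
    by (subst integrable_restrict_space, simp, rule integrable_cong_AE_imp[OF segment_measure_integral(2)[OF f, of a b]]) (use ae in auto)
qed

lemma emeasure_edge_measure_space:
  assumes e: "e \<in> BE" "e = closed_segment a b"
  shows "emeasure (edge_measure e) (frontier \<Omega>) = dist a b"
proof -
  have sub: "closed_segment a b \<subseteq> frontier \<Omega>" using e by (auto simp: boundary_edges_def)
  have "emeasure (edge_measure e) (frontier \<Omega>) = emeasure (segment_measure e) (frontier \<Omega>)"
    by (rule emeasure_edge_measure) (auto simp: sets_\<Gamma>M sets_restrict_space)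
  also have "\<dots> = emeasure (segment_measure e) UNIV"
    unfolding e(2) using AE_segment_measure_in[of a b]
    by (intro emeasure_eq_AE) (use sub in \<open>auto elim!: eventually_mono\<close>)
  finally show ?thesis unfolding e(2) emeasure_segment_measure_UNIV .
qed

end

section \<open>Green's formula on the mesh\<close>

lemma continuous_L2_bounded:
  fixes f :: "plane \<Rightarrow> 'b::euclidean_space"
  assumes f: "continuous_on UNIV f" and S: "bounded S" "S \<in> sets borel"
  shows "f \<in> L2 (lebesgue_on S)"
proof (rule L2_I)
  have m: "f \<in> borel_measurable borel" by (rule borel_measurable_continuous_onI[OF f])
  then show "f \<in> borel_measurable (lebesgue_on S)"
    by (intro measurable_restrict_space1 measurable_completion) simp
  have "integrable (lebesgue_on (closure S)) (\<lambda>x. (norm (f x))\<^sup>2)"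
    using S by (intro continuous_imp_integrable_compact continuous_intros f) simp
  then have "integrable lebesgue (\<lambda>x. indicator (closure S) x * (norm (f x))\<^sup>2)"
    by (simp add: integrable_restrict_space)
  from integrable_mult_indicator[OF _ this, of S] S
  have "integrable lebesgue (\<lambda>x. indicator S x * (indicator (closure S) x * (norm (f x))\<^sup>2))" by simp
  moreover have "indicator S x * (indicator (closure S) x * (norm (f x))\<^sup>2) = indicator S x * (norm (f x))\<^sup>2" for x
    using closure_subset[of S] by (auto simp: indicator_def)
  ultimately show "integrable (lebesgue_on S) (\<lambda>x. (norm (f x))\<^sup>2)"
    using S by (simp add: integrable_restrict_space)
qed

lemma integral_lebesgue_on_subset:
  fixes h :: "plane \<Rightarrow> real"
  assumes "S \<subseteq> S'" "S \<in> sets lebesgue" "S' \<in> sets lebesgue" "\<And>x. x \<notin> S \<Longrightarrow> h x = 0"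
  shows "(LINT x|lebesgue_on S'. h x) = (LINT x|lebesgue_on S. h x)"
proof -
  have eq: "(\<lambda>x. indicator S' x *\<^sub>R h x) = (\<lambda>x. indicator S x *\<^sub>R h x)"
  proof
    fix x show "indicator S' x *\<^sub>R h x = indicator S x *\<^sub>R h x"
      using assms(1) assms(4)[of x] by (auto simp: indicator_def)
  qed
  have "(LINT x|lebesgue_on S'. h x) = (LINT x|lebesgue. indicator S' x *\<^sub>R h x)"
    using assms(3) by (intro integral_restrict_space) auto
  also have "\<dots> = (LINT x|lebesgue_on S. h x)"
    unfolding eq using assms(2) by (intro integral_restrict_space[symmetric]) auto
  finally show ?thesis .
qed

lemma test_functions_outside:
  assumes "\<phi> \<in> test_functions U" "x \<notin> U" shows "\<phi> x = 0" "grad \<phi> x = 0"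
proof -
  let ?S = "closure {x. \<phi> x \<noteq> 0}"
  have x: "x \<notin> ?S" using assms by (auto simp: test_functions_def)
  then show "\<phi> x = 0" using closure_subset[of "{x. \<phi> x \<noteq> 0}"] by auto
  have "eventually (\<lambda>y. y \<in> - ?S) (nhds x)"
    using x by (intro eventually_nhds_in_open) auto
  then have ev: "eventually (\<lambda>y. \<phi> y = 0) (nhds x)"
    by eventually_elim (use closure_subset[of "{x. \<phi> x \<noteq> 0}"] in auto)
  have "((\<lambda>y. 0) has_derivative (\<lambda>h. h \<bullet> 0)) (at x)" by simp
  then have "GDERIV \<phi> x :> 0"
    unfolding gderiv_def
    by (rule has_derivative_transform_eventually[where f = "\<lambda>y. 0"])
       (use ev \<open>\<phi> x = 0\<close> eventually_nhds_conv_at[of "\<lambda>y. \<phi> y = 0"] in \<open>auto elim: eventually_mono\<close>)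
  then show "grad \<phi> x = 0" by (rule grad_eq)
qed

lemma test_functions_C_inf: "\<phi> \<in> test_functions U \<Longrightarrow> \<phi> \<in> C_inf"
  and test_functions_mono: "\<phi> \<in> test_functions U \<Longrightarrow> U \<subseteq> U' \<Longrightarrow> \<phi> \<in> test_functions U'"
  by (auto simp: test_functions_def)

definition field_div :: "(plane \<Rightarrow> plane) \<Rightarrow> plane \<Rightarrow> real" where
  "field_div q x = fst (grad (\<lambda>x. fst (q x)) x) + snd (grad (\<lambda>x. snd (q x)) x)"

definition smooth_field :: "(plane \<Rightarrow> plane) \<Rightarrow> bool" where
  "smooth_field q \<longleftrightarrow> (\<lambda>x. fst (q x)) \<in> C_inf \<and> (\<lambda>x. snd (q x)) \<in> C_inf"

lemma C_inf_continuous: "\<phi> \<in> C_inf \<Longrightarrow> continuous_on UNIV \<phi>"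
  and C_inf_continuous_grad: "\<phi> \<in> C_inf \<Longrightarrow> continuous_on UNIV (grad \<phi>)"
  using C1_continuous[OF C_inf_C1] C1_continuous_grad[OF C_inf_C1] by blast+

lemma smooth_field_continuous:
  assumes "smooth_field q" shows "continuous_on UNIV q" "continuous_on UNIV (field_div q)"
proof -
  have "continuous_on UNIV (\<lambda>x. (fst (q x), snd (q x)))"
    using assms by (intro continuous_intros C_inf_continuous) (auto simp: smooth_field_def)
  then show "continuous_on UNIV q" by simp
  show "continuous_on UNIV (field_div q)"
    unfolding field_div_def[abs_def] using assms
    by (intro continuous_intros C_inf_continuous_grad) (auto simp: smooth_field_def)
qed

text \<open>The divergence theorem for the product of \<open>\<phi>\<close> and \<open>q\<close>;
  the product rule splits its divergence into the two integrands.\<close>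

lemma Green_simplex_field:
  assumes K: "2 simplex K" and q: "smooth_field q" and \<phi>: "\<phi> \<in> C_inf"
  shows "(LINT x|lebesgue_on K. q x \<bullet> grad \<phi> x + \<phi> x * field_div q x) =
     (\<Sum>e | e edge_of K. LINT x|segment_measure e. \<phi> x * (q x \<bullet> outward_normal K e))"
proof -
  have q': "(\<lambda>x. fst (q x)) \<in> C_inf" "(\<lambda>x. snd (q x)) \<in> C_inf" using q by (auto simp: smooth_field_def)
  have 1: "C1_with_grad (\<lambda>x. \<phi> x * r x) (\<lambda>x. \<phi> x *\<^sub>R grad r x + r x *\<^sub>R grad \<phi> x)" if "r \<in> C_inf" for r
    using C_inf_C1[OF \<phi>] C_inf_C1[OF that] C_inf_continuous[OF \<phi>] C_inf_continuous[OF that]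
    unfolding C1_with_grad_def by (auto intro!: GDERIV_mult continuous_intros)
  have e: "fst (\<phi> x *\<^sub>R grad (\<lambda>x. fst (q x)) x + fst (q x) *\<^sub>R grad \<phi> x) + snd (\<phi> x *\<^sub>R grad (\<lambda>x. snd (q x)) x + snd (q x) *\<^sub>R grad \<phi> x)
     = q x \<bullet> grad \<phi> x + \<phi> x * field_div q x" for x
    by (simp add: field_div_def inner_prod_def algebra_simps)
  have e2: "(\<phi> x * fst (q x), \<phi> x * snd (q x)) \<bullet> n = \<phi> x * (q x \<bullet> n)" for x n
    by (simp add: inner_prod_def algebra_simps)
  show ?thesis using Green_simplex[OF K 1[OF q'(1)] 1[OF q'(2)]] unfolding e e2 .
qed

lemma P1_C_inf: assumes "a \<in> P1" shows "a \<in> C_inf"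
proof -
  obtain \<alpha> \<beta> \<gamma> where "a = (\<lambda>(x, y). \<alpha> + \<beta> * x + \<gamma> * y)" using assms by (auto simp: P1_def)
  then have "a = (\<lambda>x. \<alpha> + \<beta> * fst x + \<gamma> * snd x)" by auto
  then show ?thesis by (simp add: C_inf_add C_inf_mult C_inf_const C_inf_fst C_inf_snd)
qed

lemma RT1_smooth_field: assumes "q \<in> RT1" shows "smooth_field q"
proof -
  obtain a b d where q: "q = (\<lambda>x. (a x, b x) + d x *\<^sub>R x)" "a \<in> P1" "b \<in> P1" "d \<in> P1"
    using assms by (auto simp: RT1_def)
  note abd = q(2-4)[THEN P1_C_inf]
  have "(\<lambda>x. a x + d x * fst x) \<in> C_inf" "(\<lambda>x. b x + d x * snd x) \<in> C_inf"
    by (intro C_inf_add C_inf_mult abd C_inf_fst C_inf_snd)+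
  then show ?thesis unfolding smooth_field_def q(1) by simp
qed

text \<open>No degree is recorded: a polynomial with infinitely many zeros vanishes whatever its
  degree.\<close>

definition is_real_polynomial :: "(real \<Rightarrow> real) \<Rightarrow> bool" where
  "is_real_polynomial g \<longleftrightarrow> (\<exists>p. \<forall>t. g t = poly p t)"

lemma polyfun_const: "is_real_polynomial (\<lambda>t. c)"
  and polyfun_id: "is_real_polynomial (\<lambda>t. t)"
  and polyfun_add: "is_real_polynomial f \<Longrightarrow> is_real_polynomial g \<Longrightarrow> is_real_polynomial (\<lambda>t. f t + g t)"
  and polyfun_mult: "is_real_polynomial f \<Longrightarrow> is_real_polynomial g \<Longrightarrow> is_real_polynomial (\<lambda>t. f t * g t)"
proof -
  show "is_real_polynomial (\<lambda>t. c)" unfolding is_real_polynomial_def by (rule exI[of _ "[:c:]"]) simp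
  show "is_real_polynomial (\<lambda>t. t)" unfolding is_real_polynomial_def by (rule exI[of _ "[:0,1:]"]) simp
  show "is_real_polynomial (\<lambda>t. f t + g t)" if "is_real_polynomial f" "is_real_polynomial g"
    using that unfolding is_real_polynomial_def by (metis poly_add)
  show "is_real_polynomial (\<lambda>t. f t * g t)" if "is_real_polynomial f" "is_real_polynomial g"
    using that unfolding is_real_polynomial_def by (metis poly_mult)
qed

lemma polyfun_sum: "(\<And>i. i \<in> I \<Longrightarrow> is_real_polynomial (f i)) \<Longrightarrow> is_real_polynomial (\<lambda>t. \<Sum>i\<in>I. f i t)"
  by (induction I rule: infinite_finite_induct) (auto intro: polyfun_const polyfun_add)

lemma polyfun_zero:
  assumes "is_real_polynomial g" "infinite {t. g t = 0}" shows "g t = 0"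
proof -
  obtain p where p: "\<And>t. g t = poly p t" using assms(1) by (auto simp: is_real_polynomial_def)
  then have "p = 0" using assms(2) poly_roots_finite[of p] by auto
  then show ?thesis using p by simp
qed

lemma RT1_polyfun:
  assumes "q \<in> RT1" shows "is_real_polynomial (\<lambda>t. q (linepath a b t) \<bullet> n)"
proof -
  obtain \<alpha> \<beta> \<delta> where q: "q = (\<lambda>x. (\<alpha> x, \<beta> x) + \<delta> x *\<^sub>R x)" "\<alpha> \<in> P1" "\<beta> \<in> P1" "\<delta> \<in> P1"
    using assms by (auto simp: RT1_def)
  have l: "linepath a b t = (fst a + t * (fst b - fst a), snd a + t * (snd b - snd a))" for t
    by (simp add: linepath_def prod_eq_iff algebra_simps)
  have P: "is_real_polynomial (\<lambda>t. g (fst a + t * (fst b - fst a), snd a + t * (snd b - snd a)))" if g: "g \<in> P1" for g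
  proof -
    obtain u v w where "g = (\<lambda>(x, y). u + v * x + w * y)" using g by (auto simp: P1_def)
    then show ?thesis by (simp add: polyfun_add polyfun_mult polyfun_const polyfun_id)
  qed
  show ?thesis unfolding q(1) l
    by (simp add: inner_prod_def) (intro polyfun_add polyfun_mult polyfun_const polyfun_id P q)
qed

context polygonal_mesh
begin

section \<open>Piecewise Raviart-Thomas fields and their normal jumps\<close>

lemma continuous_L2_\<Omega>: "continuous_on UNIV f \<Longrightarrow> f \<in> L2 (lebesgue_on \<Omega>)"
  by (intro continuous_L2_bounded bounded_\<Omega>) auto

lemma continuous_L2_tri: "K \<in> T \<Longrightarrow> continuous_on UNIV f \<Longrightarrow> f \<in> L2 (lebesgue_on K)"
  by (intro continuous_L2_bounded compact_imp_bounded tri_compact) auto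

lemma borel_measurable_\<Gamma>M: "f \<in> borel_measurable borel \<Longrightarrow> f \<in> borel_measurable \<Gamma>M"
  unfolding measurable_cong_sets[OF sets_\<Gamma>M refl] by (rule measurable_restrict_space1)

lemma continuous_integrable_\<Gamma>M:
  fixes f :: "plane \<Rightarrow> real"
  assumes f: "continuous_on UNIV f" shows "integrable \<Gamma>M f"
proof (rule integrable_\<Gamma>M)
  show "f \<in> borel_measurable \<Gamma>M"
    by (intro borel_measurable_\<Gamma>M borel_measurable_continuous_onI f)
  fix e assume e: "e \<in> BE"
  obtain K P a b where "e = closed_segment a b" using BE_triangle[OF e] by metis
  then show "integrable (edge_measure e) f" using edge_measure_integral(2)[OF e _ f] by blast
qed

lemma continuous_L2_\<Gamma>M:
  fixes f :: "plane \<Rightarrow> real"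
  assumes f: "continuous_on UNIV f" shows "f \<in> L2 \<Gamma>M"
  by (intro L2_I borel_measurable_\<Gamma>M borel_measurable_continuous_onI f continuous_integrable_\<Gamma>M continuous_intros)

lemma AE_interior_tri:
  assumes K: "K \<in> T" and P: "AE x in lebesgue_on (interior K). P x" shows "AE x in lebesgue_on K. P x"
proof -
  have "frontier K \<in> null_sets lebesgue"
    using negligible_convex_frontier[OF convex_simplex[OF tri_simplex[OF K]]] by (simp add: negligible_iff_null_sets)
  moreover have "{x. \<not> (x \<in> K \<longrightarrow> x \<in> interior K)} \<subseteq> frontier K"
    using closure_subset by (auto simp: frontier_def)
  ultimately have "AE x in lebesgue. x \<in> K \<longrightarrow> x \<in> interior K" by (intro AE_I') auto
  moreover have "AE x in lebesgue. x \<in> interior K \<longrightarrow> P x"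
    using P by (subst (asm) AE_restrict_space_iff) auto
  ultimately have "AE x in lebesgue. x \<in> K \<longrightarrow> P x" by eventually_elim auto
  then show ?thesis using tri_sets_lebesgue[OF K] by (simp add: AE_restrict_space_iff)
qed

lemma interior_tri_subset: "K \<in> T \<Longrightarrow> interior K \<subseteq> \<Omega>"
proof -
  assume "K \<in> T"
  then have "K \<subseteq> closure \<Omega>" using tri_Union by blast
  then have "interior K \<subseteq> interior (closure \<Omega>)" by (rule interior_mono)
  then show ?thesis using dom by (simp add: polygonal_domain_def)
qed

lemma edge_interior: assumes "K \<in> T" "e edge_of K" shows "e \<inter> interior K = {}"
proof -
  have "aff_dim e \<noteq> aff_dim K" using assms tri_simplex[OF assms(1)] by (simp add: edge_of_def aff_dim_simplex)
  then show ?thesis using assms by (intro face_of_disjoint_interior) (auto simp: edge_of_def)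
qed

lemma all_edges_segment:
  assumes "e \<in> all_edges" obtains a b where "e = closed_segment a b" "a \<noteq> b"
proof -
  obtain K where K: "K \<in> T" "e edge_of K" using assms by (auto simp: all_edges_def)
  show ?thesis
    by (rule edge_is_triangle[OF tri_simplex[OF K(1)] K(2)]) (rule that, assumption, erule is_triangle_distinct(1))
qed

lemma segment_integral_zero:
  fixes g :: "plane \<Rightarrow> real"
  assumes "e \<in> all_edges" "continuous_on UNIV g" "\<And>x. x \<in> e \<Longrightarrow> g x = 0"
  shows "(LINT x|segment_measure e. g x) = 0"
proof -
  obtain a b where "e = closed_segment a b" using all_edges_segment[OF assms(1)] by metis
  then show ?thesis using AE_segment_measure_in[of a b] assms(3)
    by (intro integral_eq_zero_AE) (auto elim!: eventually_mono)
qed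

text \<open>For test functions supported in the interior of \<open>K\<close> only the values of
  \<open>p\<close> on \<open>K\<close> matter and all edge terms of Green's formula vanish. Weak and
  classical divergence thus have the same integrals against them, and the fundamental lemma
  applies.\<close>

lemma divergence_eq_on_triangle:
  assumes K: "K \<in> T" and p: "p \<in> L2 (lebesgue_on \<Omega>)" and d: "d \<in> L2 (lebesgue_on \<Omega>)"
    and pd: "has_weak_div \<Omega> p d" and q: "smooth_field q" and pq: "AE x in lebesgue_on K. p x = q x"
  shows "AE x in lebesgue_on K. d x = field_div q x"
proof (rule AE_interior_tri[OF K])
  let ?U = "interior K"
  note cq = smooth_field_continuous[OF q]
  have U: "?U \<in> sets lebesgue" "?U \<subseteq> K" "?U \<subseteq> \<Omega>" using interior_subset interior_tri_subset[OF K] by auto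
  have Kl: "K \<in> sets lebesgue" by (rule tri_sets_lebesgue[OF K])
  have restr: "integrable (lebesgue_on ?U) g" if "integrable (lebesgue_on K) g" for g :: "plane \<Rightarrow> real"
  proof -
    have "integrable lebesgue (\<lambda>x. indicator K x * g x)" using that Kl by (simp add: integrable_restrict_space)
    from integrable_mult_indicator[OF U(1) this]
    have "integrable lebesgue (\<lambda>x. indicator ?U x * (indicator K x * g x))" by simp
    moreover have "indicator ?U x * (indicator K x * g x) = indicator ?U x * g x" for x
      using U(2) by (auto simp: indicator_def)
    ultimately show ?thesis using U(1) by (simp add: integrable_restrict_space)
  qed
  have dK: "d \<in> L2 (lebesgue_on K)" by (rule L2_on_tri[OF K d])
  have one: "(\<lambda>x. 1::real) \<in> L2 (lebesgue_on K)" by (intro continuous_L2_tri K continuous_intros)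
  have wi: "integrable (lebesgue_on ?U) (\<lambda>x. d x - field_div q x)"
    using restr[OF L2_inner_integrable(2)[OF L2_diff[OF dK continuous_L2_tri[OF K cq(2)]] one]] by simp
  have "AE x in lebesgue_on ?U. d x - field_div q x = 0"
  proof (rule fundamental_lemma_calculus_of_variations[OF open_interior wi])
    fix \<phi> assume \<phi>: "\<phi> \<in> test_functions ?U"
    have \<phi>\<Omega>: "\<phi> \<in> test_functions \<Omega>" using test_functions_mono[OF \<phi> U(3)] .
    have \<phi>C: "\<phi> \<in> C_inf" using test_functions_C_inf[OF \<phi>] .
    note c\<phi> = C_inf_continuous[OF \<phi>C] C_inf_continuous_grad[OF \<phi>C]
    note out = test_functions_outside[OF \<phi>]
    have i1: "integrable (lebesgue_on \<Omega>) (\<lambda>x. p x \<bullet> grad \<phi> x)" "integrable (lebesgue_on \<Omega>) (\<lambda>x. d x * \<phi> x)"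
      using L2_inner_integrable(2)[OF p continuous_L2_\<Omega>[OF c\<phi>(2)]] L2_inner_integrable(2)[OF d continuous_L2_\<Omega>[OF c\<phi>(1)]] by auto
    have "(LINT x|lebesgue_on \<Omega>. p x \<bullet> grad \<phi> x + d x * \<phi> x) = 0"
      using pd \<phi>\<Omega> i1 unfolding has_weak_div_def by (simp add: Bochner_Integration.integral_add)
    moreover have "(LINT x|lebesgue_on \<Omega>. p x \<bullet> grad \<phi> x + d x * \<phi> x) = (LINT x|lebesgue_on ?U. p x \<bullet> grad \<phi> x + d x * \<phi> x)"
      by (rule integral_lebesgue_on_subset) (use U out in auto)
    moreover have "(LINT x|lebesgue_on K. p x \<bullet> grad \<phi> x + d x * \<phi> x) = (LINT x|lebesgue_on ?U. p x \<bullet> grad \<phi> x + d x * \<phi> x)"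
      by (rule integral_lebesgue_on_subset) (use U Kl out in auto)
    ultimately have 1: "(LINT x|lebesgue_on K. p x \<bullet> grad \<phi> x + d x * \<phi> x) = 0" by simp
    have cK: "continuous_on UNIV (\<lambda>x. q x \<bullet> grad \<phi> x)" "continuous_on UNIV (\<lambda>x. \<phi> x * field_div q x)"
      by (intro continuous_intros cq c\<phi>)+
    note comp = tri_compact[OF K]
    have iK: "integrable (lebesgue_on K) (\<lambda>x. q x \<bullet> grad \<phi> x)" "integrable (lebesgue_on K) (\<lambda>x. \<phi> x * field_div q x)"
      "integrable (lebesgue_on K) (\<lambda>x. d x * \<phi> x)"
      using continuous_imp_integrable_compact[OF cK(1) comp] continuous_imp_integrable_compact[OF cK(2) comp]
        integrable_on_tri(1)[OF K i1(2)] by auto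
    have "(LINT x|lebesgue_on K. q x \<bullet> grad \<phi> x + \<phi> x * field_div q x) =
        (\<Sum>e | e edge_of K. LINT x|segment_measure e. \<phi> x * (q x \<bullet> outward_normal K e))"
      by (rule Green_simplex_field[OF tri_simplex[OF K] q \<phi>C])
    also have "\<dots> = 0"
    proof (rule sum.neutral, rule ballI)
      fix e assume "e \<in> {e. e edge_of K}"
      then have e: "e edge_of K" by simp
      show "(LINT x|segment_measure e. \<phi> x * (q x \<bullet> outward_normal K e)) = 0"
      proof (rule segment_integral_zero)
        show "e \<in> all_edges" using K e by (auto simp: all_edges_def)
        show "continuous_on UNIV (\<lambda>x. \<phi> x * (q x \<bullet> outward_normal K e))" by (intro continuous_intros c\<phi> cq)
        show "\<phi> x * (q x \<bullet> outward_normal K e) = 0" if "x \<in> e" for x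
          using edge_interior[OF K e] that out(1)[of x] by auto
      qed
    qed
    finally have 2: "(LINT x|lebesgue_on K. q x \<bullet> grad \<phi> x + \<phi> x * field_div q x) = 0" .
    have 3: "(LINT x|lebesgue_on K. p x \<bullet> grad \<phi> x + d x * \<phi> x) = (LINT x|lebesgue_on K. q x \<bullet> grad \<phi> x + d x * \<phi> x)"
      using pq integrable_on_tri(1)[OF K i1(1)] iK by (intro integral_cong_AE) (auto elim: eventually_mono)
    have "(LINT x|lebesgue_on K. d x * \<phi> x) = (LINT x|lebesgue_on K. \<phi> x * field_div q x)"
      using 1 2 unfolding 3 Bochner_Integration.integral_add[OF iK(1,3)] Bochner_Integration.integral_add[OF iK(1,2)] by simp
    then have "(LINT x|lebesgue_on K. \<phi> x * (d x - field_div q x)) = 0"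
      using Bochner_Integration.integral_diff[OF iK(3,2)] by (simp add: algebra_simps)
    moreover have "(LINT x|lebesgue_on K. \<phi> x * (d x - field_div q x)) = (LINT x|lebesgue_on ?U. \<phi> x * (d x - field_div q x))"
      by (rule integral_lebesgue_on_subset) (use U Kl out in auto)
    ultimately show "(LINT x|lebesgue_on ?U. \<phi> x * (d x - field_div q x)) = 0" by simp
  qed
  then show "AE x in lebesgue_on ?U. d x = field_div q x" by eventually_elim simp
qed

text \<open>On an edge inside \<open>\<Omega>\<close> this is the jump of the normal component; on a boundary edge, which lies
  in a single triangle, it is the normal component itself.\<close>

definition jump :: "(plane set \<Rightarrow> plane \<Rightarrow> plane) \<Rightarrow> plane set \<Rightarrow> plane \<Rightarrow> real" where
  "jump q e x = (\<Sum>K | K \<in> T \<and> e edge_of K. q K x \<bullet> outward_normal K e)"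

lemma continuous_jump:
  assumes "\<And>K. K \<in> T \<Longrightarrow> q K \<in> RT1" shows "continuous_on S (jump q e)"
  unfolding jump_def[abs_def]
  by (intro continuous_intros continuous_on_subset[OF smooth_field_continuous(1)[OF RT1_smooth_field[OF assms]]]) auto

text \<open>Green's formula on each triangle, summed, with the sums over triangles and edges
  exchanged: the contributions of all triangles at an edge collect in \<open>jump\<close>.\<close>

lemma Green_mesh_jumps:
  assumes p: "p \<in> L2 (lebesgue_on \<Omega>)" and d: "d \<in> L2 (lebesgue_on \<Omega>)" and pd: "has_weak_div \<Omega> p d"
    and q: "\<And>K. K \<in> T \<Longrightarrow> q K \<in> RT1" and pq: "\<And>K. K \<in> T \<Longrightarrow> AE x in lebesgue_on K. p x = q K x"
    and \<phi>: "\<phi> \<in> C_inf"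
  shows "(LINT x|lebesgue_on \<Omega>. p x \<bullet> grad \<phi> x + d x * \<phi> x) = (\<Sum>e\<in>all_edges. LINT x|segment_measure e. \<phi> x * jump q e x)"
proof -
  note c\<phi> = C_inf_continuous[OF \<phi>] C_inf_continuous_grad[OF \<phi>]
  note sq = RT1_smooth_field[OF q]
  have i: "integrable (lebesgue_on \<Omega>) (\<lambda>x. p x \<bullet> grad \<phi> x + d x * \<phi> x)"
    using L2_inner_integrable(2)[OF p continuous_L2_\<Omega>[OF c\<phi>(2)]] L2_inner_integrable(2)[OF d continuous_L2_\<Omega>[OF c\<phi>(1)]]
    by auto
  have "(LINT x|lebesgue_on \<Omega>. p x \<bullet> grad \<phi> x + d x * \<phi> x) = (\<Sum>K\<in>T. LINT x|lebesgue_on K. p x \<bullet> grad \<phi> x + d x * \<phi> x)"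
    by (rule integral_\<Omega>_eq_sum[OF i])
  also have "\<dots> = (\<Sum>K\<in>T. \<Sum>e | e edge_of K. LINT x|segment_measure e. \<phi> x * (q K x \<bullet> outward_normal K e))"
  proof (rule sum.cong[OF refl])
    fix K assume K: "K \<in> T"
    have "(LINT x|lebesgue_on K. p x \<bullet> grad \<phi> x + d x * \<phi> x) = (LINT x|lebesgue_on K. q K x \<bullet> grad \<phi> x + \<phi> x * field_div (q K) x)"
    proof (rule integral_cong_AE)
      show "AE x in lebesgue_on K. p x \<bullet> grad \<phi> x + d x * \<phi> x = q K x \<bullet> grad \<phi> x + \<phi> x * field_div (q K) x"
        using pq[OF K] divergence_eq_on_triangle[OF K p d pd sq[OF K] pq[OF K]] by eventually_elim simp
      show "(\<lambda>x. p x \<bullet> grad \<phi> x + d x * \<phi> x) \<in> borel_measurable (lebesgue_on K)"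
        using integrable_on_tri(1)[OF K i] by auto
      have "continuous_on UNIV (\<lambda>x. q K x \<bullet> grad \<phi> x + \<phi> x * field_div (q K) x)"
        by (intro continuous_intros c\<phi> smooth_field_continuous sq K)
      from continuous_imp_integrable_compact[OF this tri_compact[OF K]]
      show "(\<lambda>x. q K x \<bullet> grad \<phi> x + \<phi> x * field_div (q K) x) \<in> borel_measurable (lebesgue_on K)" by auto
    qed
    also have "\<dots> = (\<Sum>e | e edge_of K. LINT x|segment_measure e. \<phi> x * (q K x \<bullet> outward_normal K e))"
      by (rule Green_simplex_field[OF tri_simplex[OF K] sq[OF K] \<phi>])
    finally show "(LINT x|lebesgue_on K. p x \<bullet> grad \<phi> x + d x * \<phi> x) = (\<Sum>e | e edge_of K. LINT x|segment_measure e. \<phi> x * (q K x \<bullet> outward_normal K e))" .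
  qed
  also have "\<dots> = (\<Sum>K\<in>T. \<Sum>e\<in>{e\<in>all_edges. e edge_of K}. LINT x|segment_measure e. \<phi> x * (q K x \<bullet> outward_normal K e))"
    by (intro sum.cong refl) (auto simp: all_edges_def)
  also have "\<dots> = (\<Sum>e\<in>all_edges. \<Sum>K\<in>{K\<in>T. e edge_of K}. LINT x|segment_measure e. \<phi> x * (q K x \<bullet> outward_normal K e))"
    by (rule sum.swap_restrict[OF tri_finite finite_edges])
  also have "\<dots> = (\<Sum>e\<in>all_edges. LINT x|segment_measure e. \<phi> x * jump q e x)"
  proof (rule sum.cong[OF refl])
    fix e assume "e \<in> all_edges"
    then obtain a b where e: "e = closed_segment a b" using all_edges_segment by metis
    have "(LINT x|segment_measure e. (\<Sum>K\<in>{K\<in>T. e edge_of K}. \<phi> x * (q K x \<bullet> outward_normal K e))) =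
      (\<Sum>K\<in>{K\<in>T. e edge_of K}. LINT x|segment_measure e. \<phi> x * (q K x \<bullet> outward_normal K e))"
    proof (rule Bochner_Integration.integral_sum)
      fix K assume "K \<in> {K \<in> T. e edge_of K}"
      then show "integrable (segment_measure e) (\<lambda>x. \<phi> x * (q K x \<bullet> outward_normal K e))"
        unfolding e by (intro segment_measure_integral(2) continuous_intros c\<phi> smooth_field_continuous sq) auto
    qed
    then show "(\<Sum>K\<in>{K\<in>T. e edge_of K}. LINT x|segment_measure e. \<phi> x * (q K x \<bullet> outward_normal K e)) = (LINT x|segment_measure e. \<phi> x * jump q e x)"
      by (simp add: jump_def sum_distrib_left)
  qed
  finally show ?thesis .
qed

text \<open>A bump around \<open>z\<close>, supported where no other edge passes and where the jump
  of \<open>e\<close> keeps its sign, reduces the edge sum of \<open>Green_mesh_jumps\<close> to one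
  integral of a function of constant sign. The weak divergence makes this integral zero, so the
  integrand vanishes at \<open>z\<close>, where the bump is positive.\<close>

lemma jump_zero_at:
  assumes p: "p \<in> L2 (lebesgue_on \<Omega>)" and d: "d \<in> L2 (lebesgue_on \<Omega>)" and pd: "has_weak_div \<Omega> p d"
    and q: "\<And>K. K \<in> T \<Longrightarrow> q K \<in> RT1" and pq: "\<And>K. K \<in> T \<Longrightarrow> AE x in lebesgue_on K. p x = q K x"
    and e: "e \<in> all_edges" and z: "z \<in> e" "z \<in> \<Omega>" "\<And>e'. e' \<in> all_edges \<Longrightarrow> e' \<noteq> e \<Longrightarrow> z \<notin> e'"
  shows "jump q e z = 0"
proof (rule ccontr)
  assume nz: "jump q e z \<noteq> 0"
  obtain a b where ab: "e = closed_segment a b" "a \<noteq> b" using all_edges_segment[OF e] .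
  have cJ: "continuous_on S (jump q e')" for S e' by (rule continuous_jump[OF q])
  define V where "V = \<Omega> \<inter> {x. 0 < jump q e x * jump q e z} - \<Union>(all_edges - {e})"
  have "closed (\<Union>(all_edges - {e}))"
  proof (rule closed_Union)
    show "\<forall>S\<in>all_edges - {e}. closed S"
    proof
      fix S assume "S \<in> all_edges - {e}"
      then have "S \<in> all_edges" by simp
      then show "closed S" by (rule all_edges_segment) simp
    qed
  qed (simp add: finite_edges)
  moreover have "open {x. 0 < jump q e x * jump q e z}"
    by (intro open_Collect_less continuous_intros cJ)
  ultimately have "open V" unfolding V_def by (intro open_Diff open_Int open_\<Omega>)
  moreover have "z \<in> V" using z nz by (auto simp: V_def zero_less_mult_iff) 
  ultimately obtain r s where rs: "z \<in> box r s" "cbox r s \<subseteq> V" using open_contains_cbox[of V] by metis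
  define \<phi> where "\<phi> = box_bump r s 0"
  have ne: "box r s \<noteq> {}" using rs by auto
  have "cbox r s \<subseteq> \<Omega>" using rs(2) by (auto simp: V_def)
  then have \<phi>t: "\<phi> \<in> test_functions \<Omega>" unfolding \<phi>_def using box_bump_test[OF ne] by blast
  have \<phi>C: "\<phi> \<in> C_inf" unfolding \<phi>_def by (rule box_bump_C_inf)
  note c\<phi> = C_inf_continuous[OF \<phi>C] C_inf_continuous_grad[OF \<phi>C]
  have i1: "integrable (lebesgue_on \<Omega>) (\<lambda>x. p x \<bullet> grad \<phi> x)" "integrable (lebesgue_on \<Omega>) (\<lambda>x. d x * \<phi> x)"
    using L2_inner_integrable(2)[OF p continuous_L2_\<Omega>[OF c\<phi>(2)]] L2_inner_integrable(2)[OF d continuous_L2_\<Omega>[OF c\<phi>(1)]] by auto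
  have "(LINT x|lebesgue_on \<Omega>. p x \<bullet> grad \<phi> x + d x * \<phi> x) = 0"
    using pd \<phi>t i1 unfolding has_weak_div_def by (simp add: Bochner_Integration.integral_add)
  then have "(\<Sum>e\<in>all_edges. LINT x|segment_measure e. \<phi> x * jump q e x) = 0"
    using Green_mesh_jumps[OF p d pd q pq \<phi>C] by simp
  moreover have "(LINT x|segment_measure e'. \<phi> x * jump q e' x) = 0" if "e' \<in> all_edges - {e}" for e'
  proof (rule segment_integral_zero)
    show "e' \<in> all_edges" using that by simp
    show "continuous_on UNIV (\<lambda>x. \<phi> x * jump q e' x)" by (intro continuous_intros c\<phi> cJ)
    fix x assume "x \<in> e'"
    then have "x \<notin> V" using that by (auto simp: V_def)
    then have "x \<notin> box r s" using rs(2) box_subset_cbox by blast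
    then show "\<phi> x * jump q e' x = 0" unfolding \<phi>_def by (simp add: box_bump_outside[OF ne])
  qed
  ultimately have "(LINT x|segment_measure e. \<phi> x * jump q e x) = 0"
    using sum.remove[OF finite_edges e, of "\<lambda>e. LINT x|segment_measure e. \<phi> x * jump q e x"] by simp
  then have "edge_mean (\<lambda>x. \<phi> x * jump q e x) a b = 0"
    using segment_measure_integral(1)[of "\<lambda>x. \<phi> x * jump q e x" a b] ab c\<phi> cJ by (auto simp: continuous_on_mult)
  then have "integral {0..1} (\<lambda>t. jump q e z * (\<phi> (linepath a b t) * jump q e (linepath a b t))) = 0"
    by (simp add: edge_mean_def)
  moreover have "0 \<le> jump q e z * (\<phi> x * jump q e x)" for x
  proof (cases "x \<in> box r s")
    case True
    then have "0 < jump q e x * jump q e z" using rs(2) box_subset_cbox[of r s] by (auto simp: V_def)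
    then show ?thesis using box_bump_bounds(1)[of r s 0 x] unfolding \<phi>_def
      by (metis mult.assoc mult.commute mult_nonneg_nonneg order_less_imp_le)
  qed (simp add: \<phi>_def box_bump_outside[OF ne])
  moreover have "continuous_on {0..1} (\<lambda>t. jump q e z * (\<phi> (linepath a b t) * jump q e (linepath a b t)))"
    by (intro continuous_intros continuous_on_compose2[OF c\<phi>(1)] continuous_on_compose2[OF cJ[of UNIV]]) auto
  ultimately have all0: "jump q e z * (\<phi> (linepath a b t) * jump q e (linepath a b t)) = 0" if "t \<in> {0..1}" for t
    using integral_eq_0_iff[of 0 1 "\<lambda>t. jump q e z * (\<phi> (linepath a b t) * jump q e (linepath a b t))"] that by auto
  obtain t where "t \<in> {0..1}" "z = linepath a b t" using z(1) unfolding ab linepath_image_01[symmetric] by auto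
  with all0[of t] nz have "\<phi> z = 0" by auto
  moreover have "\<phi> z > 0" unfolding \<phi>_def by (rule box_bump_inside[OF rs(1)])
  ultimately show False by simp
qed

text \<open>An edge that is not contained in \<open>\<Gamma>\<close> need not be known to lie in \<open>\<Omega>\<close>: the jump is a polynomial
  along the edge, and bump functions show that it vanishes at infinitely many points.\<close>

lemma jump_zero:
  assumes p: "p \<in> L2 (lebesgue_on \<Omega>)" and d: "d \<in> L2 (lebesgue_on \<Omega>)" and pd: "has_weak_div \<Omega> p d"
    and q: "\<And>K. K \<in> T \<Longrightarrow> q K \<in> RT1" and pq: "\<And>K. K \<in> T \<Longrightarrow> AE x in lebesgue_on K. p x = q K x"
    and e: "e \<in> all_edges" "e \<notin> BE" and x: "x \<in> e"
  shows "jump q e x = 0"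
proof -
  obtain a b where ab: "e = closed_segment a b" "a \<noteq> b" using all_edges_segment[OF e(1)] .
  obtain K where K: "K \<in> T" "e edge_of K" using e(1) by (auto simp: all_edges_def)
  have "e \<subseteq> closure \<Omega>" using K edge_of_imp_subset tri_Union by blast
  moreover have "\<not> e \<subseteq> frontier \<Omega>" using e K by (auto simp: boundary_edges_def)
  ultimately obtain z where z: "z \<in> e" "z \<in> \<Omega>"
    using open_\<Omega> by (auto simp: frontier_def interior_open)
  obtain t0 where t0: "t0 \<in> {0..1}" "z = linepath a b t0" using z(1) unfolding ab linepath_image_01[symmetric] by auto
  have inj: "s = t" if "linepath a b s = linepath a b t" for s t
  proof -
    have "(s - t) *\<^sub>R (b - a) = 0" using that by (simp add: linepath_def algebra_simps)
    then show ?thesis using ab(2) by simp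
  qed
  \<comment> \<open>The parameters of points in \<open>\<Omega>\<close>: a nonempty relatively open
    subset of the unit interval, hence infinite.\<close>
  define S where "S = {t \<in> {0..1}. linepath a b t \<in> \<Omega>}"
  have cl: "continuous_on X (linepath a b)" for X unfolding linepath_def by (intro continuous_intros)
  have "open (linepath a b -` \<Omega>)" using open_vimage[OF open_\<Omega> cl] .
  then obtain r where r: "r > 0" "\<And>t. dist t t0 < r \<Longrightarrow> linepath a b t \<in> \<Omega>"
    using z(2) t0 unfolding open_dist by auto
  have "infinite S"
  proof -
    have "{max 0 (t0 - r / 2)<..<min 1 (t0 + r / 2)} \<subseteq> S"
    proof
      fix t assume "t \<in> {max 0 (t0 - r / 2)<..<min 1 (t0 + r / 2)}"
      then have "0 < t" "t < 1" "t0 - r / 2 < t" "t < t0 + r / 2" by auto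
      then show "t \<in> S" using r(1) r(2)[of t] by (auto simp: S_def dist_real_def abs_less_iff)
    qed
    moreover have "max 0 (t0 - r / 2) < min 1 (t0 + r / 2)" using t0 r(1) by auto
    ultimately show ?thesis using infinite_Ioo finite_subset by blast
  qed
  \<comment> \<open>The parameters at which \<open>e\<close> meets another edge: finitely many, as
    two edges share at most one point and \<open>linepath\<close> is injective.\<close>
  define N where "N = (\<Union>e'\<in>all_edges - {e}. {t. linepath a b t \<in> e \<inter> e'})"
  have "finite {t. linepath a b t \<in> e \<inter> e'}" if e': "e' \<in> all_edges - {e}" for e'
  proof -
    obtain K' where K': "K' \<in> T" "e' edge_of K'" using e' by (auto simp: all_edges_def)
    obtain y where "e \<inter> e' \<subseteq> {y}"
      using triangulation_edges_Int[OF tri K(1) K'(1) K(2) K'(2)] e' by auto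
    then have sub: "{t. linepath a b t \<in> e \<inter> e'} \<subseteq> {t. linepath a b t = y}" by auto
    have "{t. linepath a b t = y} \<subseteq> {s}" if "linepath a b s = y" for s using inj that by auto
    then have "finite {t. linepath a b t = y}" by (metis (mono_tags, lifting) Collect_empty_eq finite.emptyI finite.insertI finite_subset)
    then show ?thesis using finite_subset[OF sub] by blast
  qed
  then have "finite N" unfolding N_def using finite_edges by auto
  have "jump q e (linepath a b t) = 0" if t: "t \<in> S - N" for t
  proof (rule jump_zero_at[OF p d pd q pq e(1)])
    show te: "linepath a b t \<in> e" using t unfolding ab linepath_image_01[symmetric] S_def by auto
    show "linepath a b t \<in> \<Omega>" using t by (simp add: S_def)
    show "linepath a b t \<notin> e'" if "e' \<in> all_edges" "e' \<noteq> e" for e'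
      using t te that by (auto simp: N_def)
  qed
  then have "S - N \<subseteq> {t. jump q e (linepath a b t) = 0}" by blast
  then have "infinite {t. jump q e (linepath a b t) = 0}"
    using \<open>infinite S\<close> \<open>finite N\<close> finite_subset Diff_infinite_finite by metis
  moreover have "is_real_polynomial (\<lambda>t. jump q e (linepath a b t))"
    unfolding jump_def by (intro polyfun_sum RT1_polyfun q) auto
  ultimately have "jump q e (linepath a b t) = 0" for t by (rule polyfun_zero[rotated])
  moreover obtain t where "x = linepath a b t" using x unfolding ab linepath_image_01[symmetric] by auto
  ultimately show ?thesis by simp
qed

text \<open>\<open>W_h_f\<close> supplies a polynomial for each pair of a triangle and a boundary
  edge of it. As there is at most one such edge per triangle, a single choice per triangle fits; the
  remaining triangles take theirs from \<open>W_h\<close>.\<close>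

lemma W_h_f_polynomials:
  assumes p: "p \<in> W_h_f \<Omega> T f"
  shows "\<exists>q. \<forall>K\<in>T. q K \<in> RT1 \<and> (AE x in lebesgue_on K. p x = q K x) \<and>
     (\<forall>e\<in>BE. e edge_of K \<longrightarrow> (AE x in segment_measure e. q K x \<bullet> outward_normal K e = f x))"
proof -
  have "\<exists>q\<in>RT1. (AE x in lebesgue_on K. p x = q x) \<and>
     (\<forall>e\<in>BE. e edge_of K \<longrightarrow> (AE x in segment_measure e. q x \<bullet> outward_normal K e = f x))" if K: "K \<in> T" for K
  proof (cases "\<exists>e\<in>BE. e edge_of K")
    case True
    then obtain e where e: "e \<in> BE" "e edge_of K" by blast
    then obtain q where q: "q \<in> RT1" "AE x in lebesgue_on K. p x = q x" "AE x in segment_measure e. q x \<bullet> outward_normal K e = f x"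
      using p K unfolding W_h_f_def by blast
    have "e' = e" if "e' \<in> BE" "e' edge_of K" for e'
      using one_edge K e that unfolding at_most_one_boundary_edge_def by blast
    then show ?thesis using q by blast
  next
    case False
    then show ?thesis using p K unfolding W_h_f_def W_h_def by blast
  qed
  then show ?thesis by (intro bchoice ballI) blast
qed

text \<open>Jumps on edges outside \<open>BE\<close> vanish. A boundary edge belongs to a single
  triangle, so its jump is the normal component, which equals \<open>f\<close> almost everywhere on
  the edge.\<close>

lemma Green_mesh:
  assumes p: "p \<in> W_h_f \<Omega> T f" and d: "d \<in> L2 (lebesgue_on \<Omega>)" and pd: "has_weak_div \<Omega> p d"
    and f: "f \<in> L2 \<Gamma>M" and \<phi>: "\<phi> \<in> C_inf"
  shows "(LINT x|lebesgue_on \<Omega>. p x \<bullet> grad \<phi> x + d x * \<phi> x) = (LINT x|\<Gamma>M. \<phi> x * f x)"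
proof -
  have pL: "p \<in> L2 (lebesgue_on \<Omega>)" using p by (auto simp: W_h_f_def W_h_def H_div_def)
  obtain q where q: "\<And>K. K \<in> T \<Longrightarrow> q K \<in> RT1" "\<And>K. K \<in> T \<Longrightarrow> AE x in lebesgue_on K. p x = q K x"
    "\<And>K e. K \<in> T \<Longrightarrow> e \<in> BE \<Longrightarrow> e edge_of K \<Longrightarrow> AE x in segment_measure e. q K x \<bullet> outward_normal K e = f x"
    using W_h_f_polynomials[OF p] by auto
  note c\<phi> = C_inf_continuous[OF \<phi>]
  have cJ: "continuous_on UNIV (\<lambda>x. \<phi> x * jump q e x)" for e
    by (intro continuous_intros c\<phi> continuous_jump[OF q(1)])
  have i: "integrable \<Gamma>M (\<lambda>x. \<phi> x * f x)"
    using L2_inner_integrable(2)[OF continuous_L2_\<Gamma>M[OF c\<phi>] f] by simp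
  have "(LINT x|lebesgue_on \<Omega>. p x \<bullet> grad \<phi> x + d x * \<phi> x) = (\<Sum>e\<in>all_edges. LINT x|segment_measure e. \<phi> x * jump q e x)"
    by (rule Green_mesh_jumps[OF pL d pd q(1,2) \<phi>])
  also have "\<dots> = (\<Sum>e\<in>BE. LINT x|segment_measure e. \<phi> x * jump q e x)"
  proof (rule sum.mono_neutral_right[OF finite_edges BE_subset], rule ballI)
    fix e assume e: "e \<in> all_edges - BE"
    show "(LINT x|segment_measure e. \<phi> x * jump q e x) = 0"
      by (rule segment_integral_zero[OF _ cJ]) (use e jump_zero[OF pL d pd q(1,2)] in auto)
  qed
  also have "\<dots> = (\<Sum>e\<in>BE. LINT x|edge_measure e. \<phi> x * f x)"
  proof (rule sum.cong[OF refl])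
    fix e assume e: "e \<in> BE"
    obtain K a b where K: "K \<in> T" "e edge_of K" "e = closed_segment a b"
      by (rule BE_triangle[OF e]) (rule that)
    have "K' = K" if "K' \<in> T" "e edge_of K'" for K'
      by (rule boundary_edge_unique_triangle[OF dom tri that(1) K(1) e that(2) K(2)])
    then have "{K. K \<in> T \<and> e edge_of K} = {K}" using K by blast
    then have J: "jump q e x = q K x \<bullet> outward_normal K e" for x by (simp add: jump_def)
    have "(LINT x|segment_measure e. \<phi> x * jump q e x) = (LINT x|edge_measure e. \<phi> x * jump q e x)"
      using segment_measure_integral(1)[OF cJ, of a b e] edge_measure_integral(1)[OF e K(3) cJ] K(3) by simp
    also have "\<dots> = (LINT x|edge_measure e. \<phi> x * f x)"
    proof (rule integral_cong_AE)
      show "(\<lambda>x. \<phi> x * jump q e x) \<in> borel_measurable (edge_measure e)"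
        using edge_measure_integral(2)[OF e K(3) cJ] by blast
      show "(\<lambda>x. \<phi> x * f x) \<in> borel_measurable (edge_measure e)" using i by auto
      show "AE x in edge_measure e. \<phi> x * jump q e x = \<phi> x * f x"
        using AE_edge_measure[OF q(3)[OF K(1) e K(2)]] unfolding J by eventually_elim simp
    qed
    finally show "(LINT x|segment_measure e. \<phi> x * jump q e x) = (LINT x|edge_measure e. \<phi> x * f x)" .
  qed
  also have "\<dots> = (LINT x|\<Gamma>M. \<phi> x * f x)" by (rule integral_\<Gamma>M[OF i, symmetric])
  finally show ?thesis .
qed

end

section \<open>Weak gradients and traces\<close>

lemma L2_scaleR_integrable:
  fixes f :: "'a \<Rightarrow> real" and G :: "'a \<Rightarrow> 'b::euclidean_space"
  assumes f: "f \<in> L2 M" and G: "G \<in> L2 M" shows "integrable M (\<lambda>x. f x *\<^sub>R G x)"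
proof -
  note [measurable] = L2_D(1)[OF f] L2_D(1)[OF G]
  have i: "integrable M (\<lambda>x. (norm (f x))\<^sup>2 + (norm (G x))\<^sup>2)"
    by (intro Bochner_Integration.integrable_add L2_D f G)
  have b: "norm (f x) * norm (G x) \<le> (norm (f x))\<^sup>2 + (norm (G x))\<^sup>2" for x
  proof -
    have "0 \<le> norm (f x) * norm (G x)" by simp
    then show ?thesis using sum_squares_bound[of "norm (f x)" "norm (G x)"] by linarith
  qed
  show ?thesis
    by (rule Bochner_Integration.integrable_bound[OF i]) (use b in \<open>auto intro!: AE_I2\<close>)
qed

lemma has_trace_iff:
  assumes "\<And>\<phi>::plane \<Rightarrow> real. \<phi> \<in> C_inf \<Longrightarrow> \<phi> \<in> L2 (lebesgue_on \<Omega>) \<and> grad \<phi> \<in> L2 (lebesgue_on \<Omega>) \<and> \<phi> \<in> L2 (boundary_measure \<Omega> T)"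
    and "v \<in> L2 (lebesgue_on \<Omega>)" "wgrad \<Omega> v \<in> L2 (lebesgue_on \<Omega>)"
  shows "has_trace \<Omega> T v g \<longleftrightarrow> (\<exists>\<phi>. (\<forall>n. \<phi> n \<in> C_inf) \<and> L2_lim (lebesgue_on \<Omega>) \<phi> v \<and>
     L2_lim (lebesgue_on \<Omega>) (\<lambda>n. grad (\<phi> n)) (wgrad \<Omega> v) \<and> L2_lim (boundary_measure \<Omega> T) \<phi> g)"
  using assms unfolding has_trace_def L2_lim_def by blast

lemma L2_lim_cong_AE:
  assumes "L2_lim M \<phi> v" "w \<in> L2 M" "AE x in M. v x = w x" shows "L2_lim M \<phi> w"
proof -
  have "L2_norm M (\<lambda>x. \<phi> n x - v x) = L2_norm M (\<lambda>x. \<phi> n x - w x)" for n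
    using assms by (intro L2_norm_cong_AE L2_D(1) L2_diff) (auto simp: L2_lim_def elim: eventually_mono)
  then show ?thesis using assms by (simp add: L2_lim_def)
qed

lemma grad_diff:
  assumes "\<phi> \<in> C_inf" "\<psi> \<in> C_inf" shows "grad (\<lambda>x. \<phi> x - \<psi> x) = (\<lambda>x. grad \<phi> x - grad \<psi> x)"
  using C_inf_C1[OF assms(1)] C_inf_C1[OF assms(2)] unfolding C1_with_grad_def
  by (intro ext grad_eq GDERIV_diff) auto

context polygonal_mesh
begin

abbreviation "\<Omega>M \<equiv> lebesgue_on \<Omega>"

lemma C_inf_L2:
  assumes "\<phi> \<in> C_inf" shows "\<phi> \<in> L2 \<Omega>M" "grad \<phi> \<in> L2 \<Omega>M" "\<phi> \<in> L2 \<Gamma>M"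
  using C_inf_continuous[OF assms] C_inf_continuous_grad[OF assms] continuous_L2_\<Omega> continuous_L2_\<Gamma>M by auto

lemma L2_integrable_\<Omega>: "f \<in> L2 \<Omega>M \<Longrightarrow> integrable \<Omega>M (f :: plane \<Rightarrow> real)"
  using L2_inner_integrable(2)[of f \<Omega>M "\<lambda>x. 1"] continuous_L2_\<Omega>[of "\<lambda>x. 1"] by simp

text \<open>The fundamental lemma, applied to the components of \<open>G - H\<close>.\<close>

lemma weak_grad_unique:
  assumes G: "G \<in> L2 \<Omega>M" "has_weak_grad \<Omega> v G" and H: "H \<in> L2 \<Omega>M" "has_weak_grad \<Omega> v H"
  shows "AE x in \<Omega>M. G x = H x"
proof -
  have D: "(\<lambda>x. G x - H x) \<in> L2 \<Omega>M" by (rule L2_diff[OF G(1) H(1)])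
  have z: "(LINT x|\<Omega>M. \<phi> x *\<^sub>R (G x - H x)) = 0" if \<phi>: "\<phi> \<in> test_functions \<Omega>" for \<phi>
  proof -
    have \<phi>L: "\<phi> \<in> L2 \<Omega>M" using C_inf_L2 test_functions_C_inf[OF \<phi>] by blast
    have "(LINT x|\<Omega>M. v x *\<^sub>R grad \<phi> x) = - (LINT x|\<Omega>M. \<phi> x *\<^sub>R G x)"
      "(LINT x|\<Omega>M. v x *\<^sub>R grad \<phi> x) = - (LINT x|\<Omega>M. \<phi> x *\<^sub>R H x)"
      using G(2) H(2) \<phi> by (auto simp: has_weak_grad_def)
    then have "(LINT x|\<Omega>M. \<phi> x *\<^sub>R G x) = (LINT x|\<Omega>M. \<phi> x *\<^sub>R H x)" by simp
    then show ?thesis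
      by (simp add: scaleR_diff_right Bochner_Integration.integral_diff L2_scaleR_integrable \<phi>L G(1) H(1))
  qed
  have c: "AE x in \<Omega>M. (G x - H x) \<bullet> w = 0" for w
  proof (rule fundamental_lemma_calculus_of_variations[OF open_\<Omega>])
    show "integrable \<Omega>M (\<lambda>x. (G x - H x) \<bullet> w)"
      using L2_inner_integrable(2)[OF D continuous_L2_\<Omega>[of "\<lambda>x. w"]] by simp
    fix \<phi> assume \<phi>: "\<phi> \<in> test_functions \<Omega>"
    have \<phi>L: "\<phi> \<in> L2 \<Omega>M" using C_inf_L2 test_functions_C_inf[OF \<phi>] by blast
    have "(LINT x|\<Omega>M. (\<phi> x *\<^sub>R (G x - H x)) \<bullet> w) = (LINT x|\<Omega>M. \<phi> x *\<^sub>R (G x - H x)) \<bullet> w"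
      by (rule integral_inner_left) (rule L2_scaleR_integrable[OF \<phi>L D])
    then show "(LINT x|\<Omega>M. \<phi> x * ((G x - H x) \<bullet> w)) = 0" using z[OF \<phi>] by simp
  qed
  show ?thesis using c[of "(1,0)"] c[of "(0,1)"]
    by eventually_elim (simp add: inner_prod_def prod_eq_iff)
qed

lemma H1_D:
  assumes "v \<in> H1 \<Omega>" shows "v \<in> L2 \<Omega>M" "wgrad \<Omega> v \<in> L2 \<Omega>M" "has_weak_grad \<Omega> v (wgrad \<Omega> v)"
proof -
  have "\<exists>G. G \<in> L2 \<Omega>M \<and> has_weak_grad \<Omega> v G" using assms by (auto simp: H1_def)
  from someI_ex[OF this] show "wgrad \<Omega> v \<in> L2 \<Omega>M" "has_weak_grad \<Omega> v (wgrad \<Omega> v)"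
    by (auto simp: wgrad_def)
qed (use assms in \<open>auto simp: H1_def\<close>)

text \<open>\<open>wgrad\<close> is a choice among weak gradients and hence linear only almost
  everywhere; \<open>weak_grad_unique\<close> identifies the gradient chosen for the
  difference.\<close>

lemma H1_diff:
  assumes u: "u \<in> H1 \<Omega>" and v: "v \<in> H1 \<Omega>"
  shows "(\<lambda>x. u x - v x) \<in> H1 \<Omega>" "AE x in \<Omega>M. wgrad \<Omega> (\<lambda>x. u x - v x) x = wgrad \<Omega> u x - wgrad \<Omega> v x"
proof -
  note U = H1_D[OF u] and V = H1_D[OF v]
  have d: "(\<lambda>x. wgrad \<Omega> u x - wgrad \<Omega> v x) \<in> L2 \<Omega>M" "(\<lambda>x. u x - v x) \<in> L2 \<Omega>M"
    by (intro L2_diff U V)+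
  have w: "has_weak_grad \<Omega> (\<lambda>x. u x - v x) (\<lambda>x. wgrad \<Omega> u x - wgrad \<Omega> v x)"
    unfolding has_weak_grad_def
  proof
    fix \<phi> assume \<phi>: "\<phi> \<in> test_functions \<Omega>"
    note \<phi>L = C_inf_L2[OF test_functions_C_inf[OF \<phi>]]
    have "(LINT x|\<Omega>M. u x *\<^sub>R grad \<phi> x) = - (LINT x|\<Omega>M. \<phi> x *\<^sub>R wgrad \<Omega> u x)"
      "(LINT x|\<Omega>M. v x *\<^sub>R grad \<phi> x) = - (LINT x|\<Omega>M. \<phi> x *\<^sub>R wgrad \<Omega> v x)"
      using U(3) V(3) \<phi> by (auto simp: has_weak_grad_def)
    then show "(LINT x|\<Omega>M. (u x - v x) *\<^sub>R grad \<phi> x) = - (LINT x|\<Omega>M. \<phi> x *\<^sub>R (wgrad \<Omega> u x - wgrad \<Omega> v x))"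
      by (simp add: scaleR_diff_right scaleR_diff_left Bochner_Integration.integral_diff L2_scaleR_integrable \<phi>L U V)
  qed
  show H: "(\<lambda>x. u x - v x) \<in> H1 \<Omega>" using d w by (auto simp: H1_def)
  show "AE x in \<Omega>M. wgrad \<Omega> (\<lambda>x. u x - v x) x = wgrad \<Omega> u x - wgrad \<Omega> v x"
    by (rule weak_grad_unique[OF H1_D(2,3)[OF H] d(1) w])
qed

lemma has_trace_D:
  assumes v: "v \<in> H1 \<Omega>" and t: "has_trace \<Omega> T v g"
  obtains \<phi> where "\<And>n. \<phi> n \<in> C_inf" "L2_lim \<Omega>M \<phi> v" "L2_lim \<Omega>M (\<lambda>n. grad (\<phi> n)) (wgrad \<Omega> v)" "L2_lim \<Gamma>M \<phi> g"
  using t has_trace_iff[OF _ H1_D(1,2)[OF v], of T g] C_inf_L2 by blast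

lemma has_trace_I:
  assumes v: "v \<in> H1 \<Omega>" and "\<And>n. \<phi> n \<in> C_inf" "L2_lim \<Omega>M \<phi> v" "L2_lim \<Omega>M (\<lambda>n. grad (\<phi> n)) (wgrad \<Omega> v)" "L2_lim \<Gamma>M \<phi> g"
  shows "has_trace \<Omega> T v g"
  using assms(2-) has_trace_iff[OF _ H1_D(1,2)[OF v], of T g] C_inf_L2 by blast

lemma has_trace_diff:
  assumes u: "u \<in> H1 \<Omega>" "has_trace \<Omega> T u g" and v: "v \<in> H1 \<Omega>" "has_trace \<Omega> T v h"
  shows "has_trace \<Omega> T (\<lambda>x. u x - v x) (\<lambda>x. g x - h x)"
proof -
  obtain \<phi> where \<phi>: "\<And>n. \<phi> n \<in> C_inf" "L2_lim \<Omega>M \<phi> u" "L2_lim \<Omega>M (\<lambda>n. grad (\<phi> n)) (wgrad \<Omega> u)" "L2_lim \<Gamma>M \<phi> g"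
    using has_trace_D[OF u] by blast
  obtain \<psi> where \<psi>: "\<And>n. \<psi> n \<in> C_inf" "L2_lim \<Omega>M \<psi> v" "L2_lim \<Omega>M (\<lambda>n. grad (\<psi> n)) (wgrad \<Omega> v)" "L2_lim \<Gamma>M \<psi> h"
    using has_trace_D[OF v] by blast
  note d = H1_diff[OF u(1) v(1)]
  show ?thesis
  proof (rule has_trace_I[OF d(1), of "\<lambda>n x. \<phi> n x - \<psi> n x"])
    show "(\<lambda>x. \<phi> n x - \<psi> n x) \<in> C_inf" for n by (rule C_inf_diff[OF \<phi>(1) \<psi>(1)])
    show "L2_lim \<Omega>M (\<lambda>n x. \<phi> n x - \<psi> n x) (\<lambda>x. u x - v x)" by (rule L2_lim_diff[OF \<phi>(2) \<psi>(2)])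
    show "L2_lim \<Gamma>M (\<lambda>n x. \<phi> n x - \<psi> n x) (\<lambda>x. g x - h x)" by (rule L2_lim_diff[OF \<phi>(4) \<psi>(4)])
    show "L2_lim \<Omega>M (\<lambda>n. grad (\<lambda>x. \<phi> n x - \<psi> n x)) (wgrad \<Omega> (\<lambda>x. u x - v x))"
      unfolding grad_diff[OF \<phi>(1) \<psi>(1)]
      by (rule L2_lim_cong_AE[OF L2_lim_diff[OF \<phi>(3) \<psi>(3)] H1_D(2)[OF d(1)]]) (use d(2) in \<open>auto elim: eventually_mono\<close>)
  qed
qed

section \<open>Restriction of norms and limits to triangles and edges\<close>

lemma L2_norm_tri_le:
  fixes f :: "plane \<Rightarrow> 'b::euclidean_space"
  assumes K: "K \<in> T" and f: "f \<in> L2 \<Omega>M"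
  shows "L2_norm (lebesgue_on K) f \<le> L2_norm \<Omega>M f"
proof (rule power2_le_imp_le)
  show "(L2_norm (lebesgue_on K) f)\<^sup>2 \<le> (L2_norm \<Omega>M f)\<^sup>2"
    unfolding L2_norm_\<Omega>_eq_sum[OF f] by (rule member_le_sum[OF K]) (auto simp: tri_finite)
qed simp

lemma L2_on_edge:
  fixes f :: "plane \<Rightarrow> real"
  assumes e: "e \<in> BE" and f: "f \<in> L2 \<Gamma>M" shows "f \<in> L2 (edge_measure e)"
  using integrable_\<Gamma>M_edge[OF L2_D(2)[OF f] e] L2_D(1)[OF f] by (simp add: L2_def)

lemma L2_norm_\<Gamma>M_eq_sum:
  fixes f :: "plane \<Rightarrow> real"
  assumes f: "f \<in> L2 \<Gamma>M" shows "(L2_norm \<Gamma>M f)\<^sup>2 = (\<Sum>e\<in>BE. (L2_norm (edge_measure e) f)\<^sup>2)"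
  unfolding L2_norm_sq by (rule integral_\<Gamma>M[OF L2_D(2)[OF f]])

lemma L2_norm_edge_le:
  fixes f :: "plane \<Rightarrow> real"
  assumes e: "e \<in> BE" and f: "f \<in> L2 \<Gamma>M"
  shows "L2_norm (edge_measure e) f \<le> L2_norm \<Gamma>M f"
proof (rule power2_le_imp_le)
  show "(L2_norm (edge_measure e) f)\<^sup>2 \<le> (L2_norm \<Gamma>M f)\<^sup>2"
    unfolding L2_norm_\<Gamma>M_eq_sum[OF f] by (rule member_le_sum[OF e]) (auto simp: finite_BE)
qed simp

lemma L2_lim_tri:
  fixes \<phi> :: "nat \<Rightarrow> plane \<Rightarrow> 'b::euclidean_space"
  assumes K: "K \<in> T" and l: "L2_lim \<Omega>M \<phi> v" shows "L2_lim (lebesgue_on K) \<phi> v"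
proof -
  have L: "\<phi> n \<in> L2 \<Omega>M" "v \<in> L2 \<Omega>M" for n using l by (auto simp: L2_lim_def)
  have "(\<lambda>n. L2_norm (lebesgue_on K) (\<lambda>x. \<phi> n x - v x)) \<longlonglongrightarrow> 0"
    by (rule tendsto_zero_squeeze[OF L2_norm_nonneg L2_norm_tri_le[OF K L2_diff[OF L]]])
       (use l in \<open>auto simp: L2_lim_def\<close>)
  then show ?thesis by (simp add: L2_lim_def L2_on_tri[OF K] L)
qed

lemma L2_lim_edge:
  fixes \<phi> :: "nat \<Rightarrow> plane \<Rightarrow> real"
  assumes e: "e \<in> BE" and l: "L2_lim \<Gamma>M \<phi> v" shows "L2_lim (edge_measure e) \<phi> v"
proof -
  have L: "\<phi> n \<in> L2 \<Gamma>M" "v \<in> L2 \<Gamma>M" for n using l by (auto simp: L2_lim_def)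
  have "(\<lambda>n. L2_norm (edge_measure e) (\<lambda>x. \<phi> n x - v x)) \<longlonglongrightarrow> 0"
    by (rule tendsto_zero_squeeze[OF L2_norm_nonneg L2_norm_edge_le[OF e L2_diff[OF L]]])
       (use l in \<open>auto simp: L2_lim_def\<close>)
  then show ?thesis using L2_on_edge[OF e] L by (simp add: L2_lim_def)
qed

lemma edge_norm_eq:
  assumes e: "e \<in> BE" "e = closed_segment a b" and f: "continuous_on UNIV f"
  shows "(L2_norm (edge_measure e) f)\<^sup>2 = dist a b * integral {0..1} (\<lambda>s. (f (linepath a b s))\<^sup>2)"
  using edge_measure_integral(1)[OF e, of "\<lambda>x. (f x)\<^sup>2"] f
  unfolding L2_norm_sq by (simp add: edge_mean_def continuous_intros)

section \<open>Boundedness and uniqueness of traces\<close>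

lemma edge_trace_bound:
  assumes e: "e \<in> BE"
  shows "\<exists>C\<ge>0. \<forall>\<phi>\<in>C_inf. (L2_norm (edge_measure e) \<phi>)\<^sup>2 \<le> C * ((L2_norm \<Omega>M \<phi>)\<^sup>2 + (L2_norm \<Omega>M (grad \<phi>))\<^sup>2)"
proof -
  obtain K P a b where K: "K \<in> T" "is_triangle K P a b" "e = closed_segment a b"
    using BE_triangle[OF e] by metis
  define D where "D = \<bar>cross (a - P) (b - P)\<bar>"
  define h where "h = longest_edge K"
  have D: "D > 0" "cross (a - P) (b - P) \<noteq> 0" and KK: "K = convex hull {P, a, b}"
    using K(2) by (auto simp: D_def is_triangle_def)
  note hb = is_triangle_longest_edge[OF K(2), folded h_def]
  define C where "C = dist a b / D * (3 + h\<^sup>2)"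
  have C0: "C \<ge> 0" using D by (auto simp: C_def)
  have "(L2_norm (edge_measure e) \<phi>)\<^sup>2 \<le> C * ((L2_norm \<Omega>M \<phi>)\<^sup>2 + (L2_norm \<Omega>M (grad \<phi>))\<^sup>2)" if \<phi>: "\<phi> \<in> C_inf" for \<phi>
  proof -
    note c = C_inf_continuous[OF \<phi>] C_inf_continuous_grad[OF \<phi>]
    define A B where "A = L2_norm (lebesgue_on K) \<phi>" and "B = L2_norm (lebesgue_on K) (grad \<phi>)"
    have "D * integral {0..1} (\<lambda>s. (\<phi> (linepath a b s))\<^sup>2) \<le> (LINT x|lebesgue_on K. 3 * (\<phi> x)\<^sup>2 + h\<^sup>2 * (norm (grad \<phi> x))\<^sup>2)"
      using trace_inequality_full[OF D(2) C_inf_C1[OF \<phi>] hb(1,2)] unfolding D_def KK .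
    also have "\<dots> = 3 * A\<^sup>2 + h\<^sup>2 * B\<^sup>2"
      unfolding A_def B_def L2_norm_sq
      by (subst Bochner_Integration.integral_add)
         (auto intro!: continuous_imp_integrable_compact tri_compact K continuous_intros c)
    also have "\<dots> \<le> (3 + h\<^sup>2) * A\<^sup>2 + (3 + h\<^sup>2) * B\<^sup>2"
      by (intro add_mono mult_right_mono) auto
    also have "\<dots> \<le> (3 + h\<^sup>2) * ((L2_norm \<Omega>M \<phi>)\<^sup>2 + (L2_norm \<Omega>M (grad \<phi>))\<^sup>2)"
      unfolding distrib_left[symmetric] A_def B_def
      by (intro mult_left_mono add_mono power_mono L2_norm_tri_le[OF K(1)] C_inf_L2[OF \<phi>]) auto
    finally have "integral {0..1} (\<lambda>s. (\<phi> (linepath a b s))\<^sup>2) \<le> (3 + h\<^sup>2) / D * ((L2_norm \<Omega>M \<phi>)\<^sup>2 + (L2_norm \<Omega>M (grad \<phi>))\<^sup>2)"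
      using D(1) by (simp add: field_simps)
    then have "dist a b * integral {0..1} (\<lambda>s. (\<phi> (linepath a b s))\<^sup>2) \<le> dist a b * ((3 + h\<^sup>2) / D * ((L2_norm \<Omega>M \<phi>)\<^sup>2 + (L2_norm \<Omega>M (grad \<phi>))\<^sup>2))"
      by (rule mult_left_mono) simp
    then show ?thesis unfolding edge_norm_eq[OF e K(3) c(1)] C_def by (simp add: mult_ac)
  qed
  then show ?thesis using C0 by blast
qed

text \<open>By \<open>edge_trace_bound\<close> a sequence that tends to zero together with its
  gradients tends to zero on every boundary edge. For a difference of two approximating sequences
  this yields uniqueness of traces, for a sequence minus a constant the trace of a constant
  function.\<close>

lemma trace_zero:
  assumes \<phi>: "\<And>n. \<phi> n \<in> C_inf" and z: "(\<lambda>n. L2_norm \<Omega>M (\<phi> n)) \<longlonglongrightarrow> 0" "(\<lambda>n. L2_norm \<Omega>M (grad (\<phi> n))) \<longlonglongrightarrow> 0"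
    and l: "L2_lim \<Gamma>M \<phi> g"
  shows "L2_norm \<Gamma>M g = 0"
proof -
  have gL: "g \<in> L2 \<Gamma>M" using l by (simp add: L2_lim_def)
  have "L2_norm (edge_measure e) g = 0" if e: "e \<in> BE" for e
  proof -
    obtain C where C: "\<And>\<phi>. \<phi> \<in> C_inf \<Longrightarrow> (L2_norm (edge_measure e) \<phi>)\<^sup>2 \<le> C * ((L2_norm \<Omega>M \<phi>)\<^sup>2 + (L2_norm \<Omega>M (grad \<phi>))\<^sup>2)"
      using edge_trace_bound[OF e] by blast
    have "(\<lambda>n. C * ((L2_norm \<Omega>M (\<phi> n))\<^sup>2 + (L2_norm \<Omega>M (grad (\<phi> n)))\<^sup>2)) \<longlonglongrightarrow> C * (0\<^sup>2 + 0\<^sup>2)"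
      by (intro tendsto_intros z)
    then have "(\<lambda>n. (L2_norm (edge_measure e) (\<phi> n))\<^sup>2) \<longlonglongrightarrow> 0"
      by (intro tendsto_zero_squeeze[OF zero_le_power2 C[OF \<phi>]]) simp
    moreover have "(\<lambda>n. (L2_norm (edge_measure e) (\<phi> n))\<^sup>2) \<longlonglongrightarrow> (L2_norm (edge_measure e) g)\<^sup>2"
      by (intro tendsto_intros L2_lim_norm L2_lim_edge[OF e l])
    ultimately show ?thesis using LIMSEQ_unique by fastforce
  qed
  then have "(L2_norm \<Gamma>M g)\<^sup>2 = 0" unfolding L2_norm_\<Gamma>M_eq_sum[OF gL] by simp
  then show ?thesis by simp
qed

lemma trace_unique:
  assumes v: "v \<in> H1 \<Omega>" and g: "has_trace \<Omega> T v g" and h: "has_trace \<Omega> T v h"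
  shows "AE x in \<Gamma>M. g x = h x"
proof -
  obtain \<phi> where \<phi>: "\<And>n. \<phi> n \<in> C_inf" "L2_lim \<Omega>M \<phi> v" "L2_lim \<Omega>M (\<lambda>n. grad (\<phi> n)) (wgrad \<Omega> v)" "L2_lim \<Gamma>M \<phi> g"
    using has_trace_D[OF v g] by blast
  obtain \<psi> where \<psi>: "\<And>n. \<psi> n \<in> C_inf" "L2_lim \<Omega>M \<psi> v" "L2_lim \<Omega>M (\<lambda>n. grad (\<psi> n)) (wgrad \<Omega> v)" "L2_lim \<Gamma>M \<psi> h"
    using has_trace_D[OF v h] by blast
  have n0: "L2_norm M (\<lambda>x. 0) = 0" for M :: "plane measure" by (simp add: L2_norm_def)
  have l: "L2_lim \<Gamma>M (\<lambda>n x. \<phi> n x - \<psi> n x) (\<lambda>x. g x - h x)" by (rule L2_lim_diff[OF \<phi>(4) \<psi>(4)])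
  have "L2_norm \<Gamma>M (\<lambda>x. g x - h x) = 0"
  proof (rule trace_zero[OF C_inf_diff[OF \<phi>(1) \<psi>(1)] _ _ l])
    show "(\<lambda>n. L2_norm \<Omega>M (\<lambda>x. \<phi> n x - \<psi> n x)) \<longlonglongrightarrow> 0"
      using L2_lim_norm[OF L2_lim_diff[OF \<phi>(2) \<psi>(2)]] by (simp add: n0)
    show "(\<lambda>n. L2_norm \<Omega>M (grad (\<lambda>x. \<phi> n x - \<psi> n x))) \<longlonglongrightarrow> 0"
      unfolding grad_diff[OF \<phi>(1) \<psi>(1)]
      using L2_lim_norm[OF L2_lim_diff[OF \<phi>(3) \<psi>(3)]] by (simp add: L2_norm_def)
  qed
  moreover have "(\<lambda>x. g x - h x) \<in> L2 \<Gamma>M" using l by (simp add: L2_lim_def)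
  ultimately show ?thesis using L2_zero_imp_AE by force
qed

lemma V_D:
  assumes "v \<in> V \<Omega> T c"
  shows "v \<in> H1 \<Omega>" "has_trace \<Omega> T v (bdry_trace \<Omega> T v)" "bdry_trace \<Omega> T v \<in> L2_\<Gamma> \<Omega> T c" "bdry_trace \<Omega> T v \<in> L2 \<Gamma>M"
proof -
  have ex: "\<exists>g. has_trace \<Omega> T v g" using assms by (simp add: V_def)
  show "v \<in> H1 \<Omega>" using assms by (simp add: V_def)
  show t: "has_trace \<Omega> T v (bdry_trace \<Omega> T v)" unfolding bdry_trace_def by (rule someI_ex[OF ex])
  then show "bdry_trace \<Omega> T v \<in> L2 \<Gamma>M" by (simp add: has_trace_def)
  then show "bdry_trace \<Omega> T v \<in> L2_\<Gamma> \<Omega> T c" using assms by (auto simp: L2_\<Gamma>_def V_def)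
qed

lemma L2_integrable_\<Gamma>M: "f \<in> L2 \<Gamma>M \<Longrightarrow> integrable \<Gamma>M (f :: plane \<Rightarrow> real)"
  using L2_inner_integrable(2)[of f \<Gamma>M "\<lambda>x. 1"] continuous_L2_\<Gamma>M[of "\<lambda>x. 1"] by simp

text \<open>The trace chosen for the difference equals the difference of the chosen traces only
  almost everywhere, which suffices for the integral condition in the case
  \<open>c = 0\<close>.\<close>

lemma V_diff:
  assumes u: "u \<in> V \<Omega> T c" and v: "v \<in> V \<Omega> T c" shows "(\<lambda>x. u x - v x) \<in> V \<Omega> T c"
proof -
  note U = V_D[OF u] and W = V_D[OF v]
  note H = H1_diff(1)[OF U(1) W(1)]
  have t: "has_trace \<Omega> T (\<lambda>x. u x - v x) (\<lambda>x. bdry_trace \<Omega> T u x - bdry_trace \<Omega> T v x)"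
    by (rule has_trace_diff[OF U(1,2) W(1,2)])
  have t': "has_trace \<Omega> T (\<lambda>x. u x - v x) (bdry_trace \<Omega> T (\<lambda>x. u x - v x))"
    unfolding bdry_trace_def by (rule someI[where P = "has_trace \<Omega> T (\<lambda>x. u x - v x)", OF t])
  have "(LINT x|\<Gamma>M. bdry_trace \<Omega> T (\<lambda>x. u x - v x) x) = (LINT x|\<Gamma>M. bdry_trace \<Omega> T u x - bdry_trace \<Omega> T v x)"
    by (rule integral_cong_AE) (use t t' trace_unique[OF H t' t] in \<open>auto simp: has_trace_def L2_def\<close>)
  also have "\<dots> = (LINT x|\<Gamma>M. bdry_trace \<Omega> T u x) - (LINT x|\<Gamma>M. bdry_trace \<Omega> T v x)"
    by (intro Bochner_Integration.integral_diff L2_integrable_\<Gamma>M U W)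
  finally have "c = 0 \<longrightarrow> (LINT x|\<Gamma>M. bdry_trace \<Omega> T (\<lambda>x. u x - v x) x) = 0"
    using U(3) W(3) by (simp add: L2_\<Gamma>_def)
  then show ?thesis using H t by (auto simp: V_def)
qed

lemma a_form_integrable:
  assumes u: "u \<in> H1 \<Omega>" and v: "v \<in> H1 \<Omega>"
  shows "integrable \<Omega>M (\<lambda>x. wgrad \<Omega> u x \<bullet> wgrad \<Omega> v x)" "integrable \<Omega>M (\<lambda>x. c * u x * v x)"
  using L2_inner_integrable(2)[OF H1_D(2)[OF u] H1_D(2)[OF v]] L2_inner_integrable(2)[OF H1_D(1)[OF u] H1_D(1)[OF v]]
  by (auto simp: mult.assoc)

lemma a_form_commute: "a_form \<Omega> c u v = a_form \<Omega> c v u"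
  by (simp add: a_form_def inner_commute mult_ac)

lemma a_form_diff:
  assumes u: "u \<in> H1 \<Omega>" and v: "v \<in> H1 \<Omega>" and w: "w \<in> H1 \<Omega>"
  shows "a_form \<Omega> c (\<lambda>x. u x - v x) w = a_form \<Omega> c u w - a_form \<Omega> c v w"
proof -
  note d = H1_diff[OF u v]
  have "a_form \<Omega> c (\<lambda>x. u x - v x) w = (LINT x|\<Omega>M. (wgrad \<Omega> u x \<bullet> wgrad \<Omega> w x + c * u x * w x) - (wgrad \<Omega> v x \<bullet> wgrad \<Omega> w x + c * v x * w x))"
    unfolding a_form_def
  proof (rule integral_cong_AE)
    show "AE x in \<Omega>M. wgrad \<Omega> (\<lambda>x. u x - v x) x \<bullet> wgrad \<Omega> w x + c * (u x - v x) * w x =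
       (wgrad \<Omega> u x \<bullet> wgrad \<Omega> w x + c * u x * w x) - (wgrad \<Omega> v x \<bullet> wgrad \<Omega> w x + c * v x * w x)"
      using d(2) by eventually_elim (simp only: inner_diff_left, simp add: algebra_simps)
  qed (use a_form_integrable(1)[OF d(1) w] a_form_integrable(2)[OF d(1) w, of c] a_form_integrable(1)[OF u w] a_form_integrable(2)[OF u w, of c] a_form_integrable(1)[OF v w] a_form_integrable(2)[OF v w, of c] in auto)
  also have "\<dots> = a_form \<Omega> c u w - a_form \<Omega> c v w"
    unfolding a_form_def
    by (intro Bochner_Integration.integral_diff Bochner_Integration.integrable_add a_form_integrable u v w)
  finally show ?thesis .
qed

text \<open>\<open>has_trace\<close> supplies smooth functions that approximate \<open>w\<close> in
  \<open>\<Omega>\<close>, with gradients, and on the boundary at once; each of the three integrals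
  is continuous under these limits.\<close>

lemma Green_mesh_trace:
  assumes p: "p \<in> W_h_f \<Omega> T f" and d: "d \<in> L2 \<Omega>M" and pd: "has_weak_div \<Omega> p d"
    and f: "f \<in> L2 \<Gamma>M" and w: "w \<in> H1 \<Omega>" "has_trace \<Omega> T w g"
  shows "(LINT x|\<Omega>M. p x \<bullet> wgrad \<Omega> w x) + (LINT x|\<Omega>M. d x * w x) = (LINT x|\<Gamma>M. f x * g x)"
proof -
  have pL: "p \<in> L2 \<Omega>M" using p by (auto simp: W_h_f_def W_h_def H_div_def)
  obtain \<phi> where \<phi>: "\<And>n. \<phi> n \<in> C_inf" "L2_lim \<Omega>M \<phi> w" "L2_lim \<Omega>M (\<lambda>n. grad (\<phi> n)) (wgrad \<Omega> w)" "L2_lim \<Gamma>M \<phi> g"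
    using has_trace_D[OF w] by blast
  have "(LINT x|\<Omega>M. grad (\<phi> n) x \<bullet> p x) + (LINT x|\<Omega>M. \<phi> n x \<bullet> d x) = (LINT x|\<Gamma>M. \<phi> n x \<bullet> f x)" for n
  proof -
    note L = C_inf_L2[OF \<phi>(1)[of n]]
    have "(LINT x|\<Omega>M. grad (\<phi> n) x \<bullet> p x) + (LINT x|\<Omega>M. \<phi> n x \<bullet> d x) = (LINT x|\<Omega>M. grad (\<phi> n) x \<bullet> p x + \<phi> n x \<bullet> d x)"
      by (intro Bochner_Integration.integral_add[symmetric] L2_inner_integrable L pL d)
    also have "\<dots> = (LINT x|\<Gamma>M. \<phi> n x * f x)"
      using Green_mesh[OF p d pd f \<phi>(1)[of n]] by (simp add: inner_commute mult.commute)
    finally show ?thesis by simp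
  qed
  moreover have "(\<lambda>n. (LINT x|\<Omega>M. grad (\<phi> n) x \<bullet> p x) + (LINT x|\<Omega>M. \<phi> n x \<bullet> d x)) \<longlonglongrightarrow>
     (LINT x|\<Omega>M. wgrad \<Omega> w x \<bullet> p x) + (LINT x|\<Omega>M. w x \<bullet> d x)"
    by (intro tendsto_add L2_lim_inner \<phi> pL d)
  moreover have "(\<lambda>n. LINT x|\<Gamma>M. \<phi> n x \<bullet> f x) \<longlonglongrightarrow> (LINT x|\<Gamma>M. g x \<bullet> f x)"
    by (intro L2_lim_inner \<phi> f)
  ultimately have "(LINT x|\<Omega>M. wgrad \<Omega> w x \<bullet> p x) + (LINT x|\<Omega>M. w x \<bullet> d x) = (LINT x|\<Gamma>M. g x \<bullet> f x)"
    using LIMSEQ_unique by fastforce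
  then show ?thesis by (simp add: inner_commute mult.commute)
qed

text \<open>A dual form of the trace inequality: against \<open>k\<close> of integral zero, the mean
  of \<open>\<phi>\<close> can be subtracted without changing the integral. Both sides are
  continuous in the limit that defines the trace.\<close>

lemma edge_trace_inequality:
  assumes e: "e \<in> BE" and K: "K \<in> T" "e edge_of K"
    and k: "k \<in> L2 (edge_measure e)" "(LINT x|edge_measure e. k x) = 0"
    and w: "w \<in> H1 \<Omega>" "has_trace \<Omega> T w g"
  shows "\<bar>LINT x|edge_measure e. k x * g x\<bar> \<le> C_e K e * L2_norm (edge_measure e) k * L2_norm (lebesgue_on K) (wgrad \<Omega> w)"
proof -
  obtain P a b where t: "is_triangle K P a b" "e = closed_segment a b"
    using edge_is_triangle[OF tri_simplex[OF K(1)] K(2)] .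
  define D where "D = \<bar>cross (a - P) (b - P)\<bar>"
  define h where "h = longest_edge K"
  have D: "D > 0" "cross (a - P) (b - P) \<noteq> 0" and KK: "K = convex hull {P, a, b}"
    using t by (auto simp: D_def is_triangle_def)
  note hb = is_triangle_longest_edge[OF t(1), folded h_def]
  have h0: "0 \<le> h" using hb(1) norm_ge_zero order_trans by blast
  have diam: "diameter e = dist a b"
  proof -
    have "norm (u - v) \<le> dist a b" if uv: "u \<in> e" "v \<in> e" for u v
      using segment_furthest_le[of v a b u] segment_bound[of u a b] uv unfolding t(2)
      by (auto simp: dist_norm norm_minus_commute)
    moreover have "dist a b \<le> diameter e"
      unfolding t(2) by (rule diameter_bounded_bound) (auto simp: compact_imp_bounded)
    ultimately show ?thesis by (intro antisym diameter_le) auto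
  qed
  have Ce: "C_e K e = 0.574 * sqrt (dist a b / (D / 2)) * h"
    unfolding C_e_def diam is_triangle_area[OF t(1)] D_def h_def by simp
  have Ce0: "0 \<le> C_e K e" unfolding Ce using D h0 by simp
  \<comment> \<open>\<open>D\<close> is twice the area, so the constant proved above is
    \<open>1/2\<close> in place of \<open>0.574\<close>, and the comparison reduces to
    \<open>4 * 0.574\<^sup>2 \<ge> 1\<close>.\<close>
  have Ce2: "dist a b * (h\<^sup>2 / (2 * D)) \<le> (C_e K e)\<^sup>2"
  proof -
    have "(C_e K e)\<^sup>2 = 0.574\<^sup>2 * (dist a b / (D / 2)) * h\<^sup>2"
      unfolding Ce power_mult_distrib using D by simp
    also have "\<dots> = (4 * 0.574\<^sup>2) * (dist a b * (h\<^sup>2 / (2 * D)))" using D by (simp add: field_simps)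
    also have "\<dots> \<ge> 1 * (dist a b * (h\<^sup>2 / (2 * D)))"
      using D by (intro mult_right_mono) (auto simp: power2_eq_square)
    finally show ?thesis by simp
  qed
  have smooth: "\<bar>LINT x|edge_measure e. \<phi> x \<bullet> k x\<bar> \<le> C_e K e * L2_norm (lebesgue_on K) (grad \<phi>) * L2_norm (edge_measure e) k"
    if \<phi>: "\<phi> \<in> C_inf" for \<phi>
  proof -
    define m where "m = edge_mean \<phi> a b"
    note c = C_inf_continuous[OF \<phi>] C_inf_continuous_grad[OF \<phi>]
    have cm: "continuous_on UNIV (\<lambda>x. \<phi> x - m)" by (intro continuous_intros c)
    have L: "\<phi> \<in> L2 (edge_measure e)" "(\<lambda>x. m) \<in> L2 (edge_measure e)"
      by (intro L2_on_edge[OF e] continuous_L2_\<Gamma>M c continuous_intros)+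
    have "(L2_norm (edge_measure e) (\<lambda>x. \<phi> x - m))\<^sup>2 = dist a b * integral {0..1} (\<lambda>s. (\<phi> (linepath a b s) - m)\<^sup>2)"
      by (rule edge_norm_eq[OF e t(2) cm])
    also have "\<dots> \<le> dist a b * (h\<^sup>2 / (2 * D) * (L2_norm (lebesgue_on K) (grad \<phi>))\<^sup>2)"
      unfolding L2_norm_sq m_def KK D_def
      by (intro mult_left_mono trace_inequality_mean_zero[OF D(2) C_inf_C1[OF \<phi>] hb]) auto
    also have "\<dots> \<le> (C_e K e)\<^sup>2 * (L2_norm (lebesgue_on K) (grad \<phi>))\<^sup>2"
      unfolding mult.assoc[symmetric] by (rule mult_right_mono) (use Ce2 in \<open>auto simp: mult.assoc\<close>)
    finally have "(L2_norm (edge_measure e) (\<lambda>x. \<phi> x - m))\<^sup>2 \<le> (C_e K e * L2_norm (lebesgue_on K) (grad \<phi>))\<^sup>2"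
      by (simp add: power_mult_distrib)
    then have nm: "L2_norm (edge_measure e) (\<lambda>x. \<phi> x - m) \<le> C_e K e * L2_norm (lebesgue_on K) (grad \<phi>)"
      by (rule power2_le_imp_le) (use Ce0 in simp)
    have "(LINT x|edge_measure e. \<phi> x \<bullet> k x) = (LINT x|edge_measure e. (\<phi> x - m) \<bullet> k x)"
      using L2_inner_integrable(2)[OF L(1) k(1)] L2_inner_integrable(2)[OF L(2) k(1)] k(2)
      by (simp add: left_diff_distrib Bochner_Integration.integral_diff)
    also have "\<bar>\<dots>\<bar> \<le> L2_norm (edge_measure e) (\<lambda>x. \<phi> x - m) * L2_norm (edge_measure e) k"
      by (rule L2_Cauchy_Schwarz[OF L2_diff[OF L] k(1)])
    also have "\<dots> \<le> C_e K e * L2_norm (lebesgue_on K) (grad \<phi>) * L2_norm (edge_measure e) k"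
      by (intro mult_right_mono nm) simp
    finally show ?thesis .
  qed
  obtain \<phi> where \<phi>: "\<And>n. \<phi> n \<in> C_inf" "L2_lim \<Omega>M \<phi> w" "L2_lim \<Omega>M (\<lambda>n. grad (\<phi> n)) (wgrad \<Omega> w)" "L2_lim \<Gamma>M \<phi> g"
    using has_trace_D[OF w] by blast
  have "(\<lambda>n. \<bar>LINT x|edge_measure e. \<phi> n x \<bullet> k x\<bar>) \<longlonglongrightarrow> \<bar>LINT x|edge_measure e. g x \<bullet> k x\<bar>"
    by (intro tendsto_intros L2_lim_inner L2_lim_edge[OF e \<phi>(4)] k)
  moreover have "(\<lambda>n. C_e K e * L2_norm (lebesgue_on K) (grad (\<phi> n)) * L2_norm (edge_measure e) k) \<longlonglongrightarrow>
      C_e K e * L2_norm (lebesgue_on K) (wgrad \<Omega> w) * L2_norm (edge_measure e) k"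
    by (intro tendsto_intros L2_lim_norm L2_lim_tri[OF K(1) \<phi>(3)])
  ultimately have "\<bar>LINT x|edge_measure e. g x \<bullet> k x\<bar> \<le> C_e K e * L2_norm (lebesgue_on K) (wgrad \<Omega> w) * L2_norm (edge_measure e) k"
    by (rule LIMSEQ_le) (use smooth[OF \<phi>(1)] in blast)
  then show ?thesis by (simp add: mult_ac)
qed

subsection \<open>The boundary functional on functions orthogonal to the finite element space\<close>

lemma b_norm_eq: "b_norm \<Omega> T f = L2_norm \<Gamma>M f"
  by (simp add: b_norm_def b_form_def L2_norm_def power2_eq_square)

lemma BE_not_singleton:
  assumes "e \<in> BE" obtains a b where "e = closed_segment a b" "a \<noteq> b"
proof -
  have "e \<in> all_edges" using assms BE_subset by blast
  then show ?thesis by (rule all_edges_segment) (rule that)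
qed

text \<open>The denominator is the length of \<open>e\<close>, the total mass of
  \<open>edge_measure e\<close>.\<close>

definition edge_average :: "(plane \<Rightarrow> real) \<Rightarrow> plane set \<Rightarrow> real" where
  "edge_average g e = (LINT x|edge_measure e. g x) / measure (edge_measure e) (frontier \<Omega>)"

text \<open>At common end points of edges several averages add up; this affects a null set
  only.\<close>

definition edgewise_mean :: "(plane \<Rightarrow> real) \<Rightarrow> plane \<Rightarrow> real" where
  "edgewise_mean g x = (\<Sum>e\<in>BE. edge_average g e * indicator e x)"

lemma AE_edgewise_mean:
  assumes e: "e \<in> BE" shows "AE x in segment_measure e. edgewise_mean g x = edge_average g e"
proof -
  obtain a b where ab: "e = closed_segment a b" "a \<noteq> b" using BE_not_singleton[OF e] .
  have "AE x in segment_measure e. x \<notin> e'" if e': "e' \<in> BE - {e}" for e'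
  proof -
    obtain K where K: "K \<in> T" "e edge_of K" using e by (auto simp: boundary_edges_def)
    obtain K' where K': "K' \<in> T" "e' edge_of K'" using e' by (auto simp: boundary_edges_def)
    obtain y where y: "e \<inter> e' \<subseteq> {y}"
      using triangulation_edges_Int[OF tri K(1) K'(1) K(2) K'(2)] e' by auto
    show ?thesis
      using AE_segment_measure_in[of a b] AE_segment_measure_not_eq[OF ab(2), of y] unfolding ab(1)[symmetric]
      by eventually_elim (use y in auto)
  qed
  then have "AE x in segment_measure e. \<forall>e'\<in>BE - {e}. x \<notin> e'"
    by (intro AE_finite_allI) (auto simp: finite_BE)
  moreover have "AE x in segment_measure e. x \<in> e" using AE_segment_measure_in[of a b] unfolding ab(1)[symmetric] .
  ultimately show ?thesis
  proof eventually_elim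
    case (elim x)
    then have "(\<Sum>e'\<in>BE - {e}. edge_average g e' * indicator e' x) = 0" by (intro sum.neutral) auto
    then show ?case unfolding edgewise_mean_def using elim by (simp add: sum.remove[OF finite_BE e])
  qed
qed

lemma edgewise_mean_measurable [measurable]: "edgewise_mean g \<in> borel_measurable \<Gamma>M"
proof (rule borel_measurable_\<Gamma>M)
  have "e \<in> sets borel" if eB: "e \<in> BE" for e
  proof -
    obtain a b where "e = closed_segment a b" using BE_not_singleton[OF eB] by metis
    then show ?thesis by (simp add: borel_closed)
  qed
  then show "edgewise_mean g \<in> borel_measurable borel"
    unfolding edgewise_mean_def[abs_def] by (intro borel_measurable_sum borel_measurable_times borel_measurable_indicator) auto
qed

lemma edge_measure_const:
  assumes e: "e \<in> BE"
  shows "(LINT x|edge_measure e. (k::real)) = measure (edge_measure e) (frontier \<Omega>) * k"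
    "integrable (edge_measure e) (\<lambda>x. k::real)" "measure (edge_measure e) (frontier \<Omega>) > 0"
proof -
  obtain a b where ab: "e = closed_segment a b" "a \<noteq> b" using BE_not_singleton[OF e] .
  show "(LINT x|edge_measure e. k) = measure (edge_measure e) (frontier \<Omega>) * k" by simp
  show "integrable (edge_measure e) (\<lambda>x. k)" by (rule edge_measure_integral(2)[OF e ab(1)]) simp
  show "measure (edge_measure e) (frontier \<Omega>) > 0"
    using emeasure_edge_measure_space[OF e ab(1)] ab(2) by (simp add: measure_def)
qed

text \<open>\<open>F\<close> stands for an arbitrary integrand: it allows
  \<open>edgewise_mean g\<close> to be replaced by its constant value on \<open>e\<close> inside any
  expression.\<close>

lemma edgewise_mean_edge:
  fixes F :: "real \<Rightarrow> plane \<Rightarrow> real"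
  assumes e: "e \<in> BE" and m: "(\<lambda>x. F (edgewise_mean g x) x) \<in> borel_measurable \<Gamma>M" "(\<lambda>x. F (edge_average g e) x) \<in> borel_measurable \<Gamma>M"
  shows "(LINT x|edge_measure e. F (edgewise_mean g x) x) = (LINT x|edge_measure e. F (edge_average g e) x)"
    and "integrable (edge_measure e) (\<lambda>x. F (edge_average g e) x) \<Longrightarrow> integrable (edge_measure e) (\<lambda>x. F (edgewise_mean g x) x)"
proof -
  have ae: "AE x in edge_measure e. F (edgewise_mean g x) x = F (edge_average g e) x"
    using AE_edge_measure[OF AE_edgewise_mean[OF e, of g]] by eventually_elim simp
  show "(LINT x|edge_measure e. F (edgewise_mean g x) x) = (LINT x|edge_measure e. F (edge_average g e) x)"
    by (rule integral_cong_AE) (use m ae in auto)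
  show "integrable (edge_measure e) (\<lambda>x. F (edgewise_mean g x) x)" if i: "integrable (edge_measure e) (\<lambda>x. F (edge_average g e) x)"
    by (rule integrable_cong_AE_imp[OF i]) (use m ae in \<open>auto elim: eventually_mono\<close>)
qed

lemma edgewise_mean_L2: "edgewise_mean g \<in> L2 \<Gamma>M"
proof (rule L2_I[OF edgewise_mean_measurable])
  show "integrable \<Gamma>M (\<lambda>x. (norm (edgewise_mean g x))\<^sup>2)"
    by (rule integrable_\<Gamma>M, measurable) (rule edgewise_mean_edge(2)[where F = "\<lambda>y x. (norm y)\<^sup>2"], auto intro: edge_measure_const(2))
qed

lemma edge_average_integral:
  assumes e: "e \<in> BE" and g: "g \<in> L2 \<Gamma>M"
  shows "(LINT x|edge_measure e. edgewise_mean g x) = (LINT x|edge_measure e. g x)"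
    "(LINT x|edge_measure e. g x - edgewise_mean g x) = 0"
    "(LINT x|edge_measure e. (g x - edgewise_mean g x) * edgewise_mean g x) = 0"
proof -
  have gi: "integrable (edge_measure e) g" using integrable_\<Gamma>M_edge[OF L2_integrable_\<Gamma>M[OF g] e] .
  have [measurable]: "g \<in> borel_measurable \<Gamma>M" using L2_D(1)[OF g] .
  have 1: "(LINT x|edge_measure e. edgewise_mean g x) = (LINT x|edge_measure e. edge_average g e)"
    by (rule edgewise_mean_edge(1)[OF e, where F = "\<lambda>y x. y"]) auto
  also have "\<dots> = (LINT x|edge_measure e. g x)"
    using edge_measure_const(1,3)[OF e] by (simp add: edge_average_def)
  finally show A: "(LINT x|edge_measure e. edgewise_mean g x) = (LINT x|edge_measure e. g x)" .
  have mi: "integrable (edge_measure e) (edgewise_mean g)"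
    using integrable_\<Gamma>M_edge[OF L2_integrable_\<Gamma>M[OF edgewise_mean_L2] e] .
  show B: "(LINT x|edge_measure e. g x - edgewise_mean g x) = 0"
    using A by (simp add: Bochner_Integration.integral_diff gi mi)
  have "(LINT x|edge_measure e. (g x - edgewise_mean g x) * edgewise_mean g x) = (LINT x|edge_measure e. (g x - edge_average g e) * edge_average g e)"
    by (rule edgewise_mean_edge(1)[OF e, where F = "\<lambda>y x. (g x - y) * y"]) measurable
  also have "\<dots> = (LINT x|edge_measure e. g x - edge_average g e) * edge_average g e" by simp
  also have "(LINT x|edge_measure e. g x - edge_average g e) = (LINT x|edge_measure e. g x - edgewise_mean g x)"
    by (rule edgewise_mean_edge(1)[OF e, where F = "\<lambda>y x. g x - y", symmetric]) measurable
  finally show "(LINT x|edge_measure e. (g x - edgewise_mean g x) * edgewise_mean g x) = 0" using B by simp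
qed

text \<open>Constants belong to \<open>P1\<close>, and averaging preserves the integral over each
  edge, hence the condition on the total integral in the case \<open>c = 0\<close>.\<close>

lemma edgewise_mean_X_h:
  assumes g: "g \<in> L2_\<Gamma> \<Omega> T c" shows "edgewise_mean g \<in> X_h \<Omega> T c"
proof -
  have gL: "g \<in> L2 \<Gamma>M" using g by (simp add: L2_\<Gamma>_def)
  have "(LINT x|\<Gamma>M. edgewise_mean g x) = (LINT x|\<Gamma>M. g x)"
    using edge_average_integral(1)[OF _ gL]
    by (simp add: integral_\<Gamma>M L2_integrable_\<Gamma>M edgewise_mean_L2 gL)
  then have 1: "edgewise_mean g \<in> L2_\<Gamma> \<Omega> T c" using g edgewise_mean_L2 by (simp add: L2_\<Gamma>_def)
  have "\<exists>q\<in>P1. AE x in segment_measure e. edgewise_mean g x = q x" if e: "e \<in> BE" for e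
  proof (rule bexI)
    show "AE x in segment_measure e. edgewise_mean g x = (\<lambda>(x, y). edge_average g e + 0 * x + 0 * y) x"
      using AE_edgewise_mean[OF e, of g] by eventually_elim (simp add: case_prod_unfold)
    show "(\<lambda>(x, y). edge_average g e + 0 * x + 0 * y) \<in> P1" unfolding P1_def by blast
  qed
  then show ?thesis using 1 by (simp add: X_h_def)
qed

text \<open>On every edge the error has integral zero and the mean is constant almost everywhere, so
  the cross term vanishes edge by edge.\<close>

lemma edgewise_mean_Pythagoras:
  assumes g: "g \<in> L2 \<Gamma>M"
  shows "(L2_norm \<Gamma>M g)\<^sup>2 = (L2_norm \<Gamma>M (edgewise_mean g))\<^sup>2 + (L2_norm \<Gamma>M (\<lambda>x. g x - edgewise_mean g x))\<^sup>2"
proof -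
  note m = edgewise_mean_L2[of g]
  note d = L2_diff[OF g m]
  have i: "integrable \<Gamma>M (\<lambda>x. (g x - edgewise_mean g x) * edgewise_mean g x)"
    using L2_inner_integrable(2)[OF d m] by simp
  have "(LINT x|\<Gamma>M. (g x - edgewise_mean g x) * edgewise_mean g x) = 0"
    unfolding integral_\<Gamma>M[OF i] by (rule sum.neutral) (use edge_average_integral(3)[OF _ g] in blast)
  moreover have "(LINT x|\<Gamma>M. (norm (g x))\<^sup>2) = (LINT x|\<Gamma>M. ((norm (edgewise_mean g x))\<^sup>2 + (norm (g x - edgewise_mean g x))\<^sup>2) + 2 * ((g x - edgewise_mean g x) * edgewise_mean g x))"
    by (rule arg_cong[where f = "integral\<^sup>L \<Gamma>M"]) (simp add: fun_eq_iff power2_eq_square algebra_simps)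
  moreover have "\<dots> = ((LINT x|\<Gamma>M. (norm (edgewise_mean g x))\<^sup>2) + (LINT x|\<Gamma>M. (norm (g x - edgewise_mean g x))\<^sup>2)) + 2 * (LINT x|\<Gamma>M. (g x - edgewise_mean g x) * edgewise_mean g x)"
    using L2_D(2)[OF m] L2_D(2)[OF d] i by (simp add: Bochner_Integration.integral_add)
  ultimately show ?thesis unfolding L2_norm_sq by simp
qed

lemma C_e_le_C_eh:
  assumes "e \<in> BE" "K \<in> T" "e edge_of K" shows "C_e K e \<le> C_eh \<Omega> T"
proof -
  have "{C_e K e | K e. K \<in> T \<and> e \<in> BE \<and> e edge_of K} \<subseteq> (\<lambda>(K, e). C_e K e) ` (T \<times> BE)" by auto
  then have "finite {C_e K e | K e. K \<in> T \<and> e \<in> BE \<and> e edge_of K}"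
    by (rule finite_subset) (simp add: tri_finite finite_BE)
  then show ?thesis unfolding C_eh_def by (rule Max_ge) (use assms in blast)
qed

text \<open>Each boundary triangle has only one boundary edge, so \<open>tr\<close> is injective and
  the squared gradient norms on the chosen triangles sum to at most the one on
  \<open>\<Omega>\<close>; the discrete Cauchy-Schwarz inequality joins the edges. The absolute
  value settles the sign of the \<open>Max\<close>, and \<open>M_h\<close> contains
  \<open>C_eh\<close> only squared.\<close>

lemma projection_error_bound:
  assumes g: "g \<in> L2 \<Gamma>M" and w: "w \<in> H1 \<Omega>" "has_trace \<Omega> T w \<gamma>"
  shows "\<bar>LINT x|\<Gamma>M. (g x - edgewise_mean g x) * \<gamma> x\<bar> \<le>
    \<bar>C_eh \<Omega> T\<bar> * L2_norm \<Gamma>M (\<lambda>x. g x - edgewise_mean g x) * L2_norm \<Omega>M (wgrad \<Omega> w)"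
proof -
  define k where "k x = g x - edgewise_mean g x" for x
  have k: "k \<in> L2 \<Gamma>M" unfolding k_def[abs_def] by (rule L2_diff[OF g edgewise_mean_L2])
  have \<gamma>: "\<gamma> \<in> L2 \<Gamma>M" using w(2) by (simp add: has_trace_def)
  note G = H1_D(2)[OF w(1)]
  have "\<forall>e\<in>BE. \<exists>K. K \<in> T \<and> e edge_of K" by (auto simp: boundary_edges_def)
  then obtain tr where tr: "\<And>e. e \<in> BE \<Longrightarrow> tr e \<in> T" "\<And>e. e \<in> BE \<Longrightarrow> e edge_of tr e" by metis
  have inj: "inj_on tr BE"
  proof (rule inj_onI)
    fix e e' assume e: "e \<in> BE" "e' \<in> BE" "tr e = tr e'"
    then show "e = e'" using one_edge tr(1)[OF e(1)] tr(2)[OF e(1)] tr(2)[OF e(2)]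
      unfolding at_most_one_boundary_edge_def by metis
  qed
  define A where "A e = L2_norm (edge_measure e) k" for e
  define B where "B e = L2_norm (lebesgue_on (tr e)) (wgrad \<Omega> w)" for e
  have i: "integrable \<Gamma>M (\<lambda>x. k x * \<gamma> x)" using L2_inner_integrable(2)[OF k \<gamma>] by simp
  have "\<bar>LINT x|\<Gamma>M. k x * \<gamma> x\<bar> \<le> (\<Sum>e\<in>BE. \<bar>LINT x|edge_measure e. k x * \<gamma> x\<bar>)"
    unfolding integral_\<Gamma>M[OF i] by (rule sum_abs)
  also have "\<dots> \<le> (\<Sum>e\<in>BE. \<bar>C_eh \<Omega> T\<bar> * (A e * B e))"
  proof (rule sum_mono)
    fix e assume e: "e \<in> BE"
    have "\<bar>LINT x|edge_measure e. k x * \<gamma> x\<bar> \<le> C_e (tr e) e * A e * B e"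
      unfolding A_def B_def
      by (rule edge_trace_inequality[OF e tr[OF e] L2_on_edge[OF e k] _ w]) (simp add: k_def edge_average_integral(2)[OF e g])
    also have "\<dots> \<le> \<bar>C_eh \<Omega> T\<bar> * (A e * B e)"
      unfolding mult.assoc using C_e_le_C_eh[OF e tr[OF e]] by (intro mult_right_mono) (auto simp: A_def B_def)
    finally show "\<bar>LINT x|edge_measure e. k x * \<gamma> x\<bar> \<le> \<bar>C_eh \<Omega> T\<bar> * (A e * B e)" .
  qed
  also have "\<dots> = \<bar>C_eh \<Omega> T\<bar> * (\<Sum>e\<in>BE. A e * B e)" by (simp add: sum_distrib_left)
  also have "(\<Sum>e\<in>BE. A e * B e) \<le> L2_norm \<Gamma>M k * L2_norm \<Omega>M (wgrad \<Omega> w)"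
  proof (rule power2_le_imp_le)
    have "(\<Sum>e\<in>BE. A e * B e)\<^sup>2 \<le> (\<Sum>e\<in>BE. (A e)\<^sup>2) * (\<Sum>e\<in>BE. (B e)\<^sup>2)"
      by (rule Cauchy_Schwarz_ineq_sum)
    also have "(\<Sum>e\<in>BE. (A e)\<^sup>2) = (L2_norm \<Gamma>M k)\<^sup>2" unfolding A_def L2_norm_\<Gamma>M_eq_sum[OF k] ..
    also have "(\<Sum>e\<in>BE. (B e)\<^sup>2) \<le> (L2_norm \<Omega>M (wgrad \<Omega> w))\<^sup>2"
    proof -
      have "(\<Sum>e\<in>BE. (B e)\<^sup>2) = (\<Sum>K\<in>tr ` BE. (L2_norm (lebesgue_on K) (wgrad \<Omega> w))\<^sup>2)"
        unfolding B_def by (simp add: sum.reindex[OF inj])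
      also have "\<dots> \<le> (\<Sum>K\<in>T. (L2_norm (lebesgue_on K) (wgrad \<Omega> w))\<^sup>2)"
        by (rule sum_mono2[OF tri_finite]) (use tr(1) in auto)
      finally show ?thesis unfolding L2_norm_\<Omega>_eq_sum[OF G] .
    qed
    finally show "(\<Sum>e\<in>BE. A e * B e)\<^sup>2 \<le> (L2_norm \<Gamma>M k * L2_norm \<Omega>M (wgrad \<Omega> w))\<^sup>2"
      by (simp add: power_mult_distrib mult_left_mono)
  qed simp
  finally show ?thesis unfolding k_def by (simp add: mult_left_mono mult.assoc)
qed

text \<open>Holds for every admissible pair, so it survives the passage to the infimum in
  \<open>kappa_h\<close> whether or not a minimizer exists.\<close>

lemma equilibrated_flux_bound:
  assumes v: "v \<in> V_h \<Omega> T c" and p: "p \<in> W_h_f \<Omega> T f" and pd: "has_weak_div \<Omega> p (\<lambda>x. c * v x)"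
    and f: "f \<in> L2 \<Gamma>M" and w: "w \<in> H1 \<Omega>" "has_trace \<Omega> T w \<gamma>" and orth: "a_form \<Omega> c v w = 0"
  shows "\<bar>LINT x|\<Gamma>M. f x * \<gamma> x\<bar> \<le> L2_norm \<Omega>M (\<lambda>x. wgrad \<Omega> v x - p x) * L2_norm \<Omega>M (wgrad \<Omega> w)"
proof -
  have vH: "v \<in> H1 \<Omega>" using v by (simp add: V_h_def V_def)
  have pL: "p \<in> L2 \<Omega>M" using p by (auto simp: W_h_f_def W_h_def H_div_def)
  have cv: "(\<lambda>x. c * v x) \<in> L2 \<Omega>M" using L2_scaleR[OF H1_D(1)[OF vH], of c] by simp
  note G = H1_D(2)[OF vH] H1_D(2)[OF w(1)]
  have "(LINT x|\<Omega>M. wgrad \<Omega> v x \<bullet> wgrad \<Omega> w x) + (LINT x|\<Omega>M. c * v x * w x) = 0"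
    using orth a_form_integrable[OF vH w(1)] unfolding a_form_def by (simp add: Bochner_Integration.integral_add)
  moreover have "(LINT x|\<Omega>M. p x \<bullet> wgrad \<Omega> w x) + (LINT x|\<Omega>M. c * v x * w x) = (LINT x|\<Gamma>M. f x * \<gamma> x)"
    by (rule Green_mesh_trace[OF p cv pd f w])
  ultimately have "(LINT x|\<Gamma>M. f x * \<gamma> x) = - (LINT x|\<Omega>M. (wgrad \<Omega> v x - p x) \<bullet> wgrad \<Omega> w x)"
    by (simp add: inner_diff_left Bochner_Integration.integral_diff L2_inner_integrable G pL)
  then show ?thesis using L2_Cauchy_Schwarz[OF L2_diff[OF G(1) pL] G(2)] by simp
qed

lemma kappa_bound:
  assumes fin: "kappa_h \<Omega> T c \<noteq> \<infinity>" and f: "f \<in> X_h \<Omega> T c" and w: "w \<in> H1 \<Omega>" "has_trace \<Omega> T w \<gamma>"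
    and orth: "\<And>v. v \<in> V_h \<Omega> T c \<Longrightarrow> a_form \<Omega> c v w = 0"
  shows "\<bar>LINT x|\<Gamma>M. f x * \<gamma> x\<bar> \<le> enn2real (kappa_h \<Omega> T c) * L2_norm \<Gamma>M f * L2_norm \<Omega>M (wgrad \<Omega> w)"
proof -
  have fL: "f \<in> L2 \<Gamma>M" using f by (simp add: X_h_def L2_\<Gamma>_def)
  have \<gamma>: "\<gamma> \<in> L2 \<Gamma>M" using w(2) by (simp add: has_trace_def)
  define B N F where "B = \<bar>LINT x|\<Gamma>M. f x * \<gamma> x\<bar>" and "N = L2_norm \<Omega>M (wgrad \<Omega> w)" and "F = L2_norm \<Gamma>M f"
  show ?thesis
  proof (cases "F = 0")
    case True
    then have "B \<le> 0" using L2_Cauchy_Schwarz[OF fL \<gamma>] unfolding B_def F_def by simp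
    then show ?thesis using True by (simp add: B_def F_def)
  next
    case False
    then have F: "F > 0" by (simp add: F_def less_le)
    define S where "S = {(v, p). v \<in> V_h \<Omega> T c \<and> p \<in> W_h_f \<Omega> T f \<and> has_weak_div \<Omega> p (\<lambda>x. c * v x)}"
    define I where "I = (INF (v, p)\<in>S. ennreal (L2_norm \<Omega>M (\<lambda>x. wgrad \<Omega> v x - p x) / b_norm \<Omega> T f))"
    have bound: "B \<le> L2_norm \<Omega>M (\<lambda>x. wgrad \<Omega> v x - p x) * N" if "(v, p) \<in> S" for v p
      using that equilibrated_flux_bound[OF _ _ _ fL w orth] unfolding S_def B_def N_def by auto
    have I: "I \<le> kappa_h \<Omega> T c" unfolding I_def S_def kappa_h_def
      by (rule SUP_upper) (use f False in \<open>auto simp: b_norm_eq F_def\<close>)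
    \<comment> \<open>The infimum over the empty set is \<open>top\<close>, which finiteness of
      \<open>kappa_h\<close> excludes.\<close>
    have "S \<noteq> {}"
    proof
      assume "S = {}"
      then have "I = top" unfolding I_def by simp
      with I fin show False by (simp add: top_unique)
    qed
    show ?thesis
    proof (cases "N = 0")
      case True
      \<comment> \<open>Dividing by \<open>N\<close> is impossible here, but a single admissible
        pair already gives \<open>B \<le> 0\<close>.\<close>
      obtain v p where "(v, p) \<in> S" using \<open>S \<noteq> {}\<close> by auto
      from bound[OF this] True have "B \<le> 0" by simp
      then show ?thesis using True by (simp add: B_def N_def)
    next
      case False
      then have N: "N > 0" by (simp add: N_def less_le)
      have "ennreal (B / (N * F)) \<le> I" unfolding I_def
      proof (rule INF_greatest, clarify)
        fix v p assume "(v, p) \<in> S"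
        from bound[OF this] have "B / (N * F) \<le> L2_norm \<Omega>M (\<lambda>x. wgrad \<Omega> v x - p x) / b_norm \<Omega> T f"
          using N F unfolding b_norm_eq F_def[symmetric] by (simp add: field_simps)
        then show "ennreal (B / (N * F)) \<le> ennreal (L2_norm \<Omega>M (\<lambda>x. wgrad \<Omega> v x - p x) / b_norm \<Omega> T f)"
          by (rule ennreal_leI)
      qed
      also note I
      also have "kappa_h \<Omega> T c = ennreal (enn2real (kappa_h \<Omega> T c))"
        using fin by (simp add: ennreal_enn2real_if)
      finally have "B / (N * F) \<le> enn2real (kappa_h \<Omega> T c)" by (simp add: ennreal_le_iff)
      then show ?thesis using N F unfolding B_def[symmetric] N_def[symmetric] F_def[symmetric]
        by (simp add: field_simps)
    qed
  qed
qed

lemma boundary_functional_bound: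
  assumes fin: "kappa_h \<Omega> T c \<noteq> \<infinity>" and g: "g \<in> L2_\<Gamma> \<Omega> T c" and w: "w \<in> H1 \<Omega>" "has_trace \<Omega> T w \<gamma>"
    and orth: "\<And>v. v \<in> V_h \<Omega> T c \<Longrightarrow> a_form \<Omega> c v w = 0"
  shows "\<bar>LINT x|\<Gamma>M. g x * \<gamma> x\<bar> \<le>
    sqrt ((C_eh \<Omega> T)\<^sup>2 + (enn2real (kappa_h \<Omega> T c))\<^sup>2) * L2_norm \<Gamma>M g * L2_norm \<Omega>M (wgrad \<Omega> w)"
proof -
  have gL: "g \<in> L2 \<Gamma>M" using g by (simp add: L2_\<Gamma>_def)
  have \<gamma>: "\<gamma> \<in> L2 \<Gamma>M" using w(2) by (simp add: has_trace_def)
  define C \<kappa> N where "C = \<bar>C_eh \<Omega> T\<bar>" and "\<kappa> = enn2real (kappa_h \<Omega> T c)" and "N = L2_norm \<Omega>M (wgrad \<Omega> w)"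
  define x y where "x = L2_norm \<Gamma>M (\<lambda>x. g x - edgewise_mean g x)" and "y = L2_norm \<Gamma>M (edgewise_mean g)"
  have nn: "0 \<le> C" "0 \<le> \<kappa>" "0 \<le> N" "0 \<le> x" "0 \<le> y" by (auto simp: C_def \<kappa>_def N_def x_def y_def)
  note d = L2_diff[OF gL edgewise_mean_L2[of g]]
  have i: "integrable \<Gamma>M (\<lambda>x. (g x - edgewise_mean g x) * \<gamma> x)" "integrable \<Gamma>M (\<lambda>x. edgewise_mean g x * \<gamma> x)"
    using L2_inner_integrable(2)[OF d \<gamma>] L2_inner_integrable(2)[OF edgewise_mean_L2 \<gamma>] by auto
  have "(LINT x|\<Gamma>M. g x * \<gamma> x) = (LINT x|\<Gamma>M. (g x - edgewise_mean g x) * \<gamma> x) + (LINT x|\<Gamma>M. edgewise_mean g x * \<gamma> x)"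
    unfolding Bochner_Integration.integral_add[OF i, symmetric] by (simp add: algebra_simps)
  then have "\<bar>LINT x|\<Gamma>M. g x * \<gamma> x\<bar> \<le> C * x * N + \<kappa> * y * N"
    using projection_error_bound[OF gL w] kappa_bound[OF fin edgewise_mean_X_h[OF g] w orth]
    unfolding C_def \<kappa>_def N_def x_def y_def by linarith
  also have "\<dots> = (C * x + \<kappa> * y) * N" by (simp add: algebra_simps)
  also have "\<dots> \<le> (sqrt (C\<^sup>2 + \<kappa>\<^sup>2) * sqrt (x\<^sup>2 + y\<^sup>2)) * N"
  proof (rule mult_right_mono[OF _ nn(3)])
    \<comment> \<open>Lagrange's identity, that is, the Cauchy-Schwarz inequality in the
      plane.\<close>
    have "(C * x + \<kappa> * y)\<^sup>2 \<le> (C\<^sup>2 + \<kappa>\<^sup>2) * (x\<^sup>2 + y\<^sup>2)"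
    proof -
      have "(C\<^sup>2 + \<kappa>\<^sup>2) * (x\<^sup>2 + y\<^sup>2) - (C * x + \<kappa> * y)\<^sup>2 = (C * y - \<kappa> * x)\<^sup>2"
        by (simp add: power2_eq_square algebra_simps)
      then show ?thesis by (metis diff_ge_0_iff_ge zero_le_power2)
    qed
    then show "C * x + \<kappa> * y \<le> sqrt (C\<^sup>2 + \<kappa>\<^sup>2) * sqrt (x\<^sup>2 + y\<^sup>2)"
      unfolding real_sqrt_mult[symmetric] by (rule real_le_rsqrt)
  qed
  also have "sqrt (x\<^sup>2 + y\<^sup>2) = L2_norm \<Gamma>M g"
    using edgewise_mean_Pythagoras[OF gL] unfolding x_def y_def
    by (metis L2_norm_nonneg add.commute real_sqrt_unique)
  finally show ?thesis unfolding C_def \<kappa>_def N_def by simp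
qed

lemma a_norm_sq:
  assumes c: "c \<ge> 0" and w: "w \<in> H1 \<Omega>"
  shows "(a_norm \<Omega> c w)\<^sup>2 = a_form \<Omega> c w w" "a_form \<Omega> c w w = (L2_norm \<Omega>M (wgrad \<Omega> w))\<^sup>2 + c * (L2_norm \<Omega>M w)\<^sup>2"
    "L2_norm \<Omega>M (wgrad \<Omega> w) \<le> a_norm \<Omega> c w" "0 \<le> a_norm \<Omega> c w"
proof -
  have "a_form \<Omega> c w w = (LINT x|\<Omega>M. wgrad \<Omega> w x \<bullet> wgrad \<Omega> w x) + (LINT x|\<Omega>M. c * w x * w x)"
    unfolding a_form_def by (rule Bochner_Integration.integral_add[OF a_form_integrable[OF w w]])
  also have "\<dots> = (L2_norm \<Omega>M (wgrad \<Omega> w))\<^sup>2 + c * (L2_norm \<Omega>M w)\<^sup>2"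
    unfolding L2_norm_sq power2_norm_eq_inner by (simp add: mult.assoc)
  finally show 1: "a_form \<Omega> c w w = (L2_norm \<Omega>M (wgrad \<Omega> w))\<^sup>2 + c * (L2_norm \<Omega>M w)\<^sup>2" .
  then show 2: "(a_norm \<Omega> c w)\<^sup>2 = a_form \<Omega> c w w" using c by (simp add: a_norm_def)
  show "0 \<le> a_norm \<Omega> c w" unfolding a_norm_def 1 using c by simp
  then show "L2_norm \<Omega>M (wgrad \<Omega> w) \<le> a_norm \<Omega> c w"
    by (rule power2_le_imp_le[rotated]) (use c in \<open>simp add: 1 2\<close>)
qed

end

section \<open>Functions with vanishing gradient\<close>

lemma iterated_integral_continuous:
  fixes F :: "real \<Rightarrow> real \<Rightarrow> real"
  assumes c: "continuous_on UNIV (\<lambda>z. F (fst z) (snd z))"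
  shows "continuous_on S (\<lambda>y. integral {c..d} (\<lambda>x. F x y))" "continuous_on S (\<lambda>x. F x y)"
proof -
  have "continuous_on (S \<times> cbox c d) (\<lambda>(y, x). F x y)"
    using continuous_on_compose2[OF c, of "S \<times> cbox c d" "\<lambda>z. (snd z, fst z)"]
    by (simp add: case_prod_unfold continuous_intros)
  from integral_continuous_on_param[OF this]
  show "continuous_on S (\<lambda>y. integral {c..d} (\<lambda>x. F x y))" by simp
  show "continuous_on S (\<lambda>x. F x y)"
    using continuous_on_compose2[OF c, of S "\<lambda>x. (x, y)"] by (simp add: continuous_intros)
qed

text \<open>Two values of \<open>F\<close> at points of the interval from \<open>X1\<close> to
  \<open>X2\<close> on the same line differ by at most the integral of \<open>\<bar>D\<bar>\<close>.
  Averages are compared with denominators cleared, so that degenerate intervals are covered.\<close>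

lemma interval_average_difference:
  fixes F D :: "real \<Rightarrow> real \<Rightarrow> real"
  assumes cF: "continuous_on UNIV (\<lambda>z. F (fst z) (snd z))" and cD: "continuous_on UNIV (\<lambda>z. D (fst z) (snd z))"
    and der: "\<And>x y. ((\<lambda>x. F x y) has_real_derivative D x y) (at x)"
    and I: "X1 \<le> c" "c \<le> d" "d \<le> X2" and I': "X1 \<le> c'" "c' \<le> d'" "d' \<le> X2"
  shows "(d' - c') * integral {s..t} (\<lambda>y. integral {c..d} (\<lambda>x. F x y)) - (d - c) * integral {s..t} (\<lambda>y. integral {c'..d'} (\<lambda>x. F x y))
     \<le> (d - c) * (d' - c') * integral {s..t} (\<lambda>y. integral {X1..X2} (\<lambda>x. \<bar>D x y\<bar>))"
proof -
  have cA: "continuous_on UNIV (\<lambda>z. \<bar>D (fst z) (snd z)\<bar>)" by (intro continuous_intros cD)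
  note F = iterated_integral_continuous[OF cF] and A = iterated_integral_continuous[of "\<lambda>x y. \<bar>D x y\<bar>", OF cA]
    and D = iterated_integral_continuous[OF cD]
  define M where "M y = integral {X1..X2} (\<lambda>x. \<bar>D x y\<bar>)" for y
  have step: "\<bar>F u y - F v y\<bar> \<le> M y" if uv: "v \<le> u" "X1 \<le> v" "u \<le> X2" for u v y
  proof -
    have "((\<lambda>x. D x y) has_integral (F u y - F v y)) {v..u}"
      using uv(1) by (rule fundamental_theorem_of_calculus)
        (auto simp: has_real_derivative_iff_has_vector_derivative[symmetric] intro: has_field_derivative_at_within der)
    then have "F u y - F v y = integral {v..u} (\<lambda>x. D x y)" by (simp add: integral_unique)
    also have "\<bar>\<dots>\<bar> \<le> integral {v..u} (\<lambda>x. \<bar>D x y\<bar>)"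
      using integral_norm_bound_integral[of "\<lambda>x. D x y" "{v..u}" "\<lambda>x. \<bar>D x y\<bar>"]
      by (simp add: integrable_continuous_interval D A)
    also have "\<dots> \<le> M y" unfolding M_def
      by (rule integral_subset_le) (use uv in \<open>auto intro!: integrable_continuous_interval A\<close>)
    finally show ?thesis .
  qed
  have step': "F u y \<le> F v y + M y" if "u \<in> {c..d}" "v \<in> {c'..d'}" for u v y
    using step[of v u y] step[of u v y] that I I' by (cases "v \<le> u") auto
  have slice: "(d' - c') * integral {c..d} (\<lambda>x. F x y) - (d - c) * integral {c'..d'} (\<lambda>x. F x y) \<le> (d - c) * (d' - c') * M y" for y
  proof -
    have 1: "integral {c..d} (\<lambda>x. F x y) \<le> (d - c) * (F v y + M y)" if "v \<in> {c'..d'}" for v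
    proof -
      have "integral {c..d} (\<lambda>x. F x y) \<le> integral {c..d} (\<lambda>x. F v y + M y)"
        by (rule integral_le) (auto intro!: integrable_continuous_interval F step'[OF _ that])
      then show ?thesis using I by simp
    qed
    have "(d' - c') * integral {c..d} (\<lambda>x. F x y) = integral {c'..d'} (\<lambda>v. integral {c..d} (\<lambda>x. F x y))"
      using I' by simp
    also have "\<dots> \<le> integral {c'..d'} (\<lambda>v. (d - c) * (F v y + M y))"
      by (rule integral_le[OF _ _ 1]) (auto intro!: integrable_continuous_interval continuous_intros F)
    also have "\<dots> = (d - c) * (integral {c'..d'} (\<lambda>v. F v y) + (d' - c') * M y)"
      using I' by (simp add: Henstock_Kurzweil_Integration.integral_add integrable_continuous_interval F)
    finally show ?thesis by (simp add: algebra_simps)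
  qed
  have "(d' - c') * integral {s..t} (\<lambda>y. integral {c..d} (\<lambda>x. F x y)) - (d - c) * integral {s..t} (\<lambda>y. integral {c'..d'} (\<lambda>x. F x y))
     = integral {s..t} (\<lambda>y. (d' - c') * integral {c..d} (\<lambda>x. F x y) - (d - c) * integral {c'..d'} (\<lambda>x. F x y))"
    by (subst Henstock_Kurzweil_Integration.integral_diff) (auto intro!: integrable_continuous_interval continuous_intros F)
  also have "\<dots> \<le> integral {s..t} (\<lambda>y. (d - c) * (d' - c') * M y)"
    unfolding M_def by (rule integral_le[OF _ _ slice[unfolded M_def]]) (auto intro!: integrable_continuous_interval continuous_intros F A)
  finally show ?thesis by (simp add: M_def)
qed

lemma C1_partial:
  assumes "C1_with_grad \<phi> g"
  shows "((\<lambda>x. \<phi> (x, y)) has_real_derivative fst (g (x, y))) (at x)"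
    and "((\<lambda>y. \<phi> (x, y)) has_real_derivative snd (g (x, y))) (at y)"
proof -
  have "((\<lambda>x. (x, y)) has_vector_derivative (1, 0)) (at x)" "((\<lambda>y. (x, y)) has_vector_derivative (0, 1)) (at y)"
    by (auto intro!: derivative_eq_intros has_vector_derivative_Pair)
  from C1_along_curve[OF assms this(1)] C1_along_curve[OF assms this(2)]
  show "((\<lambda>x. \<phi> (x, y)) has_real_derivative fst (g (x, y))) (at x)"
    "((\<lambda>y. \<phi> (x, y)) has_real_derivative snd (g (x, y))) (at y)"
    by (simp_all add: inner_prod_def)
qed

text \<open>The one-dimensional estimate is applied on lines parallel to an axis, and the norm of
  the gradient dominates either partial derivative.\<close>

lemma box_average_difference:
  assumes \<phi>: "\<phi> \<in> C_inf"
    and I: "X1 \<le> c" "c \<le> d" "d \<le> X2" and I': "X1 \<le> c'" "c' \<le> d'" "d' \<le> X2"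
  shows "(d' - c') * integral (cbox (c,s) (d,t)) \<phi> - (d - c) * integral (cbox (c',s) (d',t)) \<phi>
     \<le> (d - c) * (d' - c') * integral (cbox (X1,s) (X2,t)) (\<lambda>x. norm (grad \<phi> x))" (is ?horizontal)
    and "(d' - c') * integral (cbox (s,c) (t,d)) \<phi> - (d - c) * integral (cbox (s,c') (t,d')) \<phi>
     \<le> (d - c) * (d' - c') * integral (cbox (s,X1) (t,X2)) (\<lambda>x. norm (grad \<phi> x))" (is ?vertical)
proof -
  note cont = C_inf_continuous[OF \<phi>] C_inf_continuous_grad[OF \<phi>]
  have prod: "integral (cbox (a,b) (a',b')) f = integral {a..a'} (\<lambda>x. integral {b..b'} (\<lambda>y. f (x, y)))"
    "integral (cbox (a,b) (a',b')) f = integral {b..b'} (\<lambda>y. integral {a..a'} (\<lambda>x. f (x, y)))"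
    if f: "continuous_on UNIV f" for f :: "plane \<Rightarrow> real" and a b a' b'
  proof -
    have 1: "continuous_on S f" for S by (rule continuous_on_subset[OF f]) simp
    show A: "integral (cbox (a,b) (a',b')) f = integral {a..a'} (\<lambda>x. integral {b..b'} (\<lambda>y. f (x, y)))"
      using integral_prod_continuous[OF 1, of a b a' b'] by simp
    show "integral (cbox (a,b) (a',b')) f = integral {b..b'} (\<lambda>y. integral {a..a'} (\<lambda>x. f (x, y)))"
      unfolding A using integral_swap_continuous[of a b a' b' "\<lambda>x y. f (x, y)"] 1 by simp
  qed
  have cg: "continuous_on UNIV (\<lambda>x. norm (grad \<phi> x))" "continuous_on UNIV (\<lambda>x. \<bar>fst (grad \<phi> x)\<bar>)" "continuous_on UNIV (\<lambda>x. \<bar>snd (grad \<phi> x)\<bar>)"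
    by (intro continuous_intros cont)+
  have mono: "integral (cbox a b) (\<lambda>x. \<bar>fst (grad \<phi> x)\<bar>) \<le> integral (cbox a b) (\<lambda>x. norm (grad \<phi> x))"
    "integral (cbox a b) (\<lambda>x. \<bar>snd (grad \<phi> x)\<bar>) \<le> integral (cbox a b) (\<lambda>x. norm (grad \<phi> x))" for a b
    using norm_fst_le[of "fst (grad \<phi> x)" "snd (grad \<phi> x)" for x] norm_snd_le[of "snd (grad \<phi> x)" "fst (grad \<phi> x)" for x]
    by (intro integral_le integrable_continuous continuous_on_subset[OF cg(1)] continuous_on_subset[OF cg(2)] continuous_on_subset[OF cg(3)]; simp)+
  have c1: "continuous_on UNIV (\<lambda>z. \<phi> (fst z, snd z))" "continuous_on UNIV (\<lambda>z. fst (grad \<phi> (fst z, snd z)))"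
    using cont by (simp_all add: continuous_intros)
  have c2: "continuous_on UNIV (\<lambda>z. \<phi> (snd z, fst z))" "continuous_on UNIV (\<lambda>z. snd (grad \<phi> (snd z, fst z)))"
    by (auto intro!: continuous_intros continuous_on_compose2[OF cont(1)] continuous_on_compose2[OF cont(2)])
  have "(d' - c') * integral (cbox (c,s) (d,t)) \<phi> - (d - c) * integral (cbox (c',s) (d',t)) \<phi>
     \<le> (d - c) * (d' - c') * integral (cbox (X1,s) (X2,t)) (\<lambda>x. \<bar>fst (grad \<phi> x)\<bar>)"
    unfolding prod(2)[OF cont(1)] prod(2)[OF cg(2)]
    by (rule interval_average_difference[OF c1 C1_partial(1)[OF C_inf_C1[OF \<phi>]] I I'])
  also have "\<dots> \<le> (d - c) * (d' - c') * integral (cbox (X1,s) (X2,t)) (\<lambda>x. norm (grad \<phi> x))"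
    using I I' by (intro mult_left_mono mono) auto
  finally show ?horizontal .
  have "(d' - c') * integral (cbox (s,c) (t,d)) \<phi> - (d - c) * integral (cbox (s,c') (t,d')) \<phi>
     \<le> (d - c) * (d' - c') * integral (cbox (s,X1) (t,X2)) (\<lambda>x. \<bar>snd (grad \<phi> x)\<bar>)"
    unfolding prod(1)[OF cont(1)] prod(1)[OF cg(3)]
    by (rule interval_average_difference[OF c2 C1_partial(2)[OF C_inf_C1[OF \<phi>]] I I'])
  also have "\<dots> \<le> (d - c) * (d' - c') * integral (cbox (s,X1) (t,X2)) (\<lambda>x. norm (grad \<phi> x))"
    using I I' by (intro mult_left_mono mono) auto
  finally show ?vertical .
qed

context polygonal_mesh
begin

lemma indicator_L2: "(indicator (box a b) :: plane \<Rightarrow> real) \<in> L2 \<Omega>M"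
proof (rule L2_I)
  show m: "(indicator (box a b) :: plane \<Rightarrow> real) \<in> borel_measurable \<Omega>M"
    by (intro measurable_restrict_space1 borel_measurable_indicator) auto
  have 1: "integrable \<Omega>M (\<lambda>x. 1::real)" by (intro L2_integrable_\<Omega> continuous_L2_\<Omega> continuous_intros)
  show "integrable \<Omega>M (\<lambda>x. (norm (indicator (box a b) x :: real))\<^sup>2)"
  proof (rule Bochner_Integration.integrable_bound[OF 1])
    show "(\<lambda>x. (norm (indicator (box a b) x :: real))\<^sup>2) \<in> borel_measurable \<Omega>M" using m by measurable
  qed (auto simp: indicator_def intro!: AE_I2)
qed

lemma box_integral_continuous:
  fixes f :: "plane \<Rightarrow> real"
  assumes f: "continuous_on UNIV f" and sub: "cbox a b \<subseteq> \<Omega>"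
  shows "(LINT x|\<Omega>M. f x * indicator (box a b) x) = integral (cbox a b) f"
proof -
  have [measurable]: "f \<in> borel_measurable borel" by (rule borel_measurable_continuous_onI[OF f])
  have bs: "box a b \<subseteq> \<Omega>" using sub box_subset_cbox by blast
  have "(LINT x|\<Omega>M. f x * indicator (box a b) x) = (LINT x|lborel. indicator \<Omega> x *\<^sub>R (f x * indicator (box a b) x))"
    by (rule integral_lebesgue_on_borel) measurable
  also have "\<dots> = (LINT x:box a b|lborel. f x)"
    unfolding set_lebesgue_integral_def using bs by (intro Bochner_Integration.integral_cong) (auto simp: indicator_def)
  also have "\<dots> = integral (box a b) f"
  proof (rule set_borel_integral_eq_integral(2))
    have "set_integrable lborel (cbox a b) f"
      unfolding set_integrable_def by (rule borel_integrable_compact) (auto intro: continuous_on_subset[OF f])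
    then show "set_integrable lborel (box a b) f" by (rule set_integrable_subset) (auto simp: box_subset_cbox)
  qed
  finally show ?thesis by (simp add: integral_open_interval)
qed

text \<open>Along the approximating sequence the gradients tend to \<open>wgrad \<Omega> w\<close>,
  of norm zero, so the right-hand side of \<open>le\<close> disappears in the limit while the box
  integrals on the left converge.\<close>

lemma box_integral_limit_le:
  assumes w: "w \<in> H1 \<Omega>" "has_trace \<Omega> T w \<gamma>" and z: "L2_norm \<Omega>M (wgrad \<Omega> w) = 0"
    and sub: "cbox a b \<subseteq> \<Omega>" "cbox a' b' \<subseteq> \<Omega>" "cbox p q \<subseteq> \<Omega>"
    and le: "\<And>\<phi>. \<phi> \<in> C_inf \<Longrightarrow> \<alpha> * integral (cbox a b) \<phi> - \<beta> * integral (cbox a' b') \<phi> \<le> \<delta> * integral (cbox p q) (\<lambda>x. norm (grad \<phi> x))"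
  shows "\<alpha> * (LINT x|\<Omega>M. w x * indicator (box a b) x) \<le> \<beta> * (LINT x|\<Omega>M. w x * indicator (box a' b') x)"
proof -
  obtain \<phi> where \<phi>: "\<And>n. \<phi> n \<in> C_inf" "L2_lim \<Omega>M \<phi> w" "L2_lim \<Omega>M (\<lambda>n. grad (\<phi> n)) (wgrad \<Omega> w)" "L2_lim \<Gamma>M \<phi> \<gamma>"
    using has_trace_D[OF w] by blast
  define E where "E n = (LINT x|\<Omega>M. norm (grad (\<phi> n) x) * indicator (box p q) x)" for n
  have "E \<longlonglongrightarrow> 0"
  proof (rule tendsto_zero_squeeze)
    show "0 \<le> E n" for n unfolding E_def by (rule Bochner_Integration.integral_nonneg) (auto simp: indicator_def)
    have gn: "(\<lambda>x. norm (grad (\<phi> n) x)) \<in> L2 \<Omega>M" for n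
      by (intro continuous_L2_\<Omega> continuous_intros C_inf_continuous_grad \<phi>)
    have "L2_norm \<Omega>M (\<lambda>x. norm (grad (\<phi> n) x)) = L2_norm \<Omega>M (grad (\<phi> n))" for n by (simp add: L2_norm_def)
    then show "E n \<le> L2_norm \<Omega>M (grad (\<phi> n)) * L2_norm \<Omega>M (indicator (box p q) :: plane \<Rightarrow> real)" for n
      using L2_Cauchy_Schwarz[OF gn[of n] indicator_L2[of p q]] unfolding E_def by simp
    show "(\<lambda>n. L2_norm \<Omega>M (grad (\<phi> n)) * L2_norm \<Omega>M (indicator (box p q) :: plane \<Rightarrow> real)) \<longlonglongrightarrow> 0"
      using L2_lim_norm[OF \<phi>(3)] z by (auto intro: tendsto_mult_left_zero)
  qed
  then have 2: "(\<lambda>n. \<delta> * E n) \<longlonglongrightarrow> \<delta> * 0" by (intro tendsto_intros)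
  have 1: "(\<lambda>n. \<alpha> * (LINT x|\<Omega>M. \<phi> n x \<bullet> indicator (box a b) x) - \<beta> * (LINT x|\<Omega>M. \<phi> n x \<bullet> indicator (box a' b') x)) \<longlonglongrightarrow>
     \<alpha> * (LINT x|\<Omega>M. w x \<bullet> indicator (box a b) x) - \<beta> * (LINT x|\<Omega>M. w x \<bullet> indicator (box a' b') x)"
    by (intro tendsto_intros L2_lim_inner \<phi>(2) indicator_L2)
  have "\<alpha> * (LINT x|\<Omega>M. w x \<bullet> indicator (box a b) x) - \<beta> * (LINT x|\<Omega>M. w x \<bullet> indicator (box a' b') x) \<le> \<delta> * 0"
  proof (rule LIMSEQ_le[OF 1 2], intro exI allI impI)
    fix n
    note c = C_inf_continuous[OF \<phi>(1)[of n]] C_inf_continuous_grad[OF \<phi>(1)[of n]]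
    have "E n = integral (cbox p q) (\<lambda>x. norm (grad (\<phi> n) x))"
      unfolding E_def by (rule box_integral_continuous[OF _ sub(3)]) (intro continuous_intros c)
    then show "\<alpha> * (LINT x|\<Omega>M. \<phi> n x \<bullet> indicator (box a b) x) - \<beta> * (LINT x|\<Omega>M. \<phi> n x \<bullet> indicator (box a' b') x) \<le> \<delta> * E n"
      using le[OF \<phi>(1)[of n]] box_integral_continuous[OF c(1) sub(1)] box_integral_continuous[OF c(1) sub(2)] by simp
  qed
  then show ?thesis by simp
qed

text \<open>Comparison first with the full width and then with the full height shows that the
  integral of \<open>w\<close> over a subbox is proportional to its area. Hence
  \<open>w - k\<close>, with \<open>k\<close> the mean over the large box, has integral zero over
  every subbox.\<close>

lemma zero_grad_constant_on_box:
  assumes w: "w \<in> H1 \<Omega>" "has_trace \<Omega> T w \<gamma>" and z: "L2_norm \<Omega>M (wgrad \<Omega> w) = 0"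
    and Q: "box p q \<noteq> {}" "cbox p q \<subseteq> \<Omega>"
  shows "\<exists>k. AE x in lebesgue_on (box p q). w x = k"
proof -
  define W where "W c s d t = (LINT x|\<Omega>M. w x * indicator (box (c,s) (d,t)) x)" for c s d t
  obtain X1 Y1 X2 Y2 where pq: "p = (X1, Y1)" "q = (X2, Y2)" by (metis surj_pair)
  have XY: "X1 < X2" "Y1 < Y2" using Q(1) by (auto simp: pq mem_box_plane ex_in_conv[symmetric])
  have sub: "cbox (c,s) (d,t) \<subseteq> \<Omega>" if "X1 \<le> c" "d \<le> X2" "Y1 \<le> s" "t \<le> Y2" for c s d t
    by (rule order_trans[OF _ Q(2)]) (use that in \<open>auto simp: pq mem_box_plane\<close>)
  \<comment> \<open>The comparison inequality is used twice, with the two boxes exchanged.\<close>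
  have hor: "(X2 - X1) * W c s d t = (d - c) * W X1 s X2 t"
    if "X1 \<le> c" "c \<le> d" "d \<le> X2" "Y1 \<le> s" "t \<le> Y2" for c d s t
    unfolding W_def using that XY
    by (intro antisym; intro box_integral_limit_le[OF w z _ _ _ box_average_difference(1)[where ?X1.0 = X1 and ?X2.0 = X2 and s = s and t = t]] sub) auto
  have ver: "(Y2 - Y1) * W X1 s X2 t = (t - s) * W X1 Y1 X2 Y2"
    if "Y1 \<le> s" "s \<le> t" "t \<le> Y2" for s t
    unfolding W_def using that XY
    by (intro antisym; intro box_integral_limit_le[OF w z _ _ _ box_average_difference(2)[where ?X1.0 = Y1 and ?X2.0 = Y2 and s = X1 and t = X2]] sub) auto
  define k where "k = W X1 Y1 X2 Y2 / ((X2 - X1) * (Y2 - Y1))"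
  have Wk: "W c s d t = (d - c) * (t - s) * k" if "X1 \<le> c" "c \<le> d" "d \<le> X2" "Y1 \<le> s" "s \<le> t" "t \<le> Y2" for c d s t
  proof -
    have "(X2 - X1) * (Y2 - Y1) * W c s d t = (Y2 - Y1) * ((X2 - X1) * W c s d t)" by simp
    also have "\<dots> = (d - c) * ((Y2 - Y1) * W X1 s X2 t)" using hor[of c d s t] that by simp
    also have "\<dots> = (d - c) * (t - s) * W X1 Y1 X2 Y2" using ver[of s t] that by simp
    finally show ?thesis using XY by (simp add: k_def eq_divide_eq mult_ac)
  qed
  have wL: "w \<in> L2 \<Omega>M" by (rule H1_D(1)[OF w(1)])
  have d: "(\<lambda>x. w x - k) \<in> L2 \<Omega>M" by (intro L2_diff wL continuous_L2_\<Omega> continuous_intros)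
  have bs: "box p q \<subseteq> \<Omega>" using Q(2) box_subset_cbox by blast
  have "AE x in lebesgue_on (box p q). w x - k = 0"
  proof (rule AE_zero_of_box_integrals[OF open_box])
    have "integrable lebesgue (\<lambda>x. indicator \<Omega> x * (w x - k))"
      using L2_integrable_\<Omega>[OF d] by (simp add: integrable_restrict_space)
    from integrable_mult_indicator[OF _ this, of "box p q"]
    have "integrable lebesgue (\<lambda>x. indicator (box p q) x * (indicator \<Omega> x * (w x - k)))" by simp
    moreover have "indicator (box p q) x * (indicator \<Omega> x * (w x - k)) = indicator (box p q) x * (w x - k)" for x
      using bs by (auto simp: indicator_def)
    ultimately show "integrable (lebesgue_on (box p q)) (\<lambda>x. w x - k)" by (simp add: integrable_restrict_space)
    fix a b :: plane assume ab: "box a b \<noteq> {}" "cbox a b \<subseteq> box p q"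
    obtain c s d t where cs: "a = (c, s)" "b = (d, t)" by (metis surj_pair)
    have o: "c < d" "s < t" using ab(1) by (auto simp: cs mem_box_plane ex_in_conv[symmetric])
    have "a \<in> cbox a b" "b \<in> cbox a b" using o by (auto simp: cs mem_box_plane)
    then have "a \<in> box p q" "b \<in> box p q" using ab(2) by auto
    then have in': "X1 \<le> c" "d \<le> X2" "Y1 \<le> s" "t \<le> Y2" by (auto simp: cs pq mem_box_plane)
    have abs: "box a b \<subseteq> box p q" using ab(2) box_subset_cbox by blast
    have "(LINT x|lebesgue_on (box p q). indicator (box a b) x * (w x - k)) = (LINT x|\<Omega>M. indicator (box a b) x * (w x - k))"
      by (rule integral_lebesgue_on_subset[symmetric]) (use bs abs in \<open>auto simp: indicator_def\<close>)
    also have "\<dots> = (LINT x|\<Omega>M. w x * indicator (box a b) x - k * indicator (box a b) x)"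
      by (simp add: algebra_simps)
    also have "\<dots> = W c s d t - (LINT x|\<Omega>M. k * indicator (box a b) x)"
      unfolding W_def cs
      by (rule Bochner_Integration.integral_diff)
         (use L2_inner_integrable(2)[OF wL indicator_L2] L2_integrable_\<Omega>[OF indicator_L2] in auto)
    also have "(LINT x|\<Omega>M. k * indicator (box a b) x) = (d - c) * (t - s) * k"
    proof -
      have "(LINT x|\<Omega>M. k * indicator (box a b) x) = integral (cbox a b) (\<lambda>x. k)"
        by (rule box_integral_continuous) (use sub in' in \<open>auto simp: cs\<close>)
      also have "\<dots> = (d - c) * (t - s) * k"
        using o integral_prod_continuous[of c s d t "\<lambda>x. k"] by (simp add: cs mult.commute)
      finally show ?thesis .
    qed
    finally show "(LINT x|lebesgue_on (box p q). indicator (box a b) x * (w x - k)) = 0"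
      using Wk[of c d s t] in' o by simp
  qed
  then have "AE x in lebesgue_on (box p q). w x = k" by eventually_elim simp
  then show ?thesis by blast
qed

text \<open>Local constants agree on overlaps, because a nonempty open set is not negligible. The
  points near which \<open>w\<close> is almost everywhere \<open>k\<close> and those near which it
  has another constant value therefore form disjoint open sets, and connectedness excludes the
  second kind.\<close>

lemma zero_grad_constant:
  assumes w: "w \<in> H1 \<Omega>" "has_trace \<Omega> T w \<gamma>" and z: "L2_norm \<Omega>M (wgrad \<Omega> w) = 0"
  shows "\<exists>k. AE x in \<Omega>M. w x = k"
proof -
  have loc: "\<exists>N k. open N \<and> x \<in> N \<and> N \<subseteq> \<Omega> \<and> negligible {y \<in> N. w y \<noteq> k}" if x: "x \<in> \<Omega>" for x
  proof -
    obtain p q where pq: "x \<in> box p q" "cbox p q \<subseteq> \<Omega>" using open_\<Omega> x open_contains_cbox[of \<Omega>] by metis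
    obtain k where k: "AE y in lebesgue_on (box p q). w y = k"
      using zero_grad_constant_on_box[OF w z _ pq(2)] pq(1) by auto
    then have "AE y in lebesgue. y \<in> box p q \<longrightarrow> w y = k" by (subst (asm) AE_restrict_space_iff) auto
    then obtain N where "N \<in> null_sets lebesgue" "{y. \<not> (y \<in> box p q \<longrightarrow> w y = k)} \<subseteq> N"
      unfolding eventually_ae_filter by auto
    then have "negligible N" "{y \<in> box p q. w y \<noteq> k} \<subseteq> N" by (auto simp: negligible_iff_null_sets)
    then have "negligible {y \<in> box p q. w y \<noteq> k}" by (rule negligible_subset)
    then show ?thesis using pq box_subset_cbox by (intro exI[of _ "box p q"] exI[of _ k]) auto
  qed
  have uniq: "k = k'" if "open N" "open N'" "y \<in> N" "y \<in> N'" "negligible {y \<in> N. w y \<noteq> k}" "negligible {y \<in> N'. w y \<noteq> k'}" for N N' y k k'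
  proof (rule ccontr)
    assume ne: "k \<noteq> k'"
    have "negligible ({y \<in> N. w y \<noteq> k} \<union> {y \<in> N'. w y \<noteq> k'})" using that by simp
    then have "negligible (N \<inter> N')" by (rule negligible_subset) (use ne in auto)
    moreover have "open (N \<inter> N')" "N \<inter> N' \<noteq> {}" using that by auto
    ultimately show False using open_not_negligible by blast
  qed
  define const_on where "const_on N k \<longleftrightarrow> open N \<and> N \<subseteq> \<Omega> \<and> negligible {y \<in> N. w y \<noteq> k}" for N k
  have loc': "\<exists>N k. x \<in> N \<and> const_on N k" if "x \<in> \<Omega>" for x
    using loc[OF that] unfolding const_on_def by metis
  have uniq': "k = k'" if "const_on N k" "const_on N' k'" "y \<in> N" "y \<in> N'" for N N' y k k'
    using that unfolding const_on_def by (intro uniq[of N N' y]) auto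
  obtain x0 where x0: "x0 \<in> \<Omega>" using dom by (auto simp: polygonal_domain_def)
  obtain N0 k where N0: "x0 \<in> N0" "const_on N0 k" using loc'[OF x0] by metis
  define A where "A = \<Union>{N. const_on N k}"
  define B where "B = \<Union>{N. \<exists>k'. k' \<noteq> k \<and> const_on N k'}"
  have "open A" "open B" unfolding A_def B_def const_on_def by auto
  moreover have "A \<inter> B \<inter> \<Omega> = {}" unfolding A_def B_def using uniq' by blast
  moreover have "\<Omega> \<subseteq> A \<union> B"
  proof
    fix x assume "x \<in> \<Omega>"
    then obtain N k' where "x \<in> N" "const_on N k'" using loc' by metis
    then show "x \<in> A \<union> B" unfolding A_def B_def by (cases "k' = k") blast+
  qed
  moreover have "A \<inter> \<Omega> \<noteq> {}" using N0 x0 unfolding A_def by blast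
  ultimately have "B \<inter> \<Omega> = {}" using connectedD[OF connected_\<Omega>, of A B] by blast
  then have "\<Omega> \<subseteq> A" using \<open>\<Omega> \<subseteq> A \<union> B\<close> by blast
  have "negligible {x \<in> \<Omega>. w x \<noteq> k}"
  proof (subst locally_negligible_alt, intro ballI)
    fix x assume x: "x \<in> {x \<in> \<Omega>. w x \<noteq> k}"
    then obtain N where "x \<in> N" "const_on N k" using \<open>\<Omega> \<subseteq> A\<close> unfolding A_def by blast
    then have N: "open N" "x \<in> N" "negligible {y \<in> N. w y \<noteq> k}" by (simp_all add: const_on_def)
    have "negligible ({x \<in> \<Omega>. w x \<noteq> k} \<inter> N)" by (rule negligible_subset[OF N(3)]) auto
    then show "\<exists>U. openin (top_of_set {x \<in> \<Omega>. w x \<noteq> k}) U \<and> x \<in> U \<and> negligible U"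
      using x N by (intro exI[of _ "{x \<in> \<Omega>. w x \<noteq> k} \<inter> N"]) auto
  qed
  then have "AE x in lebesgue. x \<in> \<Omega> \<longrightarrow> w x = k"
    unfolding negligible_iff_null_sets by (rule AE_I') auto
  then show ?thesis by (auto simp: AE_restrict_space_iff)
qed

text \<open>Subtracting \<open>k\<close> from an approximating sequence gives one that tends to zero
  together with its gradients, so \<open>trace_zero\<close> applies.\<close>

lemma zero_grad_trace_constant:
  assumes w: "w \<in> H1 \<Omega>" "has_trace \<Omega> T w \<gamma>" and z: "L2_norm \<Omega>M (wgrad \<Omega> w) = 0"
    and k: "AE x in \<Omega>M. w x = k"
  shows "AE x in \<Gamma>M. \<gamma> x = k"
proof -
  obtain \<phi> where \<phi>: "\<And>n. \<phi> n \<in> C_inf" "L2_lim \<Omega>M \<phi> w" "L2_lim \<Omega>M (\<lambda>n. grad (\<phi> n)) (wgrad \<Omega> w)" "L2_lim \<Gamma>M \<phi> \<gamma>"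
    using has_trace_D[OF w] by blast
  have kL: "(\<lambda>x. k) \<in> L2 \<Omega>M" "(\<lambda>x. k) \<in> L2 \<Gamma>M" by (intro continuous_L2_\<Omega> continuous_L2_\<Gamma>M continuous_intros)+
  have n0: "L2_norm M (\<lambda>x. 0) = 0" for M :: "plane measure" by (simp add: L2_norm_def)
  have "L2_lim M (\<lambda>n x. k) (\<lambda>x. k)" if "(\<lambda>x. k) \<in> L2 M" for M :: "plane measure"
    using that by (simp add: L2_lim_def n0)
  note kl = this[OF kL(1)] this[OF kL(2)]
  have gk: "grad (\<lambda>x. \<phi> n x - k) = grad (\<phi> n)" for n
    using grad_diff[OF \<phi>(1) C_inf_const, of n k] C1_grad_unique[of "\<lambda>x. k" "\<lambda>x. 0"]
    by (simp add: C1_with_grad_def GDERIV_const)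
  have l: "L2_lim \<Gamma>M (\<lambda>n x. \<phi> n x - k) (\<lambda>x. \<gamma> x - k)" by (rule L2_lim_diff[OF \<phi>(4) kl(2)])
  have "L2_norm \<Gamma>M (\<lambda>x. \<gamma> x - k) = 0"
  proof (rule trace_zero[OF C_inf_diff[OF \<phi>(1) C_inf_const] _ _ l])
    have "L2_lim \<Omega>M \<phi> (\<lambda>x. k)" by (rule L2_lim_cong_AE[OF \<phi>(2) kL(1) k])
    from L2_lim_norm[OF L2_lim_diff[OF this kl(1)]]
    show "(\<lambda>n. L2_norm \<Omega>M (\<lambda>x. \<phi> n x - k)) \<longlonglongrightarrow> 0" by (simp add: n0)
    show "(\<lambda>n. L2_norm \<Omega>M (grad (\<lambda>x. \<phi> n x - k))) \<longlonglongrightarrow> 0"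
      unfolding gk using L2_lim_norm[OF \<phi>(3)] z by simp
  qed
  moreover have "(\<lambda>x. \<gamma> x - k) \<in> L2 \<Gamma>M" using l by (simp add: L2_lim_def)
  ultimately show ?thesis using L2_zero_imp_AE by force
qed

lemma a_norm_zero_trace_zero:
  assumes c: "c \<ge> 0" and w: "w \<in> V \<Omega> T c" and z: "a_norm \<Omega> c w = 0"
  shows "L2_norm \<Gamma>M (bdry_trace \<Omega> T w) = 0"
proof -
  note W = V_D[OF w]
  note a = a_norm_sq[OF c W(1)]
  have z1: "L2_norm \<Omega>M (wgrad \<Omega> w) = 0" using a(3) z L2_norm_nonneg[of \<Omega>M "wgrad \<Omega> w"] by linarith
  have z2: "c * (L2_norm \<Omega>M w)\<^sup>2 = 0" using a(1,2) z z1 by simp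
  have gm: "bdry_trace \<Omega> T w \<in> borel_measurable \<Gamma>M" using L2_D(1)[OF W(4)] .
  obtain k where k: "AE x in \<Omega>M. w x = k" using zero_grad_constant[OF W(1,2) z1] by blast
  have "AE x in \<Gamma>M. bdry_trace \<Omega> T w x = 0"
  proof (cases "c = 0")
    case True
    have gk: "AE x in \<Gamma>M. bdry_trace \<Omega> T w x = k" by (rule zero_grad_trace_constant[OF W(1,2) z1 k])
    have "(LINT x|\<Gamma>M. bdry_trace \<Omega> T w x) = 0" using W(3) True by (simp add: L2_\<Gamma>_def)
    moreover have "(LINT x|\<Gamma>M. bdry_trace \<Omega> T w x) = (LINT x|\<Gamma>M. k)"
      by (rule integral_cong_AE) (use gm gk in auto)
    \<comment> \<open>Multiplication by \<open>k\<close> turns the vanishing integral of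
      \<open>k\<close> into that of \<open>k\<^sup>2\<close>, so \<open>k = 0\<close> holds almost
      everywhere on the boundary, whatever its length.\<close>
    moreover have "(LINT x|\<Gamma>M. k * k) = k * (LINT x|\<Gamma>M. k)" by simp
    ultimately have "(LINT x|\<Gamma>M. (norm k)\<^sup>2) = 0" by (simp add: power2_eq_square)
    then have "L2_norm \<Gamma>M (\<lambda>x. k) = 0" by (simp add: L2_norm_def)
    moreover have "(\<lambda>x. k) \<in> L2 \<Gamma>M" by (intro continuous_L2_\<Gamma>M continuous_intros)
    ultimately have "AE x in \<Gamma>M. k = 0" using L2_zero_imp_AE by blast
    with gk show ?thesis by eventually_elim simp
  next
    case False
    \<comment> \<open>Here the zeroth-order term of \<open>a_form\<close> alone makes
      \<open>w\<close> vanish.\<close>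
    then have "L2_norm \<Omega>M w = 0" using z2 by simp
    then have "AE x in \<Omega>M. w x = 0" using L2_zero_imp_AE[OF H1_D(1)[OF W(1)]] by blast
    then show ?thesis by (rule zero_grad_trace_constant[OF W(1,2) z1])
  qed
  then have "L2_norm \<Gamma>M (bdry_trace \<Omega> T w) = L2_norm \<Gamma>M (\<lambda>x. 0::real)"
    by (intro L2_norm_cong_AE gm) auto
  then show ?thesis by (simp add: L2_norm_def)
qed

end

theorem theorem3:
  fixes \<Omega> :: "plane set" and T :: "plane set set" and c \<sigma> :: real
    and f u u\<^sub>h :: "plane \<Rightarrow> real"
  assumes "polygonal_domain \<Omega>" and "c \<ge> 0"
    and "triangulation_of \<Omega> T" and "shape_regular \<sigma> T" and "at_most_one_boundary_edge \<Omega> T"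
    and "f \<in> L2_\<Gamma> \<Omega> T c"
    and "u \<in> V \<Omega> T c"
    and "\<forall>v\<in>V \<Omega> T c. a_form \<Omega> c u v = b_form \<Omega> T f (bdry_trace \<Omega> T v)"
    and "u\<^sub>h \<in> V_h \<Omega> T c"
    and "\<forall>v\<in>V_h \<Omega> T c. a_form \<Omega> c u\<^sub>h v = b_form \<Omega> T f (bdry_trace \<Omega> T v)"
  defines "err \<equiv> (\<lambda>x. u x - u\<^sub>h x)"
  shows "ennreal (a_norm \<Omega> c err) \<le> M_h \<Omega> T c * ennreal (b_norm \<Omega> T f) \<and>
         ennreal (b_norm \<Omega> T (bdry_trace \<Omega> T err)) \<le> M_h \<Omega> T c * ennreal (a_norm \<Omega> c err) \<and>
         M_h \<Omega> T c * ennreal (a_norm \<Omega> c err) \<le> (M_h \<Omega> T c)\<^sup>2 * ennreal (b_norm \<Omega> T f)"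
proof -
  interpret polygonal_mesh \<Omega> T by unfold_locales fact+
  define \<gamma> where "\<gamma> = bdry_trace \<Omega> T err"
  have VhV: "v \<in> V \<Omega> T c" if "v \<in> V_h \<Omega> T c" for v using that by (simp add: V_h_def)
  have uhV: "u\<^sub>h \<in> V \<Omega> T c" by (rule VhV[OF assms(9)])
  have eV: "err \<in> V \<Omega> T c" unfolding err_def by (rule V_diff[OF assms(7) uhV])
  note E = V_D[OF eV, folded \<gamma>_def] and U = V_D[OF assms(7)] and Uh = V_D[OF uhV]
  have orth: "a_form \<Omega> c v err = 0" if v: "v \<in> V_h \<Omega> T c" for v
    using a_form_diff[OF U(1) Uh(1) V_D(1)[OF VhV[OF v]], of c] assms(8,10) VhV[OF v] v
    unfolding a_form_commute[of c v] err_def by simp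
  have energy: "a_form \<Omega> c err err = (LINT x|\<Gamma>M. f x * \<gamma> x)"
    using a_form_diff[OF U(1) Uh(1) E(1), of c] orth[OF assms(9)] assms(8) eV
    unfolding err_def[symmetric] by (simp add: b_form_def \<gamma>_def)
  have fL: "f \<in> L2 \<Gamma>M" using assms(6) by (simp add: L2_\<Gamma>_def)
  define A F B where "A = a_norm \<Omega> c err" and "F = L2_norm \<Gamma>M f" and "B = L2_norm \<Gamma>M \<gamma>"
  note an = a_norm_sq[OF assms(2) E(1), folded A_def]
  have nn: "0 \<le> A" "0 \<le> F" "0 \<le> B" using an(4) by (auto simp: F_def B_def)
  have bn: "b_norm \<Omega> T f = F" "b_norm \<Omega> T (bdry_trace \<Omega> T err) = B" by (simp_all add: b_norm_eq F_def B_def \<gamma>_def)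
  have goal: "ennreal A \<le> M_h \<Omega> T c * ennreal F \<and> ennreal B \<le> M_h \<Omega> T c * ennreal A"
  proof (cases "kappa_h \<Omega> T c = \<infinity>")
    case True
    \<comment> \<open>\<open>top * ennreal x\<close> is \<open>top\<close> for \<open>x > 0\<close>
      and 0 for \<open>x = 0\<close>, so what has to be shown is that \<open>F = 0\<close> implies
      \<open>A = 0\<close>, and \<open>A = 0\<close> implies \<open>B = 0\<close>.\<close>
    then have M: "M_h \<Omega> T c = top" by (simp add: M_h_def)
    have "A = 0" if "F = 0"
    proof -
      have "\<bar>LINT x|\<Gamma>M. f x * \<gamma> x\<bar> \<le> F * B" using L2_Cauchy_Schwarz[OF fL E(4)] by (simp add: F_def B_def)
      then have "A\<^sup>2 \<le> 0" using energy an(1) that by simp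
      then show ?thesis by simp
    qed
    moreover have "B = 0" if "A = 0"
      using a_norm_zero_trace_zero[OF assms(2) eV] that by (simp add: A_def B_def \<gamma>_def)
    ultimately show ?thesis unfolding M using nn by (auto simp: ennreal_top_mult)
  next
    case False
    define m where "m = sqrt ((C_eh \<Omega> T)\<^sup>2 + (enn2real (kappa_h \<Omega> T c))\<^sup>2)"
    have m0: "0 \<le> m" by (simp add: m_def)
    have M: "M_h \<Omega> T c = ennreal m" using False by (simp add: M_h_def m_def)
    have key: "\<bar>LINT x|\<Gamma>M. g x * \<gamma> x\<bar> \<le> m * L2_norm \<Gamma>M g * A" if g: "g \<in> L2_\<Gamma> \<Omega> T c" for g
    proof -
      have "\<bar>LINT x|\<Gamma>M. g x * \<gamma> x\<bar> \<le> m * L2_norm \<Gamma>M g * L2_norm \<Omega>M (wgrad \<Omega> err)"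
        unfolding m_def by (rule boundary_functional_bound[OF False g E(1,2) orth])
      also have "\<dots> \<le> m * L2_norm \<Gamma>M g * A" by (intro mult_left_mono an(3)) (use m0 in simp)
      finally show ?thesis .
    qed
    have "A * A \<le> (m * F) * A" using key[OF assms(6)] energy an(1) by (simp add: F_def power2_eq_square)
    \<comment> \<open>The factor \<open>A\<close> is cancelled; for \<open>A = 0\<close> the claim
      is nonnegativity of \<open>m * F\<close>.\<close>
    then have 1: "A \<le> m * F" using nn m0 by (cases "A = 0") (auto simp: mult_le_cancel_right)
    have "(LINT x|\<Gamma>M. \<gamma> x * \<gamma> x) = B * B"
      using L2_norm_sq[of \<Gamma>M \<gamma>] by (simp add: B_def power2_eq_square)
    \<comment> \<open>The trace of \<open>err\<close> is admissible as \<open>g\<close>: for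
      \<open>c = 0\<close> the integral condition of \<open>V\<close> is that of
      \<open>L2_\<Gamma>\<close>.\<close>
    then have "B * B \<le> (m * A) * B" using key[OF E(3)] nn by (simp add: B_def mult_ac)
    then have 2: "B \<le> m * A" using nn m0 by (cases "B = 0") (auto simp: mult_le_cancel_right)
    show ?thesis unfolding M using 1 2 m0 nn by (simp add: ennreal_mult[symmetric] ennreal_leI)
  qed
  \<comment> \<open>The remaining inequality is the first one multiplied by \<open>M_h\<close>; in
    \<open>ennreal\<close> this covers the infinite case too.\<close>
  then have "M_h \<Omega> T c * ennreal A \<le> M_h \<Omega> T c * (M_h \<Omega> T c * ennreal F)"
    by (intro mult_left_mono) auto
  then show ?thesis using goal unfolding bn A_def[symmetric] by (simp add: power2_eq_square mult.assoc)
qed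

end
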